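(* If $\phi\in L^\infty(\mathbb T^2)$, then $\|H_\phi\|=\mathrm{dist}_\infty(\phi,H_1)$.
   Context: $\mathbb T$ is the unit circle. $H_1$ is the closed subspace of $L^\infty(\mathbb T^2)$ consisting of those $f$ whose Fourier series has the form $\sum_{m+n\ge0}a_{m,n}z_1^mz_2^n$ (i.e. the Fourier coefficients with $m+n<0$ vanish), and $\mathrm{dist}_\infty(\phi,H_1)=\inf_{g\in H_1}\|\phi-g\|_{\mathbb T^2,\infty}$. For $\phi\in L^\infty(\mathbb T^2)$ with Fourier series $\sum_{m,n\in\mathbb Z}a_{m,n}z_1^mz_2^n$ and $k\in\mathbb Z$ put $\phi_k(\lambda)=\sum_{m+n=k}a_{m,n}\lambda^n$ (a function in $L^\infty(\mathbb T)$), so that $\phi(z,\lambda z)=\sum_{k\in\mathbb Z}\phi_k(\lambda)z^k$. $M_{\phi_k}$ is multiplication by $\phi_k$ on $L^2(\mathbb T)$. The Hankel operator $H_\phi$ is the operator on $L^2(\mathbb T)\otimes\ell^2(\mathbb N_0)$ given by the block matrix \[H_\phi=\begin{pmatrix}M_{\phi_{-1}}&M_{\phi_{-2}}&M_{\phi_{-3}}&\cdots\\ M_{\phi_{-2}}&M_{\phi_{-3}}&M_{\phi_{-4}}&\cdots\\ M_{\phi_{-3}}&M_{\phi_{-4}}&M_{\phi_{-5}}&\cdots\\ \vdots&\vdots&\vdots&\end{pmatrix}.\] *)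

theory Defs
  imports "HOL-Probability.Probability"
begin

text \<open>Normalised arc length on the unit circle. The underlying space is the circle itself, not
  the complex plane, so functions on the circle have type \<^typ>\<open>complex \<Rightarrow> complex\<close> with
  arbitrary values off the circle.\<close>

definition circle :: "complex measure" where
  "circle = distr (uniform_measure lborel {0..<2 * pi}) (restrict_space borel (sphere 0 1)) cis"

abbreviation torus :: "(complex \<times> complex) measure" where
  "torus \<equiv> circle \<Otimes>\<^sub>M circle"

text \<open>Elements of the Lebesgue spaces are represented by measurable functions; almost everywhere
  equal functions are not identified.\<close>

definition Linf :: "'a measure \<Rightarrow> ('a \<Rightarrow> complex) set" where
  "Linf M = {f \<in> borel_measurable M. \<exists>C::real. AE x in M. norm (f x) \<le> C}"

definition Linf_norm :: "'a measure \<Rightarrow> ('a \<Rightarrow> complex) \<Rightarrow> ennreal" where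
  "Linf_norm M f = esssup M (\<lambda>x. ennreal (norm (f x)))"

definition L2 :: "'a measure \<Rightarrow> ('a \<Rightarrow> complex) set" where
  "L2 M = {f \<in> borel_measurable M. integrable M (\<lambda>x. (norm (f x))\<^sup>2)}"

definition L2_norm :: "'a measure \<Rightarrow> ('a \<Rightarrow> complex) \<Rightarrow> real" where
  "L2_norm M f = sqrt (\<integral>x. (norm (f x))\<^sup>2 \<partial>M)"

definition fourier_coeff :: "(complex \<Rightarrow> complex) \<Rightarrow> int \<Rightarrow> complex" where
  "fourier_coeff f n = (\<integral>z. f z * z powi (- n) \<partial>circle)"

definition fourier_coeff2 :: "(complex \<times> complex \<Rightarrow> complex) \<Rightarrow> int \<Rightarrow> int \<Rightarrow> complex" where
  "fourier_coeff2 f m n =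
     (\<integral>z. f z * fst z powi (- m) * snd z powi (- n) \<partial>torus)"

definition H1 :: "(complex \<times> complex \<Rightarrow> complex) set" where
  "H1 = {f \<in> Linf torus. \<forall>m n. m + n < 0 \<longrightarrow> fourier_coeff2 f m n = 0}"

definition dist_inf ::
    "(complex \<times> complex \<Rightarrow> complex) \<Rightarrow> (complex \<times> complex \<Rightarrow> complex) set \<Rightarrow> ennreal" where
  "dist_inf \<phi> S = (INF g\<in>S. Linf_norm torus (\<lambda>z. \<phi> z - g z))"

text \<open>\<open>component \<phi> k\<close> is the bounded function on the circle with Fourier series
  $\sum_n a_{k-n,n}\lambda^n$, where $a_{m,n}$ are the Fourier coefficients of $\phi$.
  Such a function exists for every essentially bounded $\phi$ (lemma \<open>component\<close> below), and
  it is determined up to null sets by its Fourier coefficients.\<close>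

definition component :: "(complex \<times> complex \<Rightarrow> complex) \<Rightarrow> int \<Rightarrow> complex \<Rightarrow> complex" where
  "component \<phi> k = (SOME f. f \<in> Linf circle \<and>
     (\<forall>n. fourier_coeff f n = fourier_coeff2 \<phi> (k - n) n))"

lemma space_circle [simp]: "space circle = sphere 0 1"
  by (simp add: circle_def space_restrict_space)

lemma sets_circle: "sets circle = sets (restrict_space borel (sphere 0 1))"
  by (simp add: circle_def)

lemma cis_measurable:
  "cis \<in> uniform_measure lborel {0..<2 * pi} \<rightarrow>\<^sub>M restrict_space borel (sphere 0 1)"
proof -
  have "cis \<in> borel_measurable borel"
    by (intro borel_measurable_continuous_onI continuous_intros)
  then show ?thesis
    by (intro measurable_restrict_space2) (auto simp: measurable_def)
qed

lemma prob_space_circle: "prob_space circle"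
proof -
  have "prob_space (uniform_measure lborel {0..<2 * pi})"
    by (rule prob_space_uniform_measure) simp_all
  then show ?thesis
    unfolding circle_def by (rule prob_space.prob_space_distr[OF _ cis_measurable])
qed

lemma id_measurable_circle: "(\<lambda>z. z) \<in> borel_measurable circle"
  using measurable_restrict_space1[of "\<lambda>z. z::complex" borel borel "sphere 0 1"]
  by (simp add: measurable_cong_sets[OF sets_circle refl])

lemma measurable_circleI:
  assumes "f \<in> borel_measurable M" "\<And>x. x \<in> space M \<Longrightarrow> norm (f x) = 1"
  shows "f \<in> M \<rightarrow>\<^sub>M circle"
  unfolding measurable_cong_sets[OF refl sets_circle]
  using assms by (intro measurable_restrict_space2) (auto simp: dist_norm)

lemma emeasure_circle:
  assumes "A \<in> sets circle"
  shows "emeasure circle A = emeasure lborel ({0..<2 * pi} \<inter> cis -` A) / ennreal (2 * pi)"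
proof -
  have m: "cis -` A \<in> sets lborel"
    using measurable_sets[OF cis_measurable, of A] assms by (simp add: sets_circle)
  show ?thesis
    using assms m cis_measurable unfolding sets_circle
    by (simp add: circle_def emeasure_distr)
qed

lemma emeasure_lborel_shift:
  assumes "S \<in> sets borel"
  shows "emeasure lborel ((+) (c::real) -` S) = emeasure lborel S"
proof -
  have "emeasure lborel S = emeasure (distr lborel borel ((+) c)) S"
    by (simp add: lborel_distr_plus)
  also have "\<dots> = emeasure lborel ((+) c -` S)"
    using assms by (subst emeasure_distr) auto
  finally show ?thesis ..
qed

lemma circle_rotate:
  assumes "norm c = 1"
  shows "distr circle circle ((*) c) = circle"
proof (rule measure_eqI)
  fix A assume "A \<in> sets (distr circle circle ((*) c))"
  then have A: "A \<in> sets circle" by simp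
  have rot: "(*) c \<in> circle \<rightarrow>\<^sub>M circle"
    using assms id_measurable_circle
    by (intro measurable_circleI borel_measurable_times) (auto simp: norm_mult)
  obtain t where t: "0 \<le> t" "t < 2 * pi" "c = cis t"
  proof
    show "0 \<le> Arg2pi c" "Arg2pi c < 2 * pi"
      by (rule Arg2pi_ge_0 Arg2pi_lt_2pi)+
    have "c = of_real (norm c) * exp (\<i> * of_real (Arg2pi c))"
      by (rule Arg2pi_eq)
    then show "c = cis (Arg2pi c)"
      unfolding assms cis_conv_exp of_real_1 mult_1_left .
  qed
  define S where "S = cis -` A"
  have S: "S \<in> sets borel"
    using measurable_sets[OF cis_measurable, of A] A by (simp add: sets_circle S_def)
  have per: "2 * pi + x \<in> S \<longleftrightarrow> x \<in> S" for x
    by (simp add: S_def flip: cis_mult)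
  have preS: "x \<in> cis -` ((*) c -` A \<inter> sphere 0 1) \<longleftrightarrow> t + x \<in> S" for x
    by (simp add: S_def t cis_mult)
  have "emeasure lborel ({0..<2 * pi} \<inter> cis -` ((*) c -` A \<inter> sphere 0 1))
      = emeasure lborel ((+) t -` ({t..<t + 2 * pi} \<inter> S))"
    using preS by (intro arg_cong[where f="emeasure lborel"]) auto
  also have "\<dots> = emeasure lborel ({t..<t + 2 * pi} \<inter> S)"
    using S by (intro emeasure_lborel_shift) auto
  also have "{t..<t + 2 * pi} \<inter> S = ({t..<2 * pi} \<inter> S) \<union> ({2 * pi..<t + 2 * pi} \<inter> S)"
    using t by auto
  also have "emeasure lborel \<dots> =
      emeasure lborel ({t..<2 * pi} \<inter> S) + emeasure lborel ({2 * pi..<t + 2 * pi} \<inter> S)"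
    using S by (intro plus_emeasure[symmetric]) auto
  also have "emeasure lborel ({2 * pi..<t + 2 * pi} \<inter> S)
      = emeasure lborel ((+) (2 * pi) -` ({2 * pi..<t + 2 * pi} \<inter> S))"
    using S by (intro emeasure_lborel_shift[symmetric]) auto
  also have "(+) (2 * pi) -` ({2 * pi..<t + 2 * pi} \<inter> S) = {0..<t} \<inter> S"
    by (auto simp: per)
  also have "emeasure lborel ({t..<2 * pi} \<inter> S) + emeasure lborel ({0..<t} \<inter> S)
      = emeasure lborel (({t..<2 * pi} \<inter> S) \<union> ({0..<t} \<inter> S))"
    using S by (intro plus_emeasure) auto
  also have "({t..<2 * pi} \<inter> S) \<union> ({0..<t} \<inter> S) = {0..<2 * pi} \<inter> S"
    using t by auto
  finally have eq: "emeasure lborel ({0..<2 * pi} \<inter> cis -` ((*) c -` A \<inter> sphere 0 1))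
      = emeasure lborel ({0..<2 * pi} \<inter> S)" .
  have "(*) c -` A \<inter> sphere 0 1 \<in> sets circle"
    using measurable_sets[OF rot A] by simp
  then show "emeasure (distr circle circle ((*) c)) A = emeasure circle A"
    using eq A by (simp add: emeasure_distr[OF rot A] emeasure_circle S_def)
qed simp

lemma integral_circle_rotate:
  fixes f :: "complex \<Rightarrow> complex"
  assumes "norm c = 1" "f \<in> borel_measurable circle"
  shows "(\<integral>z. f (c * z) \<partial>circle) = (\<integral>z. f z \<partial>circle)"
proof -
  have rot: "(*) c \<in> circle \<rightarrow>\<^sub>M circle"
    using assms id_measurable_circle
    by (intro measurable_circleI borel_measurable_times) (auto simp: norm_mult)
  show ?thesis
    using integral_distr[OF rot assms(2)] circle_rotate[OF assms(1)] by simp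
qed

lemma powi_measurable_circle:
  assumes "f \<in> M \<rightarrow>\<^sub>M circle"
  shows "(\<lambda>x. f x powi n) \<in> borel_measurable M"
proof -
  have "f \<in> borel_measurable M"
    using measurable_compose[OF assms id_measurable_circle] by simp
  then show ?thesis
    by (cases "n \<ge> 0") (auto simp: power_int_def)
qed

lemma component_exists:
  assumes "\<phi> \<in> Linf torus"
  shows "\<exists>f. f \<in> Linf circle \<and> (\<forall>n. fourier_coeff f n = fourier_coeff2 \<phi> (k - n) n)"
proof -
  interpret C: prob_space circle by (rule prob_space_circle)
  interpret P: pair_prob_space circle circle by standard
  obtain B0 where phi: "\<phi> \<in> borel_measurable torus" and B0: "AE x in torus. norm (\<phi> x) \<le> B0"
    using assms by (auto simp: Linf_def)
  define B where "B = max B0 0"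
  have B: "AE x in torus. norm (\<phi> x) \<le> B" "0 \<le> B"
    using B0 by (auto simp: B_def elim: eventually_mono)
  define \<psi> where "\<psi> x = (if norm (\<phi> x) \<le> B then \<phi> x else 0)" for x
  have psi[measurable]: "\<psi> \<in> borel_measurable torus"
    unfolding \<psi>_def using phi by measurable
  have psiB: "norm (\<psi> x) \<le> B" for x
    using B by (auto simp: \<psi>_def)
  have psieq: "AE x in torus. \<psi> x = \<phi> x"
    using B(1) by eventually_elim (auto simp: \<psi>_def)
  have fst_m[measurable]: "fst \<in> torus \<rightarrow>\<^sub>M circle" and snd_m[measurable]: "snd \<in> torus \<rightarrow>\<^sub>M circle"
    by simp_all
  have id_m[measurable]: "(\<lambda>x. fst x) \<in> borel_measurable torus"
    "(\<lambda>x. snd x) \<in> borel_measurable torus"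
    using measurable_compose[OF fst_m id_measurable_circle]
      measurable_compose[OF snd_m id_measurable_circle] by simp_all
  have pw1: "(\<lambda>x. fst x powi j) \<in> borel_measurable torus"
    and pw2: "(\<lambda>x. snd x powi j) \<in> borel_measurable torus" for j
    using powi_measurable_circle[OF fst_m] powi_measurable_circle[OF snd_m] by simp_all
  have sp: "x \<in> space torus \<longleftrightarrow> norm (fst x) = 1 \<and> norm (snd x) = 1" for x
    by (auto simp: space_pair_measure mem_Times_iff)
  have sh: "(\<lambda>x. (fst x, snd x * fst x)) \<in> torus \<rightarrow>\<^sub>M torus"
    by (intro measurable_Pair fst_m measurable_circleI borel_measurable_times id_m)
       (auto simp: sp norm_mult)
  define g where "g x = \<psi> (fst x, snd x * fst x) * fst x powi (- k)" for x
  have g_m: "g \<in> borel_measurable torus"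
    unfolding g_def using measurable_compose[OF sh psi] pw1[of "- k"]
    by (intro borel_measurable_times) auto
  have gB: "norm (g x) \<le> B" if "norm (fst x) = 1" for x
    using psiB that by (simp add: g_def norm_mult norm_power_int)
  define f where "f w = (\<integral>z. g (z, w) \<partial>circle)" for w
  have g_swap: "(\<lambda>x. g (snd x, fst x)) \<in> borel_measurable torus"
    using measurable_compose[OF measurable_Pair[OF snd_m fst_m] g_m] by simp
  have f_m: "f \<in> borel_measurable circle"
    unfolding f_def using g_swap by (intro C.borel_measurable_lebesgue_integral) (simp add: case_prod_beta')
  have fB: "norm (f w) \<le> B" if "w \<in> space circle" for w
  proof -
    have m: "(\<lambda>z. g (z, w)) \<in> borel_measurable circle"
      using measurable_compose[OF measurable_Pair2'[OF that] g_m] by (simp add: o_def)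
    have i: "integrable circle (\<lambda>z. g (z, w))"
      using m gB by (intro C.integrable_const_bound[where B=B]) auto
    have "norm (f w) \<le> (\<integral>z. norm (g (z, w)) \<partial>circle)"
      unfolding f_def by (rule integral_norm_bound)
    also have "\<dots> \<le> (\<integral>z. B \<partial>circle)"
      using i gB by (intro integral_mono) auto
    finally show ?thesis by (simp add: C.prob_space del: space_circle)
  qed
  have fL: "f \<in> Linf circle"
    using f_m fB by (auto simp: Linf_def intro!: exI[of _ B])
  have "fourier_coeff f n = fourier_coeff2 \<phi> (k - n) n" for n
  proof -
    define h where "h x = g x * snd x powi (- n)" for x
    have h_m: "h \<in> borel_measurable torus"
      unfolding h_def using g_m pw2 by (intro borel_measurable_times) auto
    have hI: "integrable torus h"
      using h_m gB by (intro P.integrable_const_bound[where B=B])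
        (auto simp: h_def norm_mult norm_power_int sp intro!: AE_I2)
    define q where "q x = \<psi> x * fst x powi (- (k - n)) * snd x powi (- n)" for x
    have q_m: "q \<in> borel_measurable torus"
      unfolding q_def using psi pw1 pw2 by (intro borel_measurable_times) auto
    have qI: "integrable torus q"
      using q_m psiB by (intro P.integrable_const_bound[where B=B])
        (auto simp: q_def norm_mult norm_power_int sp intro!: AE_I2)
    have "fourier_coeff f n = (\<integral>w. (\<integral>z. h (z, w) \<partial>circle) \<partial>circle)"
      by (simp add: fourier_coeff_def f_def h_def)
    also have "\<dots> = (\<integral>z. (\<integral>w. h (z, w) \<partial>circle) \<partial>circle)"
      using P.Fubini_integral[of "\<lambda>z w. h (z, w)"] hI by simp
    also have "\<dots> = (\<integral>z. (\<integral>w. q (z, w) \<partial>circle) \<partial>circle)"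
    proof (rule Bochner_Integration.integral_cong)
      fix z assume z: "z \<in> space circle"
      then have nz: "norm z = 1" "z \<noteq> 0" by auto
      have m: "(\<lambda>w. q (z, w)) \<in> borel_measurable circle"
        using measurable_compose[OF measurable_Pair1'[OF z] q_m] by (simp add: o_def)
      have "h (z, w) = q (z, z * w)" for w
      proof -
        have "(z * w) powi (- n) = z powi (- n) * w powi (- n)"
          by (rule power_int_mult_distrib)
        moreover have "z powi (- (k - n)) * z powi (- n) = z powi (- k)"
          using nz by (simp flip: power_int_add)
        ultimately show ?thesis
          by (simp add: h_def g_def q_def mult.assoc) (simp add: mult_ac)
      qed
      then show "(\<integral>w. h (z, w) \<partial>circle) = (\<integral>w. q (z, w) \<partial>circle)"
        using integral_circle_rotate[OF nz(1) m] by simp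
    qed simp
    also have "\<dots> = (\<integral>x. q x \<partial>torus)"
      using P.integral_fst'[OF qI] by simp
    also have "\<dots> = (\<integral>x. \<phi> x * fst x powi (- (k - n)) * snd x powi (- n) \<partial>torus)"
    proof (rule integral_cong_AE)
      show "(\<lambda>x. \<phi> x * fst x powi (- (k - n)) * snd x powi (- n)) \<in> borel_measurable torus"
        using phi pw1 pw2 by (intro borel_measurable_times) auto
      show "AE x in torus. q x = \<phi> x * fst x powi (- (k - n)) * snd x powi (- n)"
        using psieq by eventually_elim (simp add: q_def)
    qed (rule q_m)
    finally show ?thesis by (simp add: fourier_coeff2_def)
  qed
  then show ?thesis using fL by blast
qed

lemma component:
  assumes "\<phi> \<in> Linf torus"
  shows "component \<phi> k \<in> Linf circle"
    and "fourier_coeff (component \<phi> k) n = fourier_coeff2 \<phi> (k - n) n"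
  using someI_ex[OF component_exists[OF assms, of k]] by (auto simp: component_def)

definition mult_op :: "('a \<Rightarrow> complex) \<Rightarrow> ('a \<Rightarrow> complex) \<Rightarrow> 'a \<Rightarrow> complex" where
  "mult_op f g = (\<lambda>x. f x * g x)"

text \<open>The Hilbert tensor product $L^2\otimes\ell^2(\mathbb N_0)$, on which block matrices act, is
  represented as the Hilbert space direct sum of countably many copies of $L^2$.\<close>

definition l2_L2 :: "'a measure \<Rightarrow> (nat \<Rightarrow> 'a \<Rightarrow> complex) set" where
  "l2_L2 M = {F. (\<forall>j. F j \<in> L2 M) \<and> summable (\<lambda>j. (L2_norm M (F j))\<^sup>2)}"

definition l2_L2_norm :: "'a measure \<Rightarrow> (nat \<Rightarrow> 'a \<Rightarrow> complex) \<Rightarrow> real" where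
  "l2_L2_norm M F = sqrt (\<Sum>j. (L2_norm M (F j))\<^sup>2)"

text \<open>\<open>block_image M A F G\<close> says that $G_i=\sum_j A_{ij}F_j$ for all $i$, with convergence in
  $L^2$. It is a relation because $G$ is determined only up to null sets.\<close>

definition block_image :: "'a measure \<Rightarrow> (nat \<Rightarrow> nat \<Rightarrow> ('a \<Rightarrow> complex) \<Rightarrow> 'a \<Rightarrow> complex) \<Rightarrow>
    (nat \<Rightarrow> 'a \<Rightarrow> complex) \<Rightarrow> (nat \<Rightarrow> 'a \<Rightarrow> complex) \<Rightarrow> bool" where
  "block_image M A F G \<longleftrightarrow>
     (\<forall>i. (\<forall>j. A i j (F j) \<in> L2 M) \<and> G i \<in> L2 M \<and>
        (\<lambda>N. L2_norm M (\<lambda>x. G i x - (\<Sum>j<N. A i j (F j) x))) \<longlonglongrightarrow> 0)"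

text \<open>The operator norm of a block matrix; it is finite exactly if the matrix defines a bounded
  operator on the whole of \<^term>\<open>l2_L2 M\<close>, and \<open>\<infinity>\<close> otherwise.\<close>

definition block_op_norm ::
    "'a measure \<Rightarrow> (nat \<Rightarrow> nat \<Rightarrow> ('a \<Rightarrow> complex) \<Rightarrow> 'a \<Rightarrow> complex) \<Rightarrow> ennreal" where
  "block_op_norm M A = Inf {ennreal C | C. 0 \<le> C \<and>
     (\<forall>F \<in> l2_L2 M. \<exists>G \<in> l2_L2 M. block_image M A F G \<and>
        l2_L2_norm M G \<le> C * l2_L2_norm M F)}"

definition hankel ::
    "(complex \<times> complex \<Rightarrow> complex) \<Rightarrow> nat \<Rightarrow> nat \<Rightarrow> (complex \<Rightarrow> complex) \<Rightarrow> complex \<Rightarrow> complex" where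
  "hankel \<phi> i j = mult_op (component \<phi> (- (int i + int j + 1)))"

end

theory Submission
  imports Defs "HOL-Complex_Analysis.Complex_Analysis"
    "HOL-Computational_Algebra.Fundamental_Theorem_Algebra" "HOL-Library.Function_Algebras"
begin

text \<open>In the coordinates \<open>(\<lambda>, z) \<mapsto> (z, \<lambda> z)\<close> the operator $H_\phi$ acts for almost every \<open>\<lambda>\<close> as the
  scalar Hankel matrix of $z \mapsto \phi(z, \lambda z)$, so \<open>\<parallel>H\<^sub>\<phi>\<parallel> \<le> C\<close> means that almost all of
  these matrices are bounded by \<open>C\<close>. If \<open>g\<close> lies in $H_1$, then \<open>\<phi>\<close> and \<open>\<phi> - g\<close> have the same
  Hankel matrices, and Bessel's inequality in \<open>z\<close> bounds them by the supremum norm of \<open>\<phi> - g\<close>.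

  Conversely, let almost all matrices be bounded by \<open>C\<close>. A polynomial in \<open>z\<close> factors as \<open>g h\<close> with
  \<open>|g|\<^sup>2 = |h|\<^sup>2 = |p|\<close> on the circle; hence the functional \<open>f \<mapsto> \<integral> \<phi> f\<close>, restricted to the \<open>f\<close> that are
  polynomials in \<open>z\<close> without constant term for each \<open>\<lambda>\<close>, has norm at most \<open>C\<close> in $L^1$. Only the
  norm of \<open>f\<close> in each fibre enters, so no measurable choice of the factorization is needed. By
  Hahn-Banach and Radon-Nikodym the functional is given by some \<open>\<psi>\<close> with \<open>|\<psi>| \<le> C\<close>, and
  \<open>\<phi> - \<psi>\<close> lies in $H_1$.\<close>

section \<open>Extension and representation of functionals on $L^1$\<close>

text \<open>An equality tolerates no lost constant. Splitting a polynomial into factors of equal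
  modulus on the circle serves this: if \<open>a\<close> and \<open>b\<close> are their Taylor
  coefficients, the functional at the product is the sum of \<open>c (i + j) * a i * b j\<close>,
  and Cauchy-Schwarz yields exactly the L1 norm. As only polynomials are factored, finitely many
  Blaschke factors and square roots suffice. The blocks are multiplication operators, hence diagonal
  in \<lambda>, which is what permits scalar matrices. Solving the scalar problem in each fibre
  would leave the task of choosing the solutions measurably in \<lambda>; therefore the fibre
  estimates are integrated, and a single extension is made on the whole torus. The constant term is
  absent because entry \<open>(i, j)\<close> has index \<open>-(i + j + 1)\<close> and is paired
  with the power \<open>i + j + 1\<close> of \<open>z\<close>. Components are known only through
  their Fourier coefficients. A uniqueness theorem identifies them with integrals along fibres, and
  countability moves the quantifier over test vectors inside "almost every".\<close>

text \<open>By Zorn's lemma there is a minimal sublinear functional \<open>u \<le> p\<close>. For fixed \<open>y\<close> the functional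
  \<open>v x = inf {u (x + t y) - t u y | t \<ge> 0}\<close> is again sublinear and below \<open>u\<close>, so \<open>v = u\<close>, and
  \<open>t = 1\<close> gives superadditivity of \<open>u\<close>.\<close>

lemma minimal_sublinear:
  fixes scale :: "real \<Rightarrow> 'v::ab_group_add \<Rightarrow> 'v"
  assumes "vector_space scale" "module.subspace scale V"
  defines "sublin \<equiv> \<lambda>q::'v \<Rightarrow> real. (\<forall>x\<in>V. \<forall>y\<in>V. q (x + y) \<le> q x + q y) \<and>
      (\<forall>x\<in>V. \<forall>t\<ge>0. q (scale t x) = t * q x)"
  assumes p: "sublin p"
  obtains u where "\<And>x y. x \<in> V \<Longrightarrow> y \<in> V \<Longrightarrow> u (x + y) = u x + u y"
    "\<And>t x. x \<in> V \<Longrightarrow> u (scale t x) = t * u x" "\<And>x. x \<in> V \<Longrightarrow> u x \<le> p x"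
proof -
  interpret vector_space scale by fact
  have V: "0 \<in> V" "\<And>x y. x \<in> V \<Longrightarrow> y \<in> V \<Longrightarrow> x + y \<in> V" "\<And>t x. x \<in> V \<Longrightarrow> scale t x \<in> V"
    "\<And>x. x \<in> V \<Longrightarrow> - x \<in> V"
    using assms(2) by (blast intro: subspace_0 subspace_add subspace_scale subspace_neg)+
  have q0: "q 0 = 0" if "sublin q" for q
    using that V(1) unfolding sublin_def by (metis mult_zero_left order_refl scale_zero_left)
  have qneg: "- q (- x) \<le> q x" if "sublin q" "x \<in> V" for q x
  proof -
    have "q (x + - x) \<le> q x + q (- x)"
      using that V(4)[OF that(2)] unfolding sublin_def by blast
    then show ?thesis
      using q0[OF that(1)] by simp
  qed
  \<comment> \<open>Off \<open>V\<close> the values are fixed to 0: otherwise they could decrease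
    without bound and a chain might have no lower bound. \<open>R\<close> reverses the pointwise
    order because Zorn's lemma delivers maximal elements.\<close>
  define Q where "Q = {q. sublin q \<and> (\<forall>x. x \<notin> V \<longrightarrow> q x = 0) \<and> (\<forall>x\<in>V. q x \<le> p x)}"
  define R where "R = (\<lambda>q q'::'v \<Rightarrow> real. \<forall>x. q' x \<le> q x)"
  have Qlow: "- p (- x) \<le> q x" if "q \<in> Q" "x \<in> V" for q x
    using qneg[of q x] that V(4)[OF that(2)] by (force simp: Q_def)
  have po: "partial_order_on Q (relation_of R Q)"
    unfolding R_def
    by (rule partial_order_on_relation_ofI) (auto intro: order_trans simp: fun_eq_iff antisym)
  define p' where "p' x = (if x \<in> V then p x else 0)" for x
  have p': "p' \<in> Q"
    using p V unfolding Q_def sublin_def p'_def by auto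
  have "\<exists>u\<in>Q. \<forall>a\<in>C. R a u" if C: "C \<in> Chains (relation_of R Q)" for C
  proof (cases "C = {}")
    case False
    have CQ: "C \<subseteq> Q" and tot: "\<And>a b. a \<in> C \<Longrightarrow> b \<in> C \<Longrightarrow> R a b \<or> R b a"
      using C by (auto simp: Chains_def relation_of_def)
    define u where "u x = (if x \<in> V then (INF q\<in>C. q x) else 0)" for x
    have bdd: "bdd_below ((\<lambda>q. q x) ` C)" if "x \<in> V" for x
      using Qlow CQ that by (intro bdd_belowI2[where m="- p (- x)"]) auto
    have ule: "u x \<le> q x" if "q \<in> C" for q x
    proof (cases "x \<in> V")
      case True
      then show ?thesis
        using cINF_lower[OF bdd[OF True] that] by (simp add: u_def)
    next
      case False
      moreover have "q x = 0"
        using CQ that False by (auto simp: Q_def)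
      ultimately show ?thesis
        by (simp add: u_def)
    qed
    have ugr: "b \<le> u x" if "x \<in> V" "\<And>q. q \<in> C \<Longrightarrow> b \<le> q x" for b x
      using that False by (auto simp: u_def intro!: cINF_greatest)
    have "u \<in> Q"
      unfolding Q_def sublin_def
    proof (intro CollectI conjI ballI allI impI)
      fix x y assume x: "x \<in> V" and y: "y \<in> V"
      have "u (x + y) \<le> q1 x + q2 y" if C12: "q1 \<in> C" "q2 \<in> C" for q1 q2
      proof -
        obtain q where q: "q \<in> C" "q x \<le> q1 x" "q y \<le> q2 y"
          using tot[OF C12] C12 unfolding R_def by (metis order_refl)
        have "u (x + y) \<le> q (x + y)"
          by (rule ule[OF q(1)])
        also have "\<dots> \<le> q x + q y"
          using q(1) CQ x y by (auto simp: Q_def sublin_def)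
        finally show ?thesis
          using q by linarith
      qed
      then have "u (x + y) - q2 y \<le> u x" if "q2 \<in> C" for q2
        using that x by (intro ugr) (auto simp: algebra_simps)
      then have "u (x + y) - u x \<le> u y"
        using y by (intro ugr) (auto simp: algebra_simps)
      then show "u (x + y) \<le> u x + u y"
        by simp
    next
      fix x t assume x: "x \<in> V" and t: "(0::real) \<le> t"
      have *: "q (scale t x) = t * q x" if "q \<in> C" "0 \<le> t" "x \<in> V" for q t x
        using that CQ by (auto simp: Q_def sublin_def)
      have le: "t * u x \<le> u (scale t x)" if "0 \<le> t" "x \<in> V" for t x
        using that ule by (intro ugr V) (auto simp: * intro!: mult_left_mono)
      show "u (scale t x) = t * u x"
      proof (cases "t = 0")
        case True
        obtain q where "q \<in> C"
          using False by auto
        have C0: "q 0 = 0" if "q \<in> C" for q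
          using q0[of q] CQ that by (auto simp: Q_def)
        have "u 0 \<le> 0" "0 \<le> u 0"
          using ule[OF \<open>q \<in> C\<close>, of 0] C0[OF \<open>q \<in> C\<close>] by (simp, intro ugr V, simp add: C0)
        then show ?thesis
          using True by simp
      next
        case False
        then have "inverse t * u (scale t x) \<le> u x"
          using le[of "inverse t" "scale t x"] t x V by simp
        then show ?thesis
          using False t le[OF t x] by (simp add: field_simps)
      qed
    next
      fix x assume "x \<in> V"
      obtain q where "q \<in> C"
        using False by auto
      then show "u x \<le> p x"
        using ule[of q x] CQ \<open>x \<in> V\<close> by (force simp: Q_def)
    qed (simp add: u_def)
    then show ?thesis
      using ule by (auto simp: R_def)
  qed (use p' in auto)
  from predicate_Zorn[OF po this] obtain u where u: "u \<in> Q"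
    and min: "\<And>q. q \<in> Q \<Longrightarrow> R u q \<Longrightarrow> q = u"
    by blast
  have su: "sublin u"
    using u by (simp add: Q_def)
  have sub: "u (x + y) \<le> u x + u y" if "x \<in> V" "y \<in> V" for x y
    using su that by (auto simp: sublin_def)
  have hom: "u (scale t x) = t * u x" if "x \<in> V" "t \<ge> 0" for x t
    using su that by (auto simp: sublin_def)
  have super: "u x + u y \<le> u (x + y)" if x: "x \<in> V" and y: "y \<in> V" for x y
  proof -
    define v where "v x = (if x \<in> V then (INF t\<in>{0..}. u (x + scale t y) - t * u y) else 0)" for x
    have lower: "- u (- x) \<le> u (x + scale t y) - t * u y" if "x \<in> V" "t \<ge> 0" for x t
      using sub[of "- x" "x + scale t y"] hom[OF y that(2)] that V y by (simp add: algebra_simps)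
    have bdd: "bdd_below ((\<lambda>t. u (x + scale t y) - t * u y) ` {0..})" if "x \<in> V" for x
      using lower that by (intro bdd_belowI2[where m="- u (- x)"]) auto
    have vle: "v x \<le> u (x + scale t y) - t * u y" if "x \<in> V" "t \<ge> 0" for x t
      using cINF_lower[OF bdd[OF that(1)], of t] that by (simp add: v_def)
    have vgr: "b \<le> v x" if "x \<in> V" "\<And>t. t \<ge> 0 \<Longrightarrow> b \<le> u (x + scale t y) - t * u y" for b x
      using that by (auto simp: v_def intro!: cINF_greatest)
    have vu: "v x \<le> u x" for x
      using vle[of x 0] u by (cases "x \<in> V") (auto simp: v_def Q_def)
    have "v \<in> Q"
      unfolding Q_def sublin_def
    proof (intro CollectI conjI ballI allI impI)
      fix a b assume a: "a \<in> V" and b: "b \<in> V"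
      have "v (a + b) \<le> (u (a + scale s y) - s * u y) + (u (b + scale t y) - t * u y)"
        if "s \<ge> 0" "t \<ge> 0" for s t
      proof -
        have "v (a + b) \<le> u ((a + b) + scale (s + t) y) - (s + t) * u y"
          using that a b V by (intro vle) auto
        also have "(a + b) + scale (s + t) y = (a + scale s y) + (b + scale t y)"
          by (simp add: scale_left_distrib algebra_simps)
        also have "u \<dots> \<le> u (a + scale s y) + u (b + scale t y)"
          using a b y V by (intro sub) auto
        finally show ?thesis
          by (simp add: algebra_simps)
      qed
      then have "v (a + b) - (u (b + scale t y) - t * u y) \<le> v a" if "t \<ge> 0" for t
        using that a by (intro vgr) (auto simp: algebra_simps)
      then have "v (a + b) - v a \<le> v b"
        using b by (intro vgr) (auto simp: algebra_simps)
      then show "v (a + b) \<le> v a + v b"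
        by simp
    next
      fix a s assume a: "a \<in> V" and s: "(0::real) \<le> s"
      have le: "s * v a \<le> v (scale s a)" if a: "a \<in> V" and s: "0 < s" for s a
      proof (rule vgr)
        fix t :: real assume t: "t \<ge> 0"
        have "s * v a \<le> s * (u (a + scale (t / s) y) - t / s * u y)"
          using a s t by (intro mult_left_mono vle) auto
        also have "\<dots> = u (scale s (a + scale (t / s) y)) - t * u y"
          using hom[of "a + scale (t / s) y" s] a y s V by (simp add: algebra_simps)
        also have "scale s (a + scale (t / s) y) = scale s a + scale t y"
          using s by (simp add: scale_right_distrib)
        finally show "s * v a \<le> u (scale s a + scale t y) - t * u y" .
      qed (use a V in auto)
      show "v (scale s a) = s * v a"
      proof (cases "s = 0")
        case True
        have "0 \<le> v 0"
          using hom[OF y] V by (intro vgr) auto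
        then show ?thesis
          using vu[of 0] q0[OF su] True by simp
      next
        case False
        then have "inverse s * v (scale s a) \<le> v a"
          using le[of "scale s a" "inverse s"] s a V by simp
        then show ?thesis
          using False s le[OF a, of s] by (simp add: field_simps)
      qed
    next
      fix a assume "a \<in> V"
      then show "v a \<le> p a"
        using order_trans[OF vu] u by (auto simp: Q_def)
    qed (simp add: v_def)
    then have "v = u"
      using min vu by (simp add: R_def)
    then show ?thesis
      using vle[OF x, of 1] by simp
  qed
  have add: "u (x + y) = u x + u y" if "x \<in> V" "y \<in> V" for x y
    using sub super that by (simp add: antisym)
  have neg: "u (- x) = - u x" if "x \<in> V" for x
    using add[of x "- x"] that V q0[OF su] by simp
  have "u (scale t x) = t * u x" if "x \<in> V" for t x
  proof (cases "t \<ge> 0")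
    case False
    then have "u (scale (- t) x) = - t * u x"
      using hom[OF that, of "- t"] by simp
    moreover have "u (- scale t x) = - u (scale t x)"
      using neg V that by simp
    ultimately show ?thesis
      by simp
  qed (use hom that in auto)
  moreover have "u x \<le> p x" if "x \<in> V" for x
    using u that by (simp add: Q_def)
  ultimately show thesis
    using that[of u] add by blast
qed

text \<open>The infimum \<open>q x\<close> of \<open>p (x + w) - L w\<close> over \<open>w\<close>
  in \<open>W\<close> is sublinear and at most \<open>p\<close>, and it encodes \<open>L\<close>:
  the shift \<open>w\<close> at the point \<open>-w\<close> gives
  \<open>q (- w) \<le> - L w\<close>. A linear \<open>u \<le> q\<close> therefore dominates
  \<open>L\<close> on \<open>W\<close>, and the same at \<open>-w\<close> gives equality.\<close>

lemma hahn_banach: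
  fixes scale :: "real \<Rightarrow> 'v::ab_group_add \<Rightarrow> 'v"
  assumes vs: "vector_space scale" and V: "module.subspace scale V"
    and W: "module.subspace scale W" "W \<subseteq> V"
    and p_add: "\<And>x y. x \<in> V \<Longrightarrow> y \<in> V \<Longrightarrow> p (x + y) \<le> p x + p y"
    and p_scale: "\<And>t x. x \<in> V \<Longrightarrow> t \<ge> 0 \<Longrightarrow> p (scale t x) = t * p x"
    and L_add: "\<And>x y. x \<in> W \<Longrightarrow> y \<in> W \<Longrightarrow> L (x + y) = L x + L y"
    and L_scale: "\<And>t x. x \<in> W \<Longrightarrow> L (scale t x) = t * L x"
    and L_le: "\<And>x. x \<in> W \<Longrightarrow> L x \<le> p x"
  obtains u :: "'v \<Rightarrow> real"
  where "\<And>x y. x \<in> V \<Longrightarrow> y \<in> V \<Longrightarrow> u (x + y) = u x + u y"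
    "\<And>t x. x \<in> V \<Longrightarrow> u (scale t x) = t * u x" "\<And>x. x \<in> V \<Longrightarrow> u x \<le> p x"
    "\<And>x. x \<in> W \<Longrightarrow> u x = L x"
proof -
  interpret vector_space scale by fact
  have VV: "0 \<in> V" "\<And>x y. x \<in> V \<Longrightarrow> y \<in> V \<Longrightarrow> x + y \<in> V" "\<And>t x. x \<in> V \<Longrightarrow> scale t x \<in> V"
    "\<And>x. x \<in> V \<Longrightarrow> - x \<in> V"
    using V by (blast intro: subspace_0 subspace_add subspace_scale subspace_neg)+
  have WW: "0 \<in> W" "\<And>x y. x \<in> W \<Longrightarrow> y \<in> W \<Longrightarrow> x + y \<in> W" "\<And>t x. x \<in> W \<Longrightarrow> scale t x \<in> W"
    "\<And>x. x \<in> W \<Longrightarrow> - x \<in> W" "\<And>x. x \<in> W \<Longrightarrow> x \<in> V"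
    using W by (blast intro: subspace_0 subspace_add subspace_scale subspace_neg)+
  define q where "q x = (INF w\<in>W. p (x + w) - L w)" for x
  have Lneg: "L (- w) = - L w" if "w \<in> W" for w
    using L_scale[OF that, of "- 1"] by simp
  have L0: "L 0 = 0"
    using L_scale[OF WW(1), of 0] by simp
  have lower: "- p (- x) \<le> p (x + w) - L w" if "x \<in> V" "w \<in> W" for x w
  proof -
    have "L w \<le> p ((x + w) + - x)"
      using L_le[OF that(2)] by (simp add: algebra_simps)
    also have "\<dots> \<le> p (x + w) + p (- x)"
      using that VV WW by (intro p_add) auto
    finally show ?thesis by simp
  qed
  have bdd: "bdd_below ((\<lambda>w. p (x + w) - L w) ` W)" if "x \<in> V" for x
    using lower that by (intro bdd_belowI2[where m="- p (- x)"]) auto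
  have qle: "q x \<le> p (x + w) - L w" if "x \<in> V" "w \<in> W" for x w
    unfolding q_def by (rule cINF_lower[OF bdd[OF that(1)] that(2)])
  have qgr: "b \<le> q x" if "\<And>w. w \<in> W \<Longrightarrow> b \<le> p (x + w) - L w" for b x
    unfolding q_def using that WW(1) by (auto intro!: cINF_greatest)
  have q_add: "q (x + y) \<le> q x + q y" if x: "x \<in> V" and y: "y \<in> V" for x y
  proof -
    have "q (x + y) \<le> (p (x + a) - L a) + (p (y + b) - L b)" if "a \<in> W" "b \<in> W" for a b
    proof -
      have "q (x + y) \<le> p ((x + y) + (a + b)) - L (a + b)"
        using that x y VV WW by (intro qle) auto
      also have "(x + y) + (a + b) = (x + a) + (y + b)"
        by (simp add: algebra_simps)
      also have "p \<dots> \<le> p (x + a) + p (y + b)"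
        using that x y VV WW by (intro p_add) auto
      finally show ?thesis
        using L_add[OF that] by simp
    qed
    then have "q (x + y) - (p (y + b) - L b) \<le> q x" if "b \<in> W" for b
      using that by (intro qgr) (auto simp: algebra_simps)
    then have "q (x + y) - q x \<le> q y"
      by (intro qgr) (auto simp: algebra_simps)
    then show ?thesis
      by simp
  qed
  have q_scale: "q (scale t x) = t * q x" if x: "x \<in> V" and t: "t \<ge> 0" for t x
  proof -
    have le: "t * q x \<le> q (scale t x)" if t: "t > 0" and x: "x \<in> V" for t x
    proof (rule qgr)
      fix w assume w: "w \<in> W"
      have "t * q x \<le> t * (p (x + scale (inverse t) w) - L (scale (inverse t) w))"
        using t x w WW by (intro mult_left_mono qle) auto
      also have "\<dots> = p (scale t (x + scale (inverse t) w)) - L w"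
        using p_scale[of "x + scale (inverse t) w" t] L_scale[OF w, of "inverse t"] t x w VV WW
        by (simp add: algebra_simps)
      also have "scale t (x + scale (inverse t) w) = scale t x + w"
        using t by (simp add: scale_right_distrib)
      finally show "t * q x \<le> p (scale t x + w) - L w" .
    qed
    show ?thesis
    proof (cases "t = 0")
      case True
      have "q 0 \<le> 0"
        using qle[OF VV(1) WW(1)] p_scale[OF VV(1), of 0] L0 by simp
      moreover have "0 \<le> q 0"
        using L_le by (intro qgr) auto
      ultimately show ?thesis
        using True by simp
    next
      case False
      then have "inverse t * q (scale t x) \<le> q x"
        using le[of "inverse t" "scale t x"] t x VV by simp
      then show ?thesis
        using False t le[OF _ x, of t] by (simp add: field_simps)
    qed
  qed
  obtain u where u_add: "\<And>x y. x \<in> V \<Longrightarrow> y \<in> V \<Longrightarrow> u (x + y) = u x + u y"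
    and u_scale: "\<And>t x. x \<in> V \<Longrightarrow> u (scale t x) = t * u x" and uq: "\<And>x. x \<in> V \<Longrightarrow> u x \<le> q x"
    using minimal_sublinear[OF vs V, of q] q_add q_scale by metis
  have up: "u x \<le> p x" if "x \<in> V" for x
    using uq[OF that] qle[OF that WW(1)] L0 by simp
  have ge: "L w \<le> u w" if "w \<in> W" for w
  proof -
    have "u (- w) \<le> - L w"
      using uq[of "- w"] qle[of "- w" w] that WW p_scale[OF VV(1), of 0] by simp
    then show ?thesis
      using u_scale[of w "- 1"] that WW by simp
  qed
  have "u w = L w" if "w \<in> W" for w
    using ge[OF that] ge[of "- w"] that WW u_scale[of w "- 1"] Lneg by (simp add: antisym)
  then show thesis
    using that[of u] u_add u_scale up by blast
qed


text \<open>Reduction to the real part: a real-linear \<open>u\<close> extends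
  \<open>Re (L f)\<close>, and \<open>u f - \<i> * u (\<i> * f)\<close> is the complex-linear
  functional with real part \<open>u\<close>. The one-sided bound for \<open>u\<close> bounds the
  modulus, because a factor \<open>c\<close> with \<open>norm c \<le> 1\<close> makes the value real
  and nonnegative.\<close>

lemma hahn_banach_L1:
  fixes L :: "('a \<Rightarrow> complex) \<Rightarrow> complex"
  assumes C: "C \<ge> 0"
    and W_int: "\<And>f. f \<in> W \<Longrightarrow> integrable M f"
    and W_zero: "(\<lambda>_. 0) \<in> W"
    and W_add: "\<And>f g. f \<in> W \<Longrightarrow> g \<in> W \<Longrightarrow> (\<lambda>x. f x + g x) \<in> W"
    and W_scale: "\<And>c f. f \<in> W \<Longrightarrow> (\<lambda>x. c * f x) \<in> W"
    and L_add: "\<And>f g. f \<in> W \<Longrightarrow> g \<in> W \<Longrightarrow> L (\<lambda>x. f x + g x) = L f + L g"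
    and L_scale: "\<And>c f. f \<in> W \<Longrightarrow> L (\<lambda>x. c * f x) = c * L f"
    and L_le: "\<And>f. f \<in> W \<Longrightarrow> norm (L f) \<le> C * (\<integral>x. norm (f x) \<partial>M)"
  obtains \<Lambda> :: "('a \<Rightarrow> complex) \<Rightarrow> complex"
  where "\<And>f g. integrable M f \<Longrightarrow> integrable M g \<Longrightarrow> \<Lambda> (\<lambda>x. f x + g x) = \<Lambda> f + \<Lambda> g"
    "\<And>c f. integrable M f \<Longrightarrow> \<Lambda> (\<lambda>x. c * f x) = c * \<Lambda> f"
    "\<And>f. integrable M f \<Longrightarrow> norm (\<Lambda> f) \<le> C * (\<integral>x. norm (f x) \<partial>M)"
    "\<And>f. f \<in> W \<Longrightarrow> \<Lambda> f = L f"
proof -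
  define scale where "scale = (\<lambda>r (f::'a \<Rightarrow> complex) x. of_real r * f x)"
  have vs: "vector_space scale"
    by unfold_locales (auto simp: scale_def fun_eq_iff algebra_simps)
  interpret vector_space scale by fact
  define p where "p f = C * (\<integral>x. norm (f x) \<partial>M)" for f :: "'a \<Rightarrow> complex"
  obtain u where u_add: "\<And>f g. integrable M f \<Longrightarrow> integrable M g \<Longrightarrow> u (f + g) = u f + u g"
    and u_scale: "\<And>t f. integrable M f \<Longrightarrow> u (scale t f) = t * u f"
    and u_le: "\<And>f. integrable M f \<Longrightarrow> u f \<le> p f"
    and u_eq: "\<And>f. f \<in> W \<Longrightarrow> u f = Re (L f)"
  proof (rule hahn_banach[OF vs, of "{f. integrable M f}" W p "\<lambda>f. Re (L f)"])
    show "subspace {f. integrable M f}"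
      by (rule subspaceI) (auto simp: scale_def zero_fun_def plus_fun_def)
    show "subspace W"
      using W_zero W_add W_scale by (intro subspaceI) (auto simp: scale_def zero_fun_def plus_fun_def)
    show "W \<subseteq> {f. integrable M f}"
      using W_int by auto
  next
    fix f g :: "'a \<Rightarrow> complex" assume "f \<in> {f. integrable M f}" "g \<in> {f. integrable M f}"
    then have fg: "integrable M f" "integrable M g"
      by auto
    have "(\<integral>x. norm (f x + g x) \<partial>M) \<le> (\<integral>x. norm (f x) + norm (g x) \<partial>M)"
      using fg by (intro integral_mono) (auto intro: norm_triangle_ineq)
    also have "\<dots> = (\<integral>x. norm (f x) \<partial>M) + (\<integral>x. norm (g x) \<partial>M)"
      using fg by simp
    finally show "p (f + g) \<le> p f + p g"
      using C by (simp add: p_def plus_fun_def mult_left_mono flip: distrib_left)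
  next
    fix f g assume "f \<in> W" "g \<in> W"
    then show "Re (L (f + g)) = Re (L f) + Re (L g)"
      using L_add by (simp add: plus_fun_def)
  next
    fix f assume "f \<in> W"
    then show "Re (L f) \<le> p f"
      using L_le[of f] complex_Re_le_cmod[of "L f"] by (simp add: p_def)
  next
    fix t f assume "f \<in> W"
    then show "Re (L (scale t f)) = t * Re (L f)"
      using L_scale by (simp add: scale_def)
  qed (auto simp: p_def scale_def norm_mult)
  have uadd: "u (\<lambda>x. f x + g x) = u f + u g" if "integrable M f" "integrable M g" for f g
    using u_add[OF that] by (simp add: plus_fun_def)
  have uscale: "u (\<lambda>x. of_real t * f x) = t * u f" if "integrable M f" for t f
    using u_scale[OF that] by (simp add: scale_def)
  define \<Lambda> where "\<Lambda> f = Complex (u f) (- u (\<lambda>x. \<i> * f x))" for f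
  have add: "\<Lambda> (\<lambda>x. f x + g x) = \<Lambda> f + \<Lambda> g" if "integrable M f" "integrable M g" for f g
    using uadd[OF that] uadd[of "\<lambda>x. \<i> * f x" "\<lambda>x. \<i> * g x"] that
    by (simp add: \<Lambda>_def complex_eq_iff distrib_left)
  have hom: "\<Lambda> (\<lambda>x. c * f x) = c * \<Lambda> f" if f: "integrable M f" for c f
  proof -
    have real: "u (\<lambda>x. d * f x) = Re d * u f + Im d * u (\<lambda>x. \<i> * f x)" for d
    proof -
      have "(\<lambda>x. d * f x) = (\<lambda>x. of_real (Re d) * f x + of_real (Im d) * (\<i> * f x))"
        by (simp add: fun_eq_iff complex_eq_iff)
      then show ?thesis
        using uadd[of "\<lambda>x. of_real (Re d) * f x" "\<lambda>x. of_real (Im d) * (\<i> * f x)"]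
          uscale[of f "Re d"] uscale[of "\<lambda>x. \<i> * f x" "Im d"] f by simp
    qed
    have "u (\<lambda>x. \<i> * (c * f x)) = Re (\<i> * c) * u f + Im (\<i> * c) * u (\<lambda>x. \<i> * f x)"
      using real[of "\<i> * c"] by (simp add: mult.assoc)
    then show ?thesis
      using real[of c] by (simp add: \<Lambda>_def complex_eq_iff)
  qed
  have le: "norm (\<Lambda> f) \<le> C * (\<integral>x. norm (f x) \<partial>M)" if f: "integrable M f" for f
  proof -
    define c where "c = cnj (sgn (\<Lambda> f))"
    have c1: "norm c \<le> 1"
      by (simp add: c_def norm_sgn)
    have "c * \<Lambda> f = of_real (norm (\<Lambda> f))"
      by (cases "\<Lambda> f = 0") (simp_all add: c_def sgn_eq mult.commute[of _ "\<Lambda> f"] power2_eq_square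
        flip: complex_norm_square)
    then have "norm (\<Lambda> f) = u (\<lambda>x. c * f x)"
      using hom[OF f, of c] by (simp add: \<Lambda>_def complex_eq_iff)
    also have "\<dots> \<le> C * (\<integral>x. norm (c * f x) \<partial>M)"
      using u_le[of "\<lambda>x. c * f x"] f by (simp add: p_def)
    also have "\<dots> \<le> C * (\<integral>x. norm (f x) \<partial>M)"
      using C f c1 by (intro mult_left_mono integral_mono) (auto simp: norm_mult mult_left_le_one_le)
    finally show ?thesis .
  qed
  have "\<Lambda> f = L f" if "f \<in> W" for f
    using u_eq[OF that] u_eq[OF W_scale[OF that, of \<i>]] L_scale[OF that, of \<i>]
    by (simp add: \<Lambda>_def complex_eq_iff)
  then show thesis
    using that[of \<Lambda>] add hom le by blast
qed

text \<open>The set function \<open>m + C \<mu>\<close> is nonnegative and at most \<open>2 C \<mu>\<close>, which makes it countably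
  additive and absolutely continuous, so Radon-Nikodym applies to it.\<close>

lemma (in finite_measure) bounded_additive_density_real:
  fixes m :: "'a set \<Rightarrow> real"
  assumes add: "\<And>A B. A \<in> sets M \<Longrightarrow> B \<in> sets M \<Longrightarrow> A \<inter> B = {} \<Longrightarrow> m (A \<union> B) = m A + m B"
    and bound: "\<And>A. A \<in> sets M \<Longrightarrow> \<bar>m A\<bar> \<le> C * measure M A"
  obtains r where "integrable M r" "\<And>A. A \<in> sets M \<Longrightarrow> (\<integral>x\<in>A. r x \<partial>M) = m A"
proof -
  define v where "v A = m A + C * measure M A" for A
  have v0: "0 \<le> v A" and v2: "v A \<le> 2 * C * measure M A" if "A \<in> sets M" for A
    using bound[OF that] by (auto simp: v_def)
  define N where "N = measure_of (space M) (sets M) (\<lambda>A. ennreal (v A))"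
  have vadd: "v (A \<union> B) = v A + v B" if "A \<in> sets M" "B \<in> sets M" "A \<inter> B = {}" for A B
    using add[OF that] finite_measure_Union[OF that] by (simp add: v_def algebra_simps)
  have "m {} = 0"
    using bound[of "{}"] by simp
  then have pos: "positive (sets M) (\<lambda>A. ennreal (v A))"
    by (simp add: positive_def v_def)
  have "countably_additive (sets M) (\<lambda>A. ennreal (v A))"
  proof (rule sets.empty_continuous_imp_countably_additive[OF pos])
    show "additive (sets M) (\<lambda>A. ennreal (v A))"
      using v0 by (auto simp: additive_def vadd)
    fix A assume A: "range A \<subseteq> sets M" "decseq A" "(\<Inter>i. A i) = {}"
    have "(\<lambda>i. measure M (A i)) \<longlonglongrightarrow> measure M (\<Inter>i. A i)"
      using A by (intro finite_Lim_measure_decseq) auto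
    then have lim: "(\<lambda>i. 2 * C * measure M (A i)) \<longlonglongrightarrow> 2 * C * 0"
      using A by (intro tendsto_intros) simp
    have "(\<lambda>i. v (A i)) \<longlonglongrightarrow> 0"
    proof (rule tendsto_sandwich[OF _ _ tendsto_const])
      show "(\<lambda>i. 2 * C * measure M (A i)) \<longlonglongrightarrow> 0"
        using lim by simp
    qed (use A v0 v2 in \<open>auto intro!: always_eventually\<close>)
    then show "(\<lambda>i. ennreal (v (A i))) \<longlonglongrightarrow> 0"
      using tendsto_ennrealI by fastforce
  qed simp
  then have N: "emeasure N A = ennreal (v A)" if "A \<in> sets M" for A
    unfolding N_def using that pos by (intro emeasure_measure_of_sigma sets.sigma_algebra_axioms)
  have sN: "sets N = sets M"
    by (simp add: N_def)
  have ac: "absolutely_continuous M N"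
    unfolding absolutely_continuous_def
  proof
    fix A assume A: "A \<in> null_sets M"
    then have "v A = 0"
      using v0[OF null_setsD2[OF A]] v2[OF null_setsD2[OF A]] null_setsD1[OF A]
      by (simp add: measure_def)
    then show "A \<in> null_sets N"
      using A by (auto simp: null_sets_def sN N)
  qed
  obtain d where d: "d \<in> borel_measurable M" "density M d = N"
    using Radon_Nikodym[OF ac sN] by blast
  have dA: "(\<integral>\<^sup>+x. d x * indicator A x \<partial>M) = ennreal (v A)" if "A \<in> sets M" for A
    using N[OF that] d emeasure_density[OF d(1) that] by simp
  have "(\<integral>\<^sup>+x. d x \<partial>M) = ennreal (v (space M))"
    using dA[of "space M"] by (simp cong: nn_integral_cong)
  then have fin: "AE x in M. d x \<noteq> \<infinity>"
    using d(1) by (intro nn_integral_noteq_infinite) auto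
  define D where "D x = enn2real (d x)" for x
  have Dd: "AE x in M. ennreal (D x) = d x"
    using fin by eventually_elim (simp add: D_def less_top)
  have Dm: "D \<in> borel_measurable M"
    unfolding D_def using d(1) by measurable
  have DA: "has_bochner_integral M (\<lambda>x. D x * indicator A x) (v A)" if A: "A \<in> sets M" for A
  proof (rule has_bochner_integral_nn_integral)
    have "(\<integral>\<^sup>+x. ennreal (D x * indicator A x) \<partial>M) = (\<integral>\<^sup>+x. d x * indicator A x \<partial>M)"
      using Dd by (intro nn_integral_cong_AE, eventually_elim) (auto split: split_indicator)
    then show "(\<integral>\<^sup>+x. ennreal (D x * indicator A x) \<partial>M) = ennreal (v A)"
      using dA[OF A] by simp
    show "(\<lambda>x. D x * indicator A x) \<in> borel_measurable M"
      using Dm A by measurable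
  qed (use A v0 in \<open>auto simp: D_def\<close>)
  have Di: "integrable M D"
    using DA[OF sets.top]
    by (subst Bochner_Integration.integrable_cong[OF refl, of _ _ "\<lambda>x. D x * indicator (space M) x"]) (auto simp: has_bochner_integral_iff)
  show thesis
  proof (rule that[of "\<lambda>x. D x - C"])
    show "integrable M (\<lambda>x. D x - C)"
      using Di by simp
    fix A assume A: "A \<in> sets M"
    have iA: "set_integrable M A D" "set_integrable M A (\<lambda>_. C)"
      unfolding set_integrable_def
      by (rule integrable_mult_indicator[OF A Di], rule integrable_mult_indicator[OF A integrable_const])
    have "(\<integral>x\<in>A. D x \<partial>M) = v A"
      using DA[OF A] by (simp add: has_bochner_integral_iff set_lebesgue_integral_def mult.commute)
    moreover have "(\<integral>x\<in>A. C \<partial>M) = C * measure M A"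
      using A by (simp add: set_lebesgue_integral_def)
    ultimately show "(\<integral>x\<in>A. D x - C \<partial>M) = m A"
      using set_integral_diff(2)[OF iA] by (simp add: v_def)
  qed
qed

text \<open>Bounding real and imaginary part separately would cost a factor \<open>sqrt 2\<close>.
  The sharp constant comes from the averages of \<psi> over sets of positive measure: they all lie
  in the closed disc of radius \<open>C\<close>, hence so do almost all values.\<close>

lemma (in finite_measure) bounded_additive_density:
  fixes m :: "'a set \<Rightarrow> complex"
  assumes add: "\<And>A B. A \<in> sets M \<Longrightarrow> B \<in> sets M \<Longrightarrow> A \<inter> B = {} \<Longrightarrow> m (A \<union> B) = m A + m B"
    and bound: "\<And>A. A \<in> sets M \<Longrightarrow> norm (m A) \<le> C * measure M A"
  obtains \<psi> where "integrable M \<psi>" "\<And>A. A \<in> sets M \<Longrightarrow> (\<integral>x\<in>A. \<psi> x \<partial>M) = m A"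
    "AE x in M. norm (\<psi> x) \<le> C"
proof -
  obtain r where r: "integrable M r" "\<And>A. A \<in> sets M \<Longrightarrow> (\<integral>x\<in>A. r x \<partial>M) = Re (m A)"
    using bounded_additive_density_real[of "\<lambda>A. Re (m A)" C] add bound
    by (metis abs_Re_le_cmod order_trans plus_complex.simps(1))
  obtain s where s: "integrable M s" "\<And>A. A \<in> sets M \<Longrightarrow> (\<integral>x\<in>A. s x \<partial>M) = Im (m A)"
    using bounded_additive_density_real[of "\<lambda>A. Im (m A)" C] add bound
    by (metis abs_Im_le_cmod order_trans plus_complex.simps(2))
  define \<psi> where "\<psi> x = complex_of_real (r x) + \<i> * of_real (s x)" for x
  have \<psi>i: "integrable M \<psi>"
    unfolding \<psi>_def using r s by simp
  have \<psi>A: "(\<integral>x\<in>A. \<psi> x \<partial>M) = m A" if A: "A \<in> sets M" for A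
  proof -
    have iA: "integrable M (\<lambda>x. indicator A x *\<^sub>R \<psi> x)"
      by (rule integrable_mult_indicator[OF A \<psi>i])
    have "Re (\<integral>x\<in>A. \<psi> x \<partial>M) = (\<integral>x\<in>A. r x \<partial>M)" "Im (\<integral>x\<in>A. \<psi> x \<partial>M) = (\<integral>x\<in>A. s x \<partial>M)"
      unfolding set_lebesgue_integral_def
      using integral_Re[OF iA] integral_Im[OF iA] by (simp_all add: \<psi>_def)
    then show ?thesis
      using r(2)[OF A] s(2)[OF A] by (simp add: complex_eq_iff)
  qed
  have "AE x in M. \<psi> x \<in> cball 0 C"
  proof (rule averaging_theorem[OF \<psi>i])
    fix A assume A: "A \<in> sets M" "measure M A > 0"
    then show "(1 / measure M A) *\<^sub>R (\<integral>x\<in>A. \<psi> x \<partial>M) \<in> cball 0 C"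
      using bound[of A] by (simp add: \<psi>A field_simps)
  qed simp
  then show thesis
    using that \<psi>i \<psi>A by simp
qed

text \<open>The density is read off from indicator functions. Both sides are continuous along
  dominated pointwise limits, so the agreement spreads to all integrable functions.\<close>

lemma (in finite_measure) L1_functional_representation:
  fixes \<Lambda> :: "('a \<Rightarrow> complex) \<Rightarrow> complex"
  assumes add: "\<And>f g. integrable M f \<Longrightarrow> integrable M g \<Longrightarrow> \<Lambda> (\<lambda>x. f x + g x) = \<Lambda> f + \<Lambda> g"
    and hom: "\<And>c f. integrable M f \<Longrightarrow> \<Lambda> (\<lambda>x. c * f x) = c * \<Lambda> f"
    and le: "\<And>f. integrable M f \<Longrightarrow> norm (\<Lambda> f) \<le> C * (\<integral>x. norm (f x) \<partial>M)"
  obtains \<psi> where "\<psi> \<in> borel_measurable M" "AE x in M. norm (\<psi> x) \<le> C"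
    "\<And>f. integrable M f \<Longrightarrow> \<Lambda> f = (\<integral>x. \<psi> x * f x \<partial>M)"
proof -
  have ind: "integrable M (\<lambda>x. indicator A x :: complex)" if "A \<in> sets M" for A
    using that by (intro integrable_const_bound[where B=1]) (auto split: split_indicator)
  obtain \<psi> where \<psi>: "integrable M \<psi>" "AE x in M. norm (\<psi> x) \<le> C"
    and \<psi>A: "\<And>A. A \<in> sets M \<Longrightarrow> (\<integral>x\<in>A. \<psi> x \<partial>M) = \<Lambda> (indicator A)"
  proof (rule bounded_additive_density[of "\<lambda>A. \<Lambda> (indicator A)" C])
    fix A B assume AB: "A \<in> sets M" "B \<in> sets M" "A \<inter> B = {}"
    then have "indicator (A \<union> B) = (\<lambda>x. indicator A x + indicator B x :: complex)"
      by (auto simp: fun_eq_iff split: split_indicator)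
    then show "\<Lambda> (indicator (A \<union> B)) = \<Lambda> (indicator A) + \<Lambda> (indicator B)"
      using add[OF ind[OF AB(1)] ind[OF AB(2)]] by simp
  next
    fix A assume A: "A \<in> sets M"
    have "(\<integral>x. norm (indicator A x :: complex) \<partial>M) = measure M A"
      using A by (subst Bochner_Integration.integral_cong[OF refl, of _ _ "indicator A"])
        (auto split: split_indicator)
    then show "norm (\<Lambda> (indicator A)) \<le> C * measure M A"
      using le[OF ind[OF A]] by simp
  qed blast
  have \<psi>f: "integrable M (\<lambda>x. \<psi> x * f x)" if "integrable M f" for f
  proof (rule Bochner_Integration.integrable_bound[of M "\<lambda>x. of_real C * f x"])
    show "AE x in M. norm (\<psi> x * f x) \<le> norm (of_real C * f x)"
      using \<psi>(2) by eventually_elim (auto simp: norm_mult intro!: mult_right_mono)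
  qed (use that \<psi>(1) in auto)
  have "\<Lambda> f = (\<integral>x. \<psi> x * f x \<partial>M)" if "integrable M f" for f
    using that
  proof (induction rule: integrable_induct)
    case (base A c)
    have "\<Lambda> (\<lambda>x. indicator A x *\<^sub>R c) = c * \<Lambda> (indicator A)"
      using hom[OF ind[OF base(1)], of c] by (simp add: scaleR_conv_of_real mult.commute of_real_indicator)
    also have "\<dots> = (\<integral>x. c * (indicator A x *\<^sub>R \<psi> x) \<partial>M)"
      using \<psi>A[OF base(1)] by (simp add: set_lebesgue_integral_def del: mult_scaleR_right)
    finally show ?case
      by (simp add: mult.commute)
  next
    case (add f g)
    then show ?case
      using assms(1)[of f g] \<psi>f by (simp add: distrib_left)
  next
    case (lim f s)
    have sm: "f \<in> borel_measurable M" "\<And>i. s i \<in> borel_measurable M"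
      using lim.hyps by auto
    \<comment> \<open>The approximants satisfy \<open>norm (s i x) \<le> 2 * norm (f x)\<close>,
      whence the factor 3 for the difference.\<close>
    have n0: "(\<lambda>i. \<integral>x. norm (s i x - f x) \<partial>M) \<longlonglongrightarrow> (\<integral>x. 0 \<partial>M)"
    proof (rule integral_dominated_convergence[where w="\<lambda>x. 3 * norm (f x)"])
      show "AE x in M. (\<lambda>i. norm (s i x - f x)) \<longlonglongrightarrow> 0"
        using lim.hyps(2) by (auto intro!: AE_I2 tendsto_norm_zero LIM_zero)
      show "AE x in M. norm (norm (s i x - f x)) \<le> 3 * norm (f x)" for i
      proof (intro AE_I2)
        fix x assume "x \<in> space M"
        then show "norm (norm (s i x - f x)) \<le> 3 * norm (f x)"
          using lim.hyps(3)[of x i] norm_triangle_ineq4[of "s i x" "f x"] by simp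
      qed
    qed (use lim.hyps sm in auto)
    have "(\<lambda>i. \<Lambda> (s i) - \<Lambda> f) \<longlonglongrightarrow> 0"
    proof (rule Lim_null_comparison)
      have "\<Lambda> (s i) - \<Lambda> f = \<Lambda> (\<lambda>x. s i x - f x)" for i
        using assms(1)[of "s i" "\<lambda>x. - 1 * f x"] hom[of f "- 1"] lim.hyps by simp
      then show "eventually (\<lambda>i. norm (\<Lambda> (s i) - \<Lambda> f) \<le> C * (\<integral>x. norm (s i x - f x) \<partial>M)) sequentially"
        using le[of "\<lambda>x. s i x - f x" for i] lim.hyps(1,4) by simp
      show "(\<lambda>i. C * (\<integral>x. norm (s i x - f x) \<partial>M)) \<longlonglongrightarrow> 0"
        using tendsto_mult[OF tendsto_const n0, of C] by simp
    qed
    then have 1: "(\<lambda>i. \<Lambda> (s i)) \<longlonglongrightarrow> \<Lambda> f"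
      by (simp add: LIM_zero_iff)
    have 2: "(\<lambda>i. \<integral>x. \<psi> x * s i x \<partial>M) \<longlonglongrightarrow> (\<integral>x. \<psi> x * f x \<partial>M)"
    proof (rule integral_dominated_convergence[where w="\<lambda>x. 2 * norm (\<psi> x * f x)"])
      show "AE x in M. (\<lambda>i. \<psi> x * s i x) \<longlonglongrightarrow> \<psi> x * f x"
        using lim.hyps(2) by (auto intro!: AE_I2 tendsto_intros)
      show "AE x in M. norm (\<psi> x * s i x) \<le> 2 * norm (\<psi> x * f x)" for i
      proof (intro AE_I2)
        fix x assume "x \<in> space M"
        from mult_left_mono[OF lim.hyps(3)[OF this] norm_ge_zero[of "\<psi> x"]]
        show "norm (\<psi> x * s i x) \<le> 2 * norm (\<psi> x * f x)"
          by (simp add: norm_mult mult_ac)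
      qed
    qed (use \<psi>f[OF lim.hyps(4)] \<psi>(1) sm in auto)
    show ?case
      using LIMSEQ_unique[OF 1] 2 lim.IH by simp
  qed
  then show thesis
    using that[of \<psi>] \<psi> by auto
qed

section \<open>Fourier coefficients on the circle\<close>

interpretation circle: prob_space circle
  by (rule prob_space_circle)

interpretation torus: pair_prob_space circle circle ..

section \<open>Algebra of essentially bounded functions\<close>

lemma LinfI:
  assumes "f \<in> borel_measurable M" "\<And>x. x \<in> space M \<Longrightarrow> norm (f x) \<le> C"
  shows "f \<in> Linf M"
  using assms by (auto simp: Linf_def)

lemma Linf_measurable: "f \<in> Linf M \<Longrightarrow> f \<in> borel_measurable M"
  by (simp add: Linf_def)

lemma Linf_bound:
  assumes "f \<in> Linf M"
  obtains C where "C \<ge> 0" "AE x in M. norm (f x) \<le> C"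
proof -
  from assms obtain C where C: "AE x in M. norm (f x) \<le> C"
    by (auto simp: Linf_def)
  then have "AE x in M. norm (f x) \<le> max C 0"
    by eventually_elim simp
  then show thesis
    using that[of "max C 0"] by simp
qed

lemma Linf_mult:
  assumes "f \<in> Linf M" "g \<in> Linf M"
  shows "(\<lambda>x. f x * g x) \<in> Linf M"
proof -
  obtain C D where "C \<ge> 0" "AE x in M. norm (f x) \<le> C" "AE x in M. norm (g x) \<le> D"
    using Linf_bound[OF assms(1)] Linf_bound[OF assms(2)] by metis
  from this(2,3) have "AE x in M. norm (f x * g x) \<le> C * D"
    by eventually_elim (auto simp: norm_mult intro!: mult_mono' order_trans[OF norm_ge_zero])
  then show ?thesis
    using assms by (auto simp: Linf_def)
qed

lemma Linf_add:
  assumes "f \<in> Linf M" "g \<in> Linf M"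
  shows "(\<lambda>x. f x + g x) \<in> Linf M"
proof -
  obtain C D where "AE x in M. norm (f x) \<le> C" "AE x in M. norm (g x) \<le> D"
    using Linf_bound[OF assms(1)] Linf_bound[OF assms(2)] by metis
  then have "AE x in M. norm (f x + g x) \<le> C + D"
    by eventually_elim (auto intro!: norm_triangle_le)
  then show ?thesis
    using assms by (auto simp: Linf_def)
qed

lemma Linf_cnj:
  assumes "f \<in> Linf M"
  shows "(\<lambda>x. cnj (f x)) \<in> Linf M"
  using assms measurable_compose[OF Linf_measurable[OF assms], of cnj borel]
  by (auto simp: Linf_def borel_measurable_continuous_onI continuous_intros)

lemma Linf_const: "(\<lambda>_. c) \<in> Linf M"
  by (rule LinfI[where C="norm c"]) auto

lemma Linf_diff:
  assumes "f \<in> Linf M" "g \<in> Linf M"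
  shows "(\<lambda>x. f x - g x) \<in> Linf M"
  using Linf_add[OF assms(1) Linf_mult[OF Linf_const[of "- 1"] assms(2)]] by simp

lemma Linf_sum:
  assumes "\<And>i. i \<in> I \<Longrightarrow> f i \<in> Linf M"
  shows "(\<lambda>x. \<Sum>i\<in>I. f i x) \<in> Linf M"
  using assms by (induction I rule: infinite_finite_induct) (auto intro: Linf_const Linf_add)

lemma (in finite_measure) Linf_integrable:
  assumes "f \<in> Linf M"
  shows "integrable M f"
proof -
  obtain C where "AE x in M. norm (f x) \<le> C"
    using Linf_bound[OF assms] by metis
  then show ?thesis
    using assms by (intro integrable_const_bound[where B=C]) (auto simp: Linf_def)
qed

lemma (in finite_measure) Linf_integrable_norm2:
  assumes "f \<in> Linf M"
  shows "integrable M (\<lambda>x. (norm (f x))\<^sup>2)"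
proof -
  have "integrable M (\<lambda>x. f x * cnj (f x))"
    using Linf_integrable[OF Linf_mult[OF assms Linf_cnj[OF assms]]] .
  then show ?thesis
    by (simp only: complex_norm_square[symmetric] complex_of_real_integrable_eq)
qed

section \<open>Orthogonality of the characters and Bessel's inequality\<close>

lemma powi_Linf_circle: "(\<lambda>z. z powi k) \<in> Linf circle"
  by (rule LinfI[where C=1]) (auto intro: powi_measurable_circle simp: norm_power_int)

text \<open>For \<open>k \<noteq> 0\<close> the rotation by \<open>cis (pi / k)\<close> changes the
  sign of \<open>z powi k\<close>, while the integral is invariant under rotation.\<close>

lemma integral_circle_powi: "(\<integral>z. z powi k \<partial>circle) = (if k = 0 then 1 else 0)"
proof (cases "k = 0")
  case False
  define c where "c = cis (pi / k)"
  have "c powi k = -1"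
    using False by (simp add: c_def cis_power_int)
  then have "(\<integral>z. (c * z) powi k \<partial>circle) = - (\<integral>z. z powi k \<partial>circle)"
    by (simp add: power_int_mult_distrib)
  moreover have "(\<integral>z. (c * z) powi k \<partial>circle) = (\<integral>z. z powi k \<partial>circle)"
    by (intro integral_circle_rotate[of c "\<lambda>z. z powi k"])
       (auto simp: c_def intro: powi_measurable_circle)
  ultimately show ?thesis
    using False by simp
qed (simp add: circle.prob_space del: space_circle)

lemma cnj_powi_circle:
  assumes "norm z = 1"
  shows "cnj z powi k = z powi (- k)"
proof -
  have "cnj z = inverse z"
    using assms by (metis complex_norm_square inverse_unique of_real_1 one_power2)
  then show ?thesis
    by (simp add: power_int_inverse power_int_minus)
qed

lemma cnj_trig_sum:
  assumes "norm z = 1"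
  shows "cnj (\<Sum>j\<in>J. x j * z powi e j) = (\<Sum>j\<in>J. cnj (x j) * z powi (- e j))"
  using assms by (simp add: cnj_powi_circle)

lemma trig_sum_Linf: "(\<lambda>z. \<Sum>j\<in>J. x j * z powi e j) \<in> Linf circle"
  by (intro Linf_sum Linf_mult Linf_const powi_Linf_circle)

lemma integral_mult_cnj_trig_sum:
  assumes "f \<in> Linf circle"
  shows "(\<integral>z. f z * cnj (\<Sum>j\<in>J. x j * z powi e j) \<partial>circle)
       = (\<Sum>j\<in>J. cnj (x j) * fourier_coeff f (e j))"
proof -
  have i: "integrable circle (\<lambda>z. f z * z powi k)" for k
    by (intro circle.Linf_integrable Linf_mult assms powi_Linf_circle)
  have "(\<integral>z. f z * cnj (\<Sum>j\<in>J. x j * z powi e j) \<partial>circle)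
      = (\<integral>z. (\<Sum>j\<in>J. cnj (x j) * (f z * z powi (- e j))) \<partial>circle)"
    by (intro Bochner_Integration.integral_cong refl, subst cnj_trig_sum)
       (auto simp: sum_distrib_left mult_ac)
  also have "\<dots> = (\<Sum>j\<in>J. cnj (x j) * fourier_coeff f (e j))"
    using i by (simp add: fourier_coeff_def)
  finally show ?thesis .
qed

lemma fourier_coeff_trig_sum:
  assumes "finite J" "inj_on e J" "j \<in> J"
  shows "fourier_coeff (\<lambda>z. \<Sum>k\<in>J. x k * z powi e k) (e j) = x j"
proof -
  have "fourier_coeff (\<lambda>z. \<Sum>k\<in>J. x k * z powi e k) (e j)
      = (\<integral>z. (\<Sum>k\<in>J. x k * z powi (e k - e j)) \<partial>circle)"
    unfolding fourier_coeff_def sum_distrib_right mult.assoc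
    by (intro Bochner_Integration.integral_cong sum.cong refl, subst power_int_add[symmetric]) auto
  also have "\<dots> = (\<Sum>k\<in>J. x k * (if e k = e j then 1 else 0))"
    using circle.Linf_integrable[OF powi_Linf_circle]
    by (subst Bochner_Integration.integral_sum) (auto simp: integral_circle_powi intro!: sum.cong)
  also have "\<dots> = (\<Sum>k\<in>J. if k = j then x k else 0)"
    using assms by (intro sum.cong) (auto dest: inj_onD)
  finally show ?thesis
    using assms by simp
qed

lemma integral_norm2_trig_sum:
  assumes "finite J" "inj_on e J"
  shows "(\<integral>z. (norm (\<Sum>j\<in>J. x j * z powi e j))\<^sup>2 \<partial>circle) = (\<Sum>j\<in>J. (norm (x j))\<^sup>2)"
proof -
  have "complex_of_real (\<integral>z. (norm (\<Sum>j\<in>J. x j * z powi e j))\<^sup>2 \<partial>circle)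
     = (\<integral>z. (\<Sum>j\<in>J. x j * z powi e j) * cnj (\<Sum>j\<in>J. x j * z powi e j) \<partial>circle)"
    by (simp only: integral_complex_of_real[symmetric] complex_norm_square)
  also have "\<dots> = (\<Sum>j\<in>J. cnj (x j) * x j)"
    using assms by (simp only: integral_mult_cnj_trig_sum[OF trig_sum_Linf] fourier_coeff_trig_sum cong: sum.cong)
  also have "\<dots> = complex_of_real (\<Sum>j\<in>J. (norm (x j))\<^sup>2)"
    unfolding of_real_sum complex_norm_square by (simp only: mult.commute)
  finally show ?thesis
    unfolding of_real_eq_iff .
qed

text \<open>Expansion of the squared distance of \<open>f\<close> to its Fourier sum
  \<open>P\<close>, where the inner product of \<open>f\<close> with \<open>P\<close> and the
  squared norm of \<open>P\<close> are both \<open>s\<close>. The injection \<open>e\<close> allows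
  negative frequencies to be enumerated by natural numbers.\<close>

lemma bessel_inequality:
  assumes "finite J" "inj_on e J" "f \<in> Linf circle"
  shows "(\<Sum>j\<in>J. (norm (fourier_coeff f (e j)))\<^sup>2) \<le> (\<integral>z. (norm (f z))\<^sup>2 \<partial>circle)"
proof -
  define P where "P z = (\<Sum>j\<in>J. fourier_coeff f (e j) * z powi e j)" for z
  define s where "s = (\<Sum>j\<in>J. (norm (fourier_coeff f (e j)))\<^sup>2)"
  have P: "P \<in> Linf circle"
    unfolding P_def by (rule trig_sum_Linf)
  have cP: "(\<lambda>z. cnj (P z)) \<in> Linf circle"
    using P by (rule Linf_cnj)
  have fP: "integrable circle (\<lambda>z. f z * cnj (P z))"
    by (intro circle.Linf_integrable Linf_mult assms cP)
  have "(\<integral>z. f z * cnj (P z) \<partial>circle) = of_real s"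
    unfolding P_def integral_mult_cnj_trig_sum[OF assms(3)] s_def of_real_sum complex_norm_square
    by (simp only: mult.commute)
  then have re: "(\<integral>z. Re (f z * cnj (P z)) \<partial>circle) = s"
    using integral_Re[OF fP] by simp
  have n2: "(\<integral>z. (norm (P z))\<^sup>2 \<partial>circle) = s"
    unfolding P_def s_def by (rule integral_norm2_trig_sum[OF assms(1,2)])
  have "0 \<le> (\<integral>z. (norm (f z - P z))\<^sup>2 \<partial>circle)"
    by simp
  also have "\<dots> = (\<integral>z. (norm (f z))\<^sup>2 - 2 * Re (f z * cnj (P z)) + (norm (P z))\<^sup>2 \<partial>circle)"
    by (intro Bochner_Integration.integral_cong refl, simp only: cmod_power2)
       (simp add: power2_eq_square algebra_simps)
  also have "\<dots> = (\<integral>z. (norm (f z))\<^sup>2 \<partial>circle) - 2 * s + s"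
    using circle.Linf_integrable_norm2[OF assms(3)] circle.Linf_integrable_norm2[OF P]
      integrable_Re[OF fP]
    by (simp add: re n2 del: times_complex.simps)
  finally show ?thesis
    by (simp add: s_def)
qed

section \<open>The scalar Nehari estimate\<close>

text \<open>Boundedness of the infinite matrix with entries \<open>c (i + j)\<close> on
  square-summable sequences, expressed through finite sections so that no convergence enters. For a
  symbol on the circle, \<open>c k\<close> will be its Fourier coefficient of index
  \<open>-(k + 1)\<close>.\<close>

definition hankel_bounded :: "(nat \<Rightarrow> complex) \<Rightarrow> real \<Rightarrow> bool" where
  "hankel_bounded c C \<longleftrightarrow> (\<forall>M N x. (\<Sum>i<M. (norm (\<Sum>j<N. c (i + j) * x j))\<^sup>2)
      \<le> C\<^sup>2 * (\<Sum>j<N. (norm (x j))\<^sup>2))"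

text \<open>The form is bilinear, without conjugates: at the Taylor coefficients of two factors it
  will give the functional of their product.\<close>

lemma hankel_bounded_bilinear:
  assumes "hankel_bounded c C" "C \<ge> 0"
  shows "norm (\<Sum>i<M. \<Sum>j<N. c (i + j) * x i * y j)
    \<le> C * sqrt (\<Sum>i<M. (norm (x i))\<^sup>2) * sqrt (\<Sum>j<N. (norm (y j))\<^sup>2)"
proof -
  define h where "h i = (\<Sum>j<N. c (i + j) * y j)" for i
  have "(\<Sum>i<M. \<Sum>j<N. c (i + j) * x i * y j) = (\<Sum>i<M. x i * h i)"
    by (simp add: h_def sum_distrib_left mult_ac)
  also have "norm \<dots> \<le> (\<Sum>i<M. \<bar>norm (x i)\<bar> * \<bar>norm (h i)\<bar>)"
    by (intro sum_norm_le) (simp add: norm_mult)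
  also have "\<dots> \<le> L2_set (\<lambda>i. norm (x i)) {..<M} * L2_set (\<lambda>i. norm (h i)) {..<M}"
    by (rule L2_set_mult_ineq)
  also have "\<dots> \<le> L2_set (\<lambda>i. norm (x i)) {..<M} * (C * sqrt (\<Sum>j<N. (norm (y j))\<^sup>2))"
  proof (rule mult_left_mono[OF _ L2_set_nonneg])
    show "L2_set (\<lambda>i. norm (h i)) {..<M} \<le> C * sqrt (\<Sum>j<N. (norm (y j))\<^sup>2)"
      using real_sqrt_le_mono[OF assms(1)[unfolded hankel_bounded_def, rule_format]] assms(2)
      unfolding L2_set_def h_def by (simp add: real_sqrt_mult)
  qed
  finally show ?thesis
    by (simp add: L2_set_def mult_ac)
qed

text \<open>The first column of the matrix contains every \<open>c k\<close> and is the image of a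
  unit vector.\<close>

lemma hankel_bounded_norm_le:
  assumes "hankel_bounded c C" "C \<ge> 0"
  shows "norm (c k) \<le> C"
proof -
  have "(\<Sum>i<Suc k. (norm (c i))\<^sup>2) \<le> C\<^sup>2"
    using assms(1)[unfolded hankel_bounded_def, rule_format, where M="Suc k" and N="Suc 0" and x="\<lambda>_. 1"]
    by simp
  moreover have "(norm (c k))\<^sup>2 \<le> (\<Sum>i<Suc k. (norm (c i))\<^sup>2)"
    by (intro member_le_sum) auto
  ultimately have "(norm (c k))\<^sup>2 \<le> C\<^sup>2"
    by linarith
  then show ?thesis
    using assms(2) by (rule power2_le_imp_le)
qed

section \<open>Factorization of polynomials without zeros on the circle\<close>

text \<open>On the circle \<open>1 - cnj w * z\<close> equals \<open>cnj (z - w) * z\<close>; this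
  makes the Blaschke factor unimodular there.\<close>

lemma norm_cnj_factor_circle:
  assumes "norm z = 1"
  shows "norm (1 - cnj w * z) = norm (z - w)"
proof -
  have "cnj z * z = 1"
    using assms by (metis complex_norm_square mult.commute of_real_1 one_power2)
  then have "1 - cnj w * z = cnj (z - w) * z"
    by (simp add: algebra_simps)
  then show ?thesis
    using assms by (simp add: norm_mult del: complex_cnj_diff)
qed

lemma norm_csqrt_power2: "(norm (csqrt z))\<^sup>2 = norm z"
  by (simp flip: norm_power)

text \<open>Inner-outer factorization: a root \<open>w\<close> in the disc contributes the Blaschke factor
  \<open>(z - w) / (1 - cnj w z)\<close>, and the rest of the polynomial is zero-free, so it is distributed
  evenly between \<open>g\<close> and \<open>h\<close> by taking square roots.\<close>

lemma poly_factor_circle: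
  fixes p :: "complex poly"
  assumes "\<And>z. norm z = 1 \<Longrightarrow> poly p z \<noteq> 0"
  obtains R g h where "R > 1" "g holomorphic_on ball 0 R" "h holomorphic_on ball 0 R"
    "\<And>z. z \<in> ball 0 R \<Longrightarrow> poly p z = g z * h z"
    "\<And>z. norm z = 1 \<Longrightarrow> (norm (g z))\<^sup>2 = norm (poly p z)"
    "\<And>z. norm z = 1 \<Longrightarrow> (norm (h z))\<^sup>2 = norm (poly p z)"
proof -
  have "\<exists>R g h. R > 1 \<and> g holomorphic_on ball 0 R \<and> h holomorphic_on ball 0 R \<and>
     (\<forall>z\<in>ball 0 R. poly p z = g z * h z) \<and>
     (\<forall>z. norm z = 1 \<longrightarrow> (norm (g z))\<^sup>2 = norm (poly p z) \<and> (norm (h z))\<^sup>2 = norm (poly p z))"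
    using assms
  proof (induction "degree p" arbitrary: p)
    case 0
    then obtain c where c: "p = [:c:]"
      by (metis degree_eq_zeroE)
    show ?case
      by (intro exI[of _ 2] exI[of _ "\<lambda>_. csqrt c"])
         (auto simp: c norm_csqrt_power2 simp flip: power2_eq_square)
  next
    case (Suc n)
    have "\<not> (\<exists>a l. a \<noteq> 0 \<and> l = 0 \<and> p = pCons a l)"
      using Suc.hyps(2) by auto
    then obtain w where w: "poly p w = 0"
      using fundamental_theorem_of_algebra_alt by blast
    then obtain q where q: "p = [:- w, 1:] * q"
      by (metis dvdE poly_eq_0_iff_dvd)
    have p: "poly p z = (z - w) * poly q z" for z
      by (simp add: q algebra_simps)
    have "norm w \<noteq> 1"
      using w Suc.prems by auto
    have "q \<noteq> 0"
      using Suc.hyps(2) by (auto simp: q)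
    then have "degree p = degree [:- w, 1:] + degree q"
      unfolding q by (intro degree_mult_eq) auto
    then have "n = degree q"
      using Suc.hyps(2) by simp
    moreover have "norm z = 1 \<Longrightarrow> poly q z \<noteq> 0" for z
      using Suc.prems[of z] by (simp add: p)
    ultimately obtain R g h where R: "R > 1" and g: "g holomorphic_on ball 0 R"
      and h: "h holomorphic_on ball 0 R"
      and qgh: "\<And>z. z \<in> ball 0 R \<Longrightarrow> poly q z = g z * h z"
      and qn: "\<And>z. norm z = 1 \<Longrightarrow> (norm (g z))\<^sup>2 = norm (poly q z)"
        "\<And>z. norm z = 1 \<Longrightarrow> (norm (h z))\<^sup>2 = norm (poly q z)"
      using Suc.hyps(1)[of q] by blast
    show ?case
    proof (cases "norm w > 1")
      case True
      \<comment> \<open>For \<open>norm z < norm w\<close> the number \<open>1 - z / w\<close> lies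
        in the right half plane, where \<open>csqrt\<close> is holomorphic; thus \<open>s\<close> is
        a holomorphic square root of \<open>z - w\<close> on the smaller disc.\<close>
      define S where "S = min R (norm w)"
      define s where "s z = csqrt (- w) * csqrt (1 - z / w)" for z
      have "1 - z / w \<notin> \<real>\<^sub>\<le>\<^sub>0" if "z \<in> ball 0 S" for z
      proof -
        have "norm (z / w) < 1"
          using that order_trans[OF zero_le_one less_imp_le[OF True]]
          by (auto simp: S_def norm_divide divide_less_eq_1)
        then have "Re (z / w) < 1"
          using complex_Re_le_cmod[of "z / w"] by linarith
        then show ?thesis
          by (auto simp: complex_nonpos_Reals_iff)
      qed
      then have s: "s holomorphic_on ball 0 S"
        unfolding s_def using True by (intro holomorphic_intros) auto
      have s2: "s z * s z = z - w" for z
        using True by (auto simp: s_def field_simps simp flip: power2_eq_square)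
      have sn: "(norm (s z))\<^sup>2 = norm (z - w)" for z
        by (simp flip: s2 add: norm_mult power2_eq_square)
      have sub: "ball 0 S \<subseteq> ball (0::complex) R"
        by (auto simp: S_def)
      show ?thesis
      proof (intro exI conjI ballI allI impI)
        show "S > 1"
          using R True by (simp add: S_def)
        show "(\<lambda>z. g z * s z) holomorphic_on ball 0 S" "(\<lambda>z. h z * s z) holomorphic_on ball 0 S"
          using g h s by (auto intro!: holomorphic_intros intro: holomorphic_on_subset[OF _ sub])
        show "poly p z = g z * s z * (h z * s z)" if "z \<in> ball 0 S" for z
          using qgh[of z] that sub by (simp add: p subset_iff flip: s2)
      qed (simp_all add: p norm_mult power_mult_distrib sn qn)
    next
      case False
      then have w1: "norm w < 1"
        using \<open>norm w \<noteq> 1\<close> by simp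
      \<comment> \<open>The radius \<open>2 / (1 + norm w)\<close> lies strictly between 1 and the
        modulus \<open>1 / norm w\<close> of the pole of the Blaschke factor, and it also makes
        sense for \<open>w = 0\<close>. The factor \<open>z - w\<close> is split as
        \<open>(z - w) / s\<close> times \<open>s\<close>, where the square of \<open>s\<close> is
        \<open>1 - cnj w * z\<close>; on the circle both have squared modulus
        \<open>norm (z - w)\<close>.\<close>
      define S where "S = min R (2 / (1 + norm w))"
      define s where "s z = csqrt (1 - cnj w * z)" for z
      have re: "Re (1 - cnj w * z) > 0" if "z \<in> ball 0 S" for z
      proof -
        have "norm z * (1 + norm w) < 2"
          using that by (auto simp: S_def field_simps add_pos_nonneg)
        moreover have "norm z * (norm w + norm w) \<le> norm z * (1 + norm w)"
          using w1 by (intro mult_left_mono) auto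
        ultimately have "norm (cnj w * z) < 1"
          by (simp add: norm_mult algebra_simps)
        then show ?thesis
          using complex_Re_le_cmod[of "cnj w * z"] by simp
      qed
      then have "1 - cnj w * z \<notin> \<real>\<^sub>\<le>\<^sub>0" if "z \<in> ball 0 S" for z
        using re[OF that] by (auto simp: complex_nonpos_Reals_iff)
      then have s: "s holomorphic_on ball 0 S"
        unfolding s_def by (intro holomorphic_intros) auto
      have s2: "s z * s z = 1 - cnj w * z" for z
        by (simp add: s_def flip: power2_eq_square)
      have s0: "s z \<noteq> 0" if "z \<in> ball 0 S" for z
        using re[OF that] s2[of z] by (metis less_irrefl mult_zero_left zero_complex.sel(1))
      have sn: "(norm (s z))\<^sup>2 = norm (z - w)" if "norm z = 1" for z
        by (simp add: s_def norm_csqrt_power2 norm_cnj_factor_circle[OF that])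
      have sub: "ball 0 S \<subseteq> ball (0::complex) R"
        by (auto simp: S_def)
      show ?thesis
      proof (intro exI conjI ballI allI impI)
        show S: "S > 1"
          using R w1 by (simp add: S_def less_divide_eq add_pos_nonneg)
        show "(\<lambda>z. g z * ((z - w) / s z)) holomorphic_on ball 0 S"
          "(\<lambda>z. h z * s z) holomorphic_on ball 0 S"
          using g h s s0 by (auto intro!: holomorphic_intros intro: holomorphic_on_subset[OF _ sub])
        show "poly p z = g z * ((z - w) / s z) * (h z * s z)" if "z \<in> ball 0 S" for z
          using qgh[of z] s0[of z] that sub by (simp add: p subset_iff)
        show "(norm (g z * ((z - w) / s z)))\<^sup>2 = norm (poly p z)" if "norm z = 1" for z
        proof -
          have "s z \<noteq> 0"
            using s0[of z] S that by simp
          then have "norm (z - w) \<noteq> 0"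
            using sn[OF that] by (metis norm_eq_zero power_eq_0_iff)
          then show ?thesis
            using that by (simp add: p norm_mult norm_divide power_mult_distrib power_divide sn qn
              power2_eq_square[of "norm (z - w)"])
        qed
      qed (simp_all add: p norm_mult power_mult_distrib sn qn)
    qed
  qed
  then show thesis
    using that by blast
qed

text \<open>Holomorphy beyond the closed unit disc makes the Taylor series converge absolutely on
  the circle. The partial sums are then uniformly bounded, so their orthogonality relation passes to
  the limit by dominated convergence.\<close>

lemma taylor_coeffs_circle:
  assumes g: "g holomorphic_on ball 0 R" and R: "R > 1"
  defines "a \<equiv> \<lambda>n. (deriv ^^ n) g 0 / fact n"
  shows "summable (\<lambda>n. norm (a n))"
    and "(\<Sum>n<M. (norm (a n))\<^sup>2) \<le> (\<integral>z. (norm (g z))\<^sup>2 \<partial>circle)"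
proof -
  have sums: "(\<lambda>n. a n * z ^ n) sums g z" if "norm z < R" for z
    using holomorphic_power_series[OF g, of z] that by (simp add: a_def)
  have "summable (\<lambda>n. norm (a n * 1 ^ n))"
  proof (rule powser_insidea)
    show "summable (\<lambda>n. a n * (of_real ((1 + R) / 2)) ^ n)"
      using sums[of "of_real ((1 + R) / 2)"] R unfolding norm_of_real by (auto simp: sums_iff)
    show "norm (1::complex) < norm (complex_of_real ((1 + R) / 2))"
      using R unfolding norm_of_real by auto
  qed
  then show sa: "summable (\<lambda>n. norm (a n))"
    by simp
  define P where "P N z = (\<Sum>n<N. a n * z ^ n)" for N z
  have P_powi: "P N = (\<lambda>z. \<Sum>n<N. a n * z powi int n)" for N
    by (simp add: P_def fun_eq_iff)
  have Pb: "norm (P N z) \<le> (\<Sum>n. norm (a n))" if "norm z = 1" for N z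
  proof -
    have "norm (P N z) \<le> (\<Sum>n<N. norm (a n))"
      unfolding P_def by (rule sum_norm_le) (simp add: norm_mult norm_power that)
    also have "\<dots> \<le> (\<Sum>n. norm (a n))"
      using sa by (intro sum_le_suminf) auto
    finally show ?thesis .
  qed
  have lim: "(\<lambda>N. P N z) \<longlonglongrightarrow> g z" if "norm z = 1" for z
    using sums[of z] that R by (simp add: sums_def P_def)
  have Pm: "P N \<in> borel_measurable circle" for N
    unfolding P_powi by (rule Linf_measurable[OF trig_sum_Linf])
  have gm: "g \<in> borel_measurable circle"
    by (rule borel_measurable_LIMSEQ_metric[of P]) (use lim Pm in auto)
  have "(\<lambda>N. \<integral>z. (norm (P N z))\<^sup>2 \<partial>circle) \<longlonglongrightarrow> (\<integral>z. (norm (g z))\<^sup>2 \<partial>circle)"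
    using Pm gm Pb lim
    by (intro integral_dominated_convergence[where w="\<lambda>_. (\<Sum>n. norm (a n))\<^sup>2"])
       (auto intro!: AE_I2 tendsto_intros power_mono)
  moreover have "(\<integral>z. (norm (P N z))\<^sup>2 \<partial>circle) = (\<Sum>n<N. (norm (a n))\<^sup>2)" for N
    unfolding P_powi by (rule integral_norm2_trig_sum) auto
  ultimately have "(\<lambda>N. \<Sum>n<N. (norm (a n))\<^sup>2) \<longlonglongrightarrow> (\<integral>z. (norm (g z))\<^sup>2 \<partial>circle)"
    by simp
  then show "(\<Sum>n<M. (norm (a n))\<^sup>2) \<le> (\<integral>z. (norm (g z))\<^sup>2 \<partial>circle)"
    by (rule incseq_le[rotated]) (auto intro!: incseq_SucI)
qed

text \<open>The double family \<open>c (i + j) * a i * b j\<close> is absolutely summable, so its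
  sums over the triangles \<open>i + j < M\<close> and over squares have the same limit. The
  triangles collect the coefficients of a product; the squares are finite sections of a Hankel
  form.\<close>

lemma weighted_Cauchy_product:
  fixes a b c :: "nat \<Rightarrow> complex"
  assumes a: "summable (\<lambda>n. norm (a n))" and b: "summable (\<lambda>n. norm (b n))"
    and c: "\<And>n. norm (c n) \<le> C"
    and lim: "(\<lambda>M. \<Sum>k<M. c k * (\<Sum>i\<le>k. a i * b (k - i))) \<longlonglongrightarrow> L"
  shows "(\<lambda>M. \<Sum>i<M. \<Sum>j<M. c (i + j) * a i * b j) \<longlonglongrightarrow> L"
proof -
  define F where "F = (\<lambda>(i, j). c (i + j) * a i * b j)"
  have C: "C \<ge> 0"
    using c[of 0] norm_ge_zero order_trans by blast
  have "(\<lambda>x. norm (F x)) summable_on UNIV"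
  proof (rule nonneg_bdd_above_summable_on)
    have "(\<Sum>x\<in>X. norm (F x)) \<le> C * ((\<Sum>n. norm (a n)) * (\<Sum>n. norm (b n)))"
      if X: "finite X" for X
    proof -
      obtain M where M: "fst ` X \<union> snd ` X \<subseteq> {..<M}"
        using finite_nat_iff_bounded[of "fst ` X \<union> snd ` X"] X by auto
      then have "X \<subseteq> {..<M} \<times> {..<M}"
        by force
      then have "(\<Sum>x\<in>X. norm (F x)) \<le> (\<Sum>x\<in>{..<M} \<times> {..<M}. norm (F x))"
        by (intro sum_mono2) auto
      also have "\<dots> \<le> (\<Sum>(i, j)\<in>{..<M} \<times> {..<M}. C * (norm (a i) * norm (b j)))"
        using c by (intro sum_mono) (auto simp: F_def norm_mult mult.assoc intro!: mult_right_mono)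
      also have "\<dots> = C * ((\<Sum>i<M. norm (a i)) * (\<Sum>j<M. norm (b j)))"
        unfolding sum.cartesian_product[symmetric] sum_product by (simp add: sum_distrib_left)
      also have "\<dots> \<le> C * ((\<Sum>n. norm (a n)) * (\<Sum>n. norm (b n)))"
        using C a b by (intro mult_left_mono mult_mono sum_le_suminf suminf_nonneg) (auto intro: sum_nonneg)
      finally show ?thesis .
    qed
    then show "bdd_above (sum (\<lambda>x. norm (F x)) ` {X. X \<subseteq> UNIV \<and> finite X})"
      by (auto intro!: bdd_aboveI2)
  qed simp
  then have "F summable_on UNIV"
    by (rule abs_summable_summable)
  then have F: "(sum F \<longlongrightarrow> infsum F UNIV) (finite_subsets_at_top UNIV)"
    using has_sum_infsum unfolding has_sum_def by blast
  have sq: "filterlim (\<lambda>M. {..<M} \<times> {..<M}) (finite_subsets_at_top UNIV) (sequentially :: nat filter)"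
    and tri: "filterlim (\<lambda>M. {(i, j). i + j < M}) (finite_subsets_at_top UNIV) (sequentially :: nat filter)"
  proof -
    have fin: "finite {(i, j). i + j < M}" for M :: nat
      by (rule finite_subset[of _ "{..<M} \<times> {..<M}"]) auto
    have ev: "eventually (\<lambda>M. X \<subseteq> {..<M} \<times> {..<M} \<and> X \<subseteq> {(i, j). i + j < M}) sequentially"
      if fX: "finite X" for X :: "(nat \<times> nat) set"
    proof -
      obtain K where K: "(\<lambda>(i, j). i + j) ` X \<subseteq> {..<K}"
        using finite_nat_iff_bounded finite_imageI[OF fX] by metis
      show ?thesis
        using eventually_ge_at_top[of K] by eventually_elim (use K in force)
    qed
    show "filterlim (\<lambda>M. {..<M} \<times> {..<M}) (finite_subsets_at_top UNIV) (sequentially :: nat filter)"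
      "filterlim (\<lambda>M. {(i, j). i + j < M}) (finite_subsets_at_top UNIV) (sequentially :: nat filter)"
      unfolding filterlim_finite_subsets_at_top using fin by (auto intro: eventually_mono[OF ev])
  qed
  have "sum F {(i, j). i + j < M} = (\<Sum>k<M. c k * (\<Sum>i\<le>k. a i * b (k - i)))" for M
    unfolding F_def by (subst sum.triangle_reindex) (auto simp: sum_distrib_left mult.assoc intro!: sum.cong)
  then have "infsum F UNIV = L"
    using LIMSEQ_unique[OF lim] filterlim_compose[OF F tri] by simp
  moreover have "sum F ({..<M} \<times> {..<M}) = (\<Sum>i<M. \<Sum>j<M. c (i + j) * a i * b j)" for M
    by (simp add: F_def flip: sum.cartesian_product)
  ultimately show ?thesis
    using filterlim_compose[OF F sq] by simp
qed

text \<open>The coefficients of \<open>p\<close> are the Cauchy product of those of the factors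
  \<open>g\<close> and \<open>h\<close>, so the functional is a limit of Hankel forms at
  \<open>a\<close> and \<open>b\<close>. Both sequences have squared norm at most the L1 norm
  \<open>I\<close> of \<open>p\<close>, and \<open>C * sqrt I * sqrt I\<close> is the claimed
  bound.\<close>

lemma nehari_poly_nonvanishing:
  assumes c: "hankel_bounded c C" "C \<ge> 0"
    and p: "\<And>z. norm z = 1 \<Longrightarrow> poly p z \<noteq> 0"
  shows "norm (\<Sum>k\<le>degree p. c k * coeff p k) \<le> C * (\<integral>z. norm (poly p z) \<partial>circle)"
proof -
  obtain R g h where R: "R > 1" and g: "g holomorphic_on ball 0 R" and h: "h holomorphic_on ball 0 R"
    and pgh: "\<And>z. z \<in> ball 0 R \<Longrightarrow> poly p z = g z * h z"
    and gn: "\<And>z. norm z = 1 \<Longrightarrow> (norm (g z))\<^sup>2 = norm (poly p z)"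
    and hn: "\<And>z. norm z = 1 \<Longrightarrow> (norm (h z))\<^sup>2 = norm (poly p z)"
    using poly_factor_circle[OF p] by metis
  define a b where "a = (\<lambda>n. (deriv ^^ n) g 0 / fact n)" and "b = (\<lambda>n. (deriv ^^ n) h 0 / fact n)"
  define I where "I = (\<integral>z. norm (poly p z) \<partial>circle)"
  have I0: "I \<ge> 0"
    by (simp add: I_def)
  have "(\<integral>z. (norm (g z))\<^sup>2 \<partial>circle) = I" "(\<integral>z. (norm (h z))\<^sup>2 \<partial>circle) = I"
    unfolding I_def using gn hn by (auto intro!: Bochner_Integration.integral_cong)
  then have aI: "(\<Sum>n<M. (norm (a n))\<^sup>2) \<le> I" and bI: "(\<Sum>n<M. (norm (b n))\<^sup>2) \<le> I" for M
    using taylor_coeffs_circle(2)[OF g R, of M] taylor_coeffs_circle(2)[OF h R, of M]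
    by (simp_all add: a_def b_def)
  have sa: "summable (\<lambda>n. norm (a n))" and sb: "summable (\<lambda>n. norm (b n))"
    using taylor_coeffs_circle(1)[OF g R] taylor_coeffs_circle(1)[OF h R]
    by (simp_all add: a_def b_def)
  have conv: "(\<Sum>i\<le>k. a i * b (k - i)) = coeff p k" for k
  proof -
    have "(\<lambda>z. g z * h z) has_fps_expansion fps_expansion g 0 * fps_expansion h 0"
      using g h R by (intro has_fps_expansion_mult has_fps_expansion_fps_expansion[of "ball 0 R"]) auto
    moreover have ev: "eventually (\<lambda>z. g z * h z = poly p z) (nhds 0)"
      using eventually_nhds_in_open[of "ball 0 R" "0::complex"] R
      by (auto elim!: eventually_mono simp: pgh)
    ultimately have "poly p has_fps_expansion fps_expansion g 0 * fps_expansion h 0"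
      using has_fps_expansion_cong[OF ev refl] by blast
    moreover have "poly p has_fps_expansion fps_of_poly p"
      by (simp add: has_fps_expansion_def)
    ultimately have "fps_expansion g 0 * fps_expansion h 0 = fps_of_poly p"
      by (rule fps_expansion_unique_complex)
    then have "fps_nth (fps_expansion g 0 * fps_expansion h 0) k = coeff p k"
      by simp
    then show ?thesis
      by (simp add: fps_mult_nth fps_expansion_def a_def b_def atLeast0AtMost)
  qed
  have "eventually (\<lambda>M. (\<Sum>k<M. c k * coeff p k) = (\<Sum>k\<le>degree p. c k * coeff p k)) sequentially"
    using eventually_gt_at_top[of "degree p"]
    by eventually_elim (rule sum.mono_neutral_right, auto intro: le_degree)
  then have "(\<lambda>M. \<Sum>k<M. c k * coeff p k) \<longlonglongrightarrow> (\<Sum>k\<le>degree p. c k * coeff p k)"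
    by (rule tendsto_eventually)
  then have "(\<lambda>M. \<Sum>i<M. \<Sum>j<M. c (i + j) * a i * b j) \<longlonglongrightarrow> (\<Sum>k\<le>degree p. c k * coeff p k)"
    using weighted_Cauchy_product[OF sa sb hankel_bounded_norm_le[OF c]] conv by simp
  moreover have "norm (\<Sum>i<M. \<Sum>j<M. c (i + j) * a i * b j) \<le> C * I" for M
  proof -
    have "norm (\<Sum>i<M. \<Sum>j<M. c (i + j) * a i * b j)
      \<le> C * sqrt (\<Sum>i<M. (norm (a i))\<^sup>2) * sqrt (\<Sum>j<M. (norm (b j))\<^sup>2)"
      by (rule hankel_bounded_bilinear[OF c])
    also have "\<dots> \<le> C * sqrt I * sqrt I"
      using aI bI c(2) I0
      by (intro mult_mono mult_left_mono real_sqrt_le_mono mult_nonneg_nonneg real_sqrt_ge_zero sum_nonneg) auto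
    finally show ?thesis
      using I0 by (simp add: mult.assoc)
  qed
  ultimately show ?thesis
    unfolding I_def by (intro LIMSEQ_le_const2[OF tendsto_norm]) auto
qed

lemma poly_Linf_circle: "(\<lambda>z. poly p (r * z)) \<in> Linf circle"
proof -
  have "(\<lambda>z. poly p (r * z)) = (\<lambda>z. \<Sum>k\<le>degree p. (coeff p k * r ^ k) * z powi int k)"
    by (simp add: fun_eq_iff poly_altdef power_mult_distrib mult_ac)
  then show ?thesis
    using trig_sum_Linf by metis
qed

lemma nehari_poly:
  assumes c: "hankel_bounded c C" "C \<ge> 0"
  shows "norm (\<Sum>k\<le>degree p. c k * coeff p k) \<le> C * (\<integral>z. norm (poly p z) \<partial>circle)"
proof (cases "p = 0")
  case False
  \<comment> \<open>All but finitely many dilations of \<open>p\<close> have no zero on the circle.\<close>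
  define r where "r n = 1 + 1 / real (Suc n)" for n
  have r1: "r \<longlonglongrightarrow> 1"
    unfolding r_def using LIMSEQ_inverse_real_of_nat_add[of 1] by (simp add: inverse_eq_divide)
  have rb: "1 < r n" "r n \<le> 2" for n
    by (auto simp: r_def field_simps)
  define q where "q n = pcompose p [:0, of_real (r n):]" for n
  have qz: "poly (q n) z = poly p (of_real (r n) * z)" for n z
    by (simp add: q_def poly_pcompose mult.commute)
  have qc: "coeff (q n) k = of_real (r n) ^ k * coeff p k" for n k
    by (simp add: q_def coeff_pcompose_linear)
  have qd: "degree (q n) = degree p" for n
    using rb[of n] by (simp add: q_def degree_pcompose)
  have "finite (norm ` {w. poly p w = 0})"
    using poly_roots_finite[OF False] by simp
  then have "eventually (\<lambda>x. x \<notin> norm ` {w. poly p w = 0}) (at 1)"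
    using islimpt_finite islimpt_iff_eventually by blast
  moreover have "filterlim r (at 1) sequentially"
    using r1 rb(1) by (auto simp: filterlim_at less_imp_neq intro!: always_eventually) (metis less_irrefl)
  ultimately have "eventually (\<lambda>n. r n \<notin> norm ` {w. poly p w = 0}) sequentially"
    using filterlim_iff by blast
  then have ev: "eventually (\<lambda>n. norm (\<Sum>k\<le>degree p. c k * coeff (q n) k)
      \<le> C * (\<integral>z. norm (poly (q n) z) \<partial>circle)) sequentially"
  proof eventually_elim
    case (elim n)
    have "poly (q n) z \<noteq> 0" if "norm z = 1" for z
    proof
      assume "poly (q n) z = 0"
      moreover have "norm (of_real (r n) * z) = r n"
        using that rb(1)[of n] by (simp add: norm_mult)
      ultimately show False
        using elim by (force simp: qz)
    qed
    then show ?case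
      using nehari_poly_nonvanishing[OF c, of "q n"] by (simp add: qd)
  qed
  \<comment> \<open>All dilation factors are at most 2, so this disc supplies a common dominating
    constant.\<close>
  have "bounded (poly p ` cball 0 2)"
    by (intro compact_imp_bounded compact_continuous_image continuous_intros) simp
  then obtain B where "\<forall>z\<in>cball 0 2. norm (poly p z) \<le> B"
    by (auto simp: bounded_iff)
  then have B: "norm (poly p z) \<le> B" if "norm z \<le> 2" for z
    using that by simp
  have "(\<lambda>n. \<integral>z. norm (poly (q n) z) \<partial>circle) \<longlonglongrightarrow> (\<integral>z. norm (poly p z) \<partial>circle)"
  proof (rule integral_dominated_convergence[where w="\<lambda>_. B"])
    show "AE z in circle. (\<lambda>n. norm (poly (q n) z)) \<longlonglongrightarrow> norm (poly p z)"
    proof (intro AE_I2 tendsto_norm)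
      fix z :: complex
      have "(\<lambda>n. of_real (r n) * z) \<longlonglongrightarrow> of_real 1 * z"
        by (intro tendsto_mult tendsto_of_real tendsto_const r1)
      then show "(\<lambda>n. poly (q n) z) \<longlonglongrightarrow> poly p z"
        unfolding qz using isCont_tendsto_compose[OF poly_isCont] by simp
    qed
    show "(\<lambda>z. norm (poly p z)) \<in> borel_measurable circle"
      using Linf_measurable[OF poly_Linf_circle[of p 1]] by simp
    show "(\<lambda>z. norm (poly (q n) z)) \<in> borel_measurable circle" for n
      using Linf_measurable[OF poly_Linf_circle[of p "of_real (r n)"]] by (simp add: qz)
    show "AE z in circle. norm (norm (poly (q n) z)) \<le> B" for n
      using rb[of n] by (auto intro!: AE_I2 B simp: qz norm_mult)
  qed simp
  then have 1: "(\<lambda>n. C * (\<integral>z. norm (poly (q n) z) \<partial>circle)) \<longlonglongrightarrow> C * (\<integral>z. norm (poly p z) \<partial>circle)"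
    by (intro tendsto_intros)
  have "(\<lambda>n. \<Sum>k\<le>degree p. c k * coeff (q n) k)
      \<longlonglongrightarrow> (\<Sum>k\<le>degree p. c k * (of_real 1 ^ k * coeff p k))"
    unfolding qc by (intro tendsto_intros r1)
  then have 2: "(\<lambda>n. norm (\<Sum>k\<le>degree p. c k * coeff (q n) k))
      \<longlonglongrightarrow> norm (\<Sum>k\<le>degree p. c k * coeff p k)"
    by (intro tendsto_norm) simp
  show ?thesis
    using tendsto_le[OF sequentially_bot 1 2 ev] .
qed simp

text \<open>The number of coefficients is prescribed instead of a degree, because they will depend
  on the fibre and leading ones may vanish.\<close>

lemma nehari_scalar:
  assumes c: "hankel_bounded c C" "C \<ge> 0"
  shows "norm (\<Sum>k<n. c k * a k) \<le> C * (\<integral>z. norm (\<Sum>k<n. a k * z ^ k) \<partial>circle)"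
proof -
  define p where "p = (\<Sum>k<n. monom (a k) k)"
  have cp: "coeff p k = (if k < n then a k else 0)" for k
    by (simp add: p_def coeff_sum sum.delta)
  have pz: "poly p z = (\<Sum>k<n. a k * z ^ k)" for z
    by (simp add: p_def poly_sum poly_monom)
  have "(\<Sum>k<n. c k * a k) = (\<Sum>k\<in>{..<n} \<union> {..degree p}. c k * coeff p k)"
    by (rule sum.mono_neutral_cong_left) (auto simp: cp)
  also have "\<dots> = (\<Sum>k\<le>degree p. c k * coeff p k)"
    by (rule sum.mono_neutral_right) (auto simp: coeff_eq_0)
  finally show ?thesis
    using nehari_poly[OF c, of p] by (simp add: pz)
qed

section \<open>Shear coordinates on the torus\<close>

text \<open>The coordinates \<open>(\<lambda>, z) \<mapsto> (z, \<lambda> z)\<close> on the torus, in which \<^term>\<open>H1\<close> consists of the functions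
  that are analytic in \<open>z\<close>.\<close>

definition shear :: "complex \<times> complex \<Rightarrow> complex \<times> complex" where
  "shear x = (snd x, fst x * snd x)"

lemma fst_torus_measurable: "fst \<in> borel_measurable torus"
  and snd_torus_measurable: "snd \<in> borel_measurable torus"
  using measurable_compose[OF measurable_fst id_measurable_circle, of circle]
    measurable_compose[OF measurable_snd id_measurable_circle, of circle] by simp_all

lemma space_torus: "x \<in> space torus \<longleftrightarrow> norm (fst x) = 1 \<and> norm (snd x) = 1"
  by (auto simp: space_pair_measure mem_Times_iff)

lemma shear_measurable: "shear \<in> torus \<rightarrow>\<^sub>M torus"
  unfolding shear_def
  by (intro measurable_Pair measurable_snd measurable_circleI borel_measurable_times
      fst_torus_measurable snd_torus_measurable) (auto simp: space_torus norm_mult)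

text \<open>For fixed \<open>z\<close> the map taking \<open>w\<close> to \<open>w * z\<close> is a
  rotation, which preserves the circle measure; Tonelli's theorem integrates this over
  \<open>z\<close>.\<close>

lemma distr_shear: "distr torus torus shear = torus"
proof (rule measure_eqI)
  fix A assume "A \<in> sets (distr torus torus shear)"
  then have A: "A \<in> sets torus" by simp
  define X where "X = shear -` A \<inter> space torus"
  have X: "X \<in> sets torus"
    unfolding X_def by (rule measurable_sets[OF shear_measurable A])
  have "emeasure circle ((\<lambda>w. (w, z)) -` X) = emeasure circle (Pair z -` A)" if "z \<in> space circle" for z
  proof -
    have z: "norm z = 1"
      using that by simp
    have rot: "(*) z \<in> circle \<rightarrow>\<^sub>M circle"
      using z id_measurable_circle
      by (intro measurable_circleI borel_measurable_times) (auto simp: norm_mult)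
    have Az: "Pair z -` A \<in> sets circle"
      using A by (rule sets_Pair1)
    have "(\<lambda>w. (w, z)) -` X = (*) z -` (Pair z -` A) \<inter> space circle"
      using z by (auto simp: X_def shear_def space_torus mult.commute)
    then have "emeasure circle ((\<lambda>w. (w, z)) -` X) = emeasure (distr circle circle ((*) z)) (Pair z -` A)"
      using emeasure_distr[OF rot Az] by simp
    then show ?thesis
      by (simp add: circle_rotate[OF z])
  qed
  then have "(\<integral>\<^sup>+z. emeasure circle ((\<lambda>w. (w, z)) -` X) \<partial>circle) = (\<integral>\<^sup>+z. emeasure circle (Pair z -` A) \<partial>circle)"
    by (rule nn_integral_cong)
  then have "emeasure torus X = emeasure torus A"
    using torus.emeasure_pair_measure_alt2[OF X] circle.emeasure_pair_measure_alt[OF A] by simp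
  then show "emeasure (distr torus torus shear) A = emeasure torus A"
    using emeasure_distr[OF shear_measurable A] by (simp add: X_def)
qed simp

lemma AE_shear:
  assumes "AE x in torus. P x"
  shows "AE w in circle. AE z in circle. P (z, w * z)"
proof -
  have "AE x in distr torus torus shear. P x"
    unfolding distr_shear by fact
  then have "AE x in torus. P (shear x)"
    by (rule AE_distrD[OF shear_measurable])
  then show ?thesis
    using torus.AE_pair[of "\<lambda>x. P (shear x)"] by (simp add: shear_def)
qed

lemma Linf_shear:
  assumes "f \<in> Linf torus"
  shows "(\<lambda>x. f (shear x)) \<in> Linf torus"
proof -
  obtain C where "AE x in distr torus torus shear. norm (f x) \<le> C"
    unfolding distr_shear using Linf_bound[OF assms] by metis
  then have "AE x in torus. norm (f (shear x)) \<le> C"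
    by (rule AE_distrD[OF shear_measurable])
  then show ?thesis
    using measurable_compose[OF shear_measurable Linf_measurable[OF assms]] by (auto simp: Linf_def)
qed

lemma integral_shear:
  fixes f :: "complex \<times> complex \<Rightarrow> 'b::{banach, second_countable_topology}"
  assumes "integrable torus f"
  shows "(\<integral>x. f x \<partial>torus) = (\<integral>w. (\<integral>z. f (z, w * z) \<partial>circle) \<partial>circle)"
    and "integrable circle (\<lambda>w. \<integral>z. f (z, w * z) \<partial>circle)"
    and "AE w in circle. integrable circle (\<lambda>z. f (z, w * z))"
proof -
  have i: "integrable torus (\<lambda>x. f (shear x))"
    using integrable_distr[OF shear_measurable, of f] assms by (simp add: distr_shear)
  have "(\<integral>x. f x \<partial>torus) = (\<integral>x. f (shear x) \<partial>torus)"
    using integral_distr[OF shear_measurable, of f] assms by (simp add: distr_shear)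
  then show "(\<integral>x. f x \<partial>torus) = (\<integral>w. (\<integral>z. f (z, w * z) \<partial>circle) \<partial>circle)"
    using torus.integral_fst'[OF i] by (simp add: shear_def)
  show "integrable circle (\<lambda>w. \<integral>z. f (z, w * z) \<partial>circle)"
    using torus.integrable_fst'[OF i] by (simp add: shear_def)
  show "AE w in circle. integrable circle (\<lambda>z. f (z, w * z))"
    using torus.AE_integrable_fst'[OF i] by (simp add: shear_def)
qed

lemma powi_Linf_torus:
  "(\<lambda>x. fst x powi k) \<in> Linf torus" "(\<lambda>x. snd x powi k) \<in> Linf torus"
  using powi_measurable_circle[OF measurable_fst[of circle circle]]
    powi_measurable_circle[OF measurable_snd[of circle circle]]
  by (auto intro!: LinfI[where C=1] simp: space_torus norm_power_int)

text \<open>An explicit counterpart of \<open>component f k\<close>, which is only chosen by its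
  Fourier coefficients and therefore gives no direct access to a single fibre.\<close>

definition slice :: "(complex \<times> complex \<Rightarrow> complex) \<Rightarrow> int \<Rightarrow> complex \<Rightarrow> complex" where
  "slice f k w = (\<integral>z. f (z, w * z) * z powi (- k) \<partial>circle)"

lemma slice_eq_fourier_coeff: "slice f k w = fourier_coeff (\<lambda>z. f (z, w * z)) k"
  by (simp add: slice_def fourier_coeff_def)

lemma slice_Linf:
  assumes "f \<in> Linf torus"
  shows "slice f k \<in> Linf circle"
proof -
  have "(\<lambda>x. f (shear x) * snd x powi (- k)) \<in> borel_measurable torus"
    by (intro borel_measurable_times Linf_measurable powi_Linf_torus Linf_shear assms)
  then have m: "slice f k \<in> borel_measurable circle"
    unfolding slice_def
    by (intro circle.borel_measurable_lebesgue_integral) (simp add: case_prod_beta' shear_def)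
  obtain C where C: "C \<ge> 0" "AE x in torus. norm (f x) \<le> C"
    using Linf_bound[OF assms] .
  from AE_shear[OF C(2)] have "AE w in circle. norm (slice f k w) \<le> C"
  proof eventually_elim
    case (elim w)
    have "norm (slice f k w) \<le> (\<integral>z. norm (f (z, w * z) * z powi (- k)) \<partial>circle)"
      unfolding slice_def by (rule integral_norm_bound)
    also have "\<dots> \<le> C"
    \<comment> \<open>An integral that does not exist is 0 by convention, so the bound by
      \<open>C \<ge> 0\<close> also covers such fibres.\<close>
    proof (cases "integrable circle (\<lambda>z. norm (f (z, w * z) * z powi (- k)))")
      case True
      have "(\<integral>z. norm (f (z, w * z) * z powi (- k)) \<partial>circle) \<le> (\<integral>z. C \<partial>circle)"
        using True elim by (intro integral_mono_AE) (auto simp: norm_mult norm_power_int elim: AE_mp)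
      then show ?thesis
        by (simp add: circle.prob_space del: space_circle)
    next
      case False
      then show ?thesis
        using C(1) by (simp add: not_integrable_integral_eq)
    qed
    finally show ?case .
  qed
  then show ?thesis
    using m by (auto simp: Linf_def)
qed

text \<open>In shear coordinates the character with exponents \<open>k - n\<close> and
  \<open>n\<close> becomes \<open>z powi k * w powi n\<close>: the integral over \<open>z\<close>
  isolates the antidiagonal \<open>k\<close>, the integral over \<open>w\<close> its entry
  \<open>n\<close>.\<close>

lemma fourier_coeff_slice:
  assumes "f \<in> Linf torus"
  shows "fourier_coeff (slice f k) n = fourier_coeff2 f (k - n) n"
proof -
  define q where "q x = f x * fst x powi (- (k - n)) * snd x powi (- n)" for x
  have "q \<in> Linf torus"
    unfolding q_def by (intro Linf_mult assms powi_Linf_torus)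
  then have "fourier_coeff2 f (k - n) n = (\<integral>w. (\<integral>z. q (z, w * z) \<partial>circle) \<partial>circle)"
    unfolding fourier_coeff2_def using integral_shear(1)[of q] torus.Linf_integrable
    by (simp add: q_def)
  also have "\<dots> = (\<integral>w. (\<integral>z. f (z, w * z) * z powi (- k) * w powi (- n) \<partial>circle) \<partial>circle)"
  proof (intro Bochner_Integration.integral_cong refl)
    fix w z :: complex assume "z \<in> space circle"
    then have "z \<noteq> 0" by auto
    then have "z powi (- (k - n)) * z powi (- n) = z powi (- k)"
      by (simp flip: power_int_add)
    moreover have "q (z, w * z) = f (z, w * z) * (z powi (- (k - n)) * z powi (- n)) * w powi (- n)"
      by (simp add: q_def power_int_mult_distrib mult_ac)
    ultimately show "q (z, w * z) = f (z, w * z) * z powi (- k) * w powi (- n)"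
      by simp
  qed
  finally show ?thesis
    by (simp add: fourier_coeff_def slice_def)
qed

section \<open>Uniqueness of Fourier coefficients of bounded functions\<close>

lemma continuous_Linf_circle:
  fixes h :: "complex \<Rightarrow> real"
  assumes "continuous_on (sphere 0 1) h"
  shows "(\<lambda>z. of_real (h z)) \<in> Linf circle"
proof -
  have "bounded (h ` sphere 0 1)"
    using assms by (intro compact_imp_bounded compact_continuous_image) auto
  then obtain C where "\<forall>z\<in>sphere 0 1. norm (h z) \<le> C"
    by (auto simp: bounded_iff)
  moreover have "(\<lambda>z. complex_of_real (h z)) \<in> borel_measurable circle"
    unfolding measurable_cong_sets[OF sets_circle refl]
    using assms by (intro borel_measurable_continuous_on_restrict continuous_on_of_real)
  ultimately show ?thesis
    by (intro LinfI[where C=C]) auto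
qed

lemma continuous_on_real_polynomial_function:
  "real_polynomial_function p \<Longrightarrow> continuous_on S p"
  by (intro continuous_at_imp_continuous_on ballI continuous_real_polymonial_function)

text \<open>The induction needs all Fourier coefficients of the product, not only its mean.\<close>

lemma fourier_coeff_mult_polynomial:
  assumes "real_polynomial_function h" "f \<in> Linf circle" "\<And>n. fourier_coeff f n = 0"
  shows "fourier_coeff (\<lambda>z. of_real (h z) * f z) n = 0"
  using assms
proof (induction arbitrary: f n rule: real_polynomial_function.induct)
  case (linear h)
  interpret h: bounded_linear h by fact
  \<comment> \<open>On the circle a real-linear function is a combination of \<open>z\<close> and
    \<open>cnj z = inverse z\<close>, so multiplication by it shifts the frequencies by one.\<close>
  define a b where "a = (of_real (h 1) - \<i> * of_real (h \<i>)) / 2" and "b = (of_real (h 1) + \<i> * of_real (h \<i>)) / 2"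
  have hz: "of_real (h z) = a * z powi 1 + b * z powi (- 1)" if "norm z = 1" for z
  proof -
    have "z = Re z *\<^sub>R 1 + Im z *\<^sub>R \<i>"
      by (simp add: complex_eq_iff)
    then have "h z = Re z * h 1 + Im z * h \<i>"
      by (metis h.add h.scaleR real_scaleR_def)
    then have "of_real (h z) = a * z + b * cnj z"
      by (simp add: a_def b_def complex_eq_iff field_simps)
    then show ?thesis
      using cnj_powi_circle[OF that, of 1] by simp
  qed
  have i: "integrable circle (\<lambda>z. f z * z powi m)" for m
    by (intro circle.Linf_integrable Linf_mult linear.prems powi_Linf_circle)
  have "fourier_coeff (\<lambda>z. of_real (h z) * f z) n
      = (\<integral>z. a * (f z * z powi (- (n - 1))) + b * (f z * z powi (- (n + 1))) \<partial>circle)"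
    unfolding fourier_coeff_def
  proof (intro Bochner_Integration.integral_cong refl)
    fix z assume "z \<in> space circle"
    then have z: "norm z = 1" "z \<noteq> 0" by auto
    then have "z powi 1 * z powi (- n) = z powi (- (n - 1))" "z powi (- 1) * z powi (- n) = z powi (- (n + 1))"
      using power_int_add[of z 1 "- n"] power_int_add[of z "- 1" "- n"] by (simp_all add: algebra_simps)
    then show "of_real (h z) * f z * z powi (- n)
      = a * (f z * z powi (- (n - 1))) + b * (f z * z powi (- (n + 1)))"
      unfolding hz[OF z(1)] by (simp only: distrib_right distrib_left mult_ac)
  qed
  also have "\<dots> = a * fourier_coeff f (n - 1) + b * fourier_coeff f (n + 1)"
    using i by (simp add: fourier_coeff_def)
  finally show ?case
    using linear.prems by simp
next
  case (const c)
  then show ?case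
    by (simp add: fourier_coeff_def mult.assoc)
next
  case (add g h)
  have L: "(\<lambda>z. of_real (p z) * f z * z powi (- n)) \<in> Linf circle" if "real_polynomial_function p" for p
    using that add.prems
    by (intro Linf_mult powi_Linf_circle continuous_Linf_circle)
       (auto intro: continuous_on_real_polynomial_function)
  have "fourier_coeff (\<lambda>z. of_real (g z + h z) * f z) n
     = fourier_coeff (\<lambda>z. of_real (g z) * f z) n + fourier_coeff (\<lambda>z. of_real (h z) * f z) n"
    unfolding fourier_coeff_def
    using circle.Linf_integrable[OF L[OF add.hyps(1)]] circle.Linf_integrable[OF L[OF add.hyps(2)]]
    by (simp add: distrib_right)
  then show ?case
    using add by simp
next
  case (mult g h)
  have "(\<lambda>z. of_real (h z) * f z) \<in> Linf circle"
    using mult.prems mult.hyps(2)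
    by (intro Linf_mult continuous_Linf_circle) (auto intro: continuous_on_real_polynomial_function)
  then have "fourier_coeff (\<lambda>z. of_real (g z) * (of_real (h z) * f z)) n = 0"
    using mult by blast
  then show ?case
    by (simp add: mult.assoc)
qed

text \<open>Stone-Weierstrass approximates \<open>h\<close> uniformly by real polynomials in the
  coordinates, against which \<open>f\<close> integrates to 0; the error is at most the uniform
  distance times the L1 norm of \<open>f\<close>.\<close>

lemma integral_mult_continuous_eq_0:
  fixes h :: "complex \<Rightarrow> real"
  assumes f: "f \<in> Linf circle" "\<And>n. fourier_coeff f n = 0" and h: "continuous_on (sphere 0 1) h"
  shows "(\<integral>z. of_real (h z) * f z \<partial>circle) = 0"
proof -
  have L: "integrable circle (\<lambda>z. of_real (g z) * f z)" if "continuous_on (sphere 0 1) g" for g :: "complex \<Rightarrow> real"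
    by (intro circle.Linf_integrable Linf_mult f continuous_Linf_circle that)
  have fi: "integrable circle f"
    by (rule circle.Linf_integrable[OF f(1)])
  define K where "K = (\<integral>z. norm (f z) \<partial>circle)"
  have K: "K \<ge> 0"
    by (simp add: K_def)
  have "norm (\<integral>z. of_real (h z) * f z \<partial>circle) \<le> 0 + e" if "e > 0" for e
  proof -
    \<comment> \<open>Dividing by \<open>K + 1\<close> keeps \<open>d\<close> positive when
      \<open>K = 0\<close> and still gives \<open>d * K \<le> e\<close>.\<close>
    define d where "d = e / (K + 1)"
    have d: "d > 0"
      using that K by (simp add: d_def)
    obtain g where g: "real_polynomial_function g" "\<And>z. z \<in> sphere 0 1 \<Longrightarrow> \<bar>h z - g z\<bar> < d"
      using Stone_Weierstrass_real_polynomial_function[OF compact_sphere h d] by blast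
    have gc: "continuous_on (sphere 0 1) g"
      by (rule continuous_on_real_polynomial_function[OF g(1)])
    have "(\<integral>z. of_real (g z) * f z \<partial>circle) = 0"
      using fourier_coeff_mult_polynomial[OF g(1) f, of 0] by (simp add: fourier_coeff_def)
    then have "(\<integral>z. of_real (h z) * f z \<partial>circle) = (\<integral>z. of_real (h z) * f z - of_real (g z) * f z \<partial>circle)"
      using L[OF h] L[OF gc] by simp
    also have "norm \<dots> \<le> (\<integral>z. norm (of_real (h z) * f z - of_real (g z) * f z) \<partial>circle)"
      by (rule integral_norm_bound)
    also have "\<dots> \<le> (\<integral>z. d * norm (f z) \<partial>circle)"
    proof (intro integral_mono)
      fix z assume "z \<in> space circle"
      then have "\<bar>h z - g z\<bar> \<le> d"
        using g(2)[of z] by simp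
      moreover have "norm (of_real (h z) * f z - of_real (g z) * f z) = \<bar>h z - g z\<bar> * norm (f z)"
        by (simp flip: left_diff_distrib of_real_diff add: norm_mult)
      ultimately show "norm (of_real (h z) * f z - of_real (g z) * f z) \<le> d * norm (f z)"
        by (simp add: mult_right_mono)
    qed (use L[OF h] L[OF gc] fi in auto)
    also have "\<dots> = d * K"
      by (simp add: K_def)
    also have "\<dots> \<le> e"
      using that K by (simp add: d_def field_simps)
    finally show ?thesis by simp
  qed
  then have "norm (\<integral>z. of_real (h z) * f z \<partial>circle) \<le> 0"
    by (rule field_le_epsilon)
  then show ?thesis by simp
qed

text \<open>The integral of \<open>f\<close> vanishes over closed sets, whose indicators are limits
  of continuous functions, and over all Borel sets by Dynkin's argument, since closed sets are
  stable under intersection. A function with vanishing integral over every measurable set is 0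
  almost everywhere.\<close>

lemma fourier_coeff_eq_0_imp_AE:
  assumes f: "f \<in> Linf circle" "\<And>n. fourier_coeff f n = 0"
  shows "AE z in circle. f z = 0"
proof (rule circle.density_zero)
  show fi: "integrable circle f"
    by (rule circle.Linf_integrable[OF f(1)])
  have B: "B \<inter> sphere 0 1 \<in> sets circle" if "B \<in> sets borel" for B
    using that unfolding sets_circle sets_restrict_space by (auto simp: Int_commute)
  have fB: "set_integrable circle (B \<inter> sphere 0 1) f" if "B \<in> sets borel" for B
    unfolding set_integrable_def by (rule integrable_mult_indicator[OF B[OF that] fi])
  have total: "(\<integral>z. f z \<partial>circle) = 0"
    using f(2)[of 0] by (simp add: fourier_coeff_def)
  have "(\<integral>z\<in>B \<inter> sphere 0 1. f z \<partial>circle) = 0" if "B \<in> sigma_sets UNIV (Collect closed)" for B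
  proof (rule sigma_sets_induct_disjoint[OF _ _ that])
    show "Int_stable (Collect closed)"
      by (auto simp: Int_stable_def)
  next
    fix B :: "complex set" assume "B \<in> Collect closed"
    then have clo: "closed B" by simp
    show "(\<integral>z\<in>B \<inter> sphere 0 1. f z \<partial>circle) = 0"
    \<comment> \<open>\<open>infdist z {}\<close> is 0 by convention, which would turn the functions
      \<open>h n\<close> below into the constant 1. For nonempty closed \<open>B\<close> they are 1
      on \<open>B\<close> and eventually 0 at every other point, where the distance is
      positive.\<close>
    proof (cases "B = {}")
      case False
      define h where "h n z = max 0 (1 - real n * infdist z B)" for n and z :: complex
      have hc: "continuous_on S (h n)" for n S
        unfolding h_def by (intro continuous_intros)
      have lim: "(\<lambda>n. h n z) \<longlonglongrightarrow> indicator (B \<inter> sphere 0 1) z" if "z \<in> sphere 0 1" for z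
      proof (cases "z \<in> B")
        case True
        then show ?thesis
          using that by (simp add: h_def)
      next
        case zB: False
        then have pos: "infdist z B > 0"
          using clo False by (metis in_closed_iff_infdist_zero infdist_nonneg le_less)
        obtain N where N: "1 < real N * infdist z B"
          using reals_Archimedean3[OF pos] by blast
        have "eventually (\<lambda>n. h n z = 0) sequentially"
          using eventually_ge_at_top[of N]
        proof eventually_elim
          case (elim n)
          have "real N * infdist z B \<le> real n * infdist z B"
            using elim pos by (intro mult_right_mono) auto
          then show ?case
            using N by (simp add: h_def)
        qed
        then show ?thesis
          using zB by (simp add: tendsto_eventually)
      qed
      have "(\<lambda>n. \<integral>z. of_real (h n z) * f z \<partial>circle) \<longlonglongrightarrow> (\<integral>z\<in>B \<inter> sphere 0 1. f z \<partial>circle)"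
        unfolding set_lebesgue_integral_def
      proof (rule integral_dominated_convergence[where w="\<lambda>z. norm (f z)"])
        show "AE z in circle. (\<lambda>n. of_real (h n z) * f z) \<longlonglongrightarrow> indicator (B \<inter> sphere 0 1) z *\<^sub>R f z"
          unfolding scaleR_conv_of_real
          by (intro AE_I2 tendsto_mult tendsto_of_real tendsto_const lim) simp
        show "AE z in circle. norm (of_real (h n z) * f z) \<le> norm (f z)" for n
          by (intro AE_I2) (auto simp: h_def norm_mult infdist_nonneg intro!: mult_left_le_one_le)
        show "(\<lambda>z. of_real (h n z) * f z) \<in> borel_measurable circle" for n
          by (intro Linf_measurable Linf_mult f continuous_Linf_circle hc)
        show "(\<lambda>z. indicator (B \<inter> sphere 0 1) z *\<^sub>R f z) \<in> borel_measurable circle"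
          using fB[OF borel_closed[OF clo]] by (auto simp: set_integrable_def)
      qed (use fi in auto)
      then show ?thesis
        using integral_mult_continuous_eq_0[OF f hc] by (simp add: LIMSEQ_const_iff)
    qed (simp add: set_lebesgue_integral_def)
  next
    show "(\<integral>z\<in>{} \<inter> sphere 0 1. f z \<partial>circle) = 0"
      by (simp add: set_lebesgue_integral_def)
  next
    fix B :: "complex set" assume "B \<in> sigma_sets UNIV (Collect closed)" and 0: "(\<integral>z\<in>B \<inter> sphere 0 1. f z \<partial>circle) = 0"
    then have "B \<in> sets borel"
      by (simp add: borel_eq_closed)
    have "(\<integral>z\<in>(UNIV - B) \<inter> sphere 0 1. f z \<partial>circle)
      = (\<integral>z. f z - indicator (B \<inter> sphere 0 1) z *\<^sub>R f z \<partial>circle)"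
      unfolding set_lebesgue_integral_def
      by (intro Bochner_Integration.integral_cong) (auto split: split_indicator)
    also have "\<dots> = 0"
      using fi fB[OF \<open>B \<in> sets borel\<close>] 0 total
      by (subst Bochner_Integration.integral_diff) (auto simp: set_integrable_def set_lebesgue_integral_def)
    finally show "(\<integral>z\<in>(UNIV - B) \<inter> sphere 0 1. f z \<partial>circle) = 0" .
  next
    fix A :: "nat \<Rightarrow> complex set"
    assume A: "disjoint_family A" "range A \<subseteq> sigma_sets UNIV (Collect closed)"
      and 0: "\<And>i. (\<integral>z\<in>A i \<inter> sphere 0 1. f z \<partial>circle) = 0"
    have Ab: "A i \<in> sets borel" for i
      using A(2) by (auto simp: borel_eq_closed)
    have "(\<integral>z\<in>(\<Union>i. A i \<inter> sphere 0 1). f z \<partial>circle) = (\<Sum>i. (\<integral>z\<in>A i \<inter> sphere 0 1. f z \<partial>circle))"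
    proof (rule lebesgue_integral_countable_add)
      show "A i \<inter> sphere 0 1 \<inter> (A j \<inter> sphere 0 1) = {}" if "i \<noteq> j" for i j
        using A(1) that by (auto simp: disjoint_family_on_def)
      show "set_integrable circle (\<Union>i. A i \<inter> sphere 0 1) f"
        using fB[of "\<Union>i. A i"] Ab by (simp add: Int_UN_distrib2 Int_commute)
    qed (rule B[OF Ab])
    then show "(\<integral>z\<in>\<Union>(range A) \<inter> sphere 0 1. f z \<partial>circle) = 0"
      using 0 by simp
  qed auto
  moreover fix A assume "A \<in> sets circle"
  then obtain B where "B \<in> sets borel" "A = B \<inter> sphere 0 1"
    unfolding sets_circle sets_restrict_space by (auto simp: Int_commute)
  ultimately show "(\<integral>z\<in>A. f z \<partial>circle) = 0"
    by (simp add: borel_eq_closed)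
qed

text \<open>Bounded functions with equal Fourier coefficients agree almost everywhere. Only
  coefficients with \<open>m + n = k\<close> are compared, so \<psi> may be \<phi> itself or, for
  negative \<open>k\<close>, its difference with an element of \<open>H1\<close>.\<close>

lemma component_AE_slice:
  assumes "\<phi> \<in> Linf torus" "\<psi> \<in> Linf torus"
    and "\<And>n. fourier_coeff2 \<phi> (k - n) n = fourier_coeff2 \<psi> (k - n) n"
  shows "AE w in circle. component \<phi> k w = slice \<psi> k w"
proof -
  have L: "component \<phi> k \<in> Linf circle" "slice \<psi> k \<in> Linf circle"
    using component(1)[OF assms(1)] slice_Linf[OF assms(2)] by auto
  have i: "integrable circle (\<lambda>z. f z * z powi m)" if "f \<in> Linf circle" for f m
    by (intro circle.Linf_integrable Linf_mult that powi_Linf_circle)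
  have "fourier_coeff (\<lambda>w. component \<phi> k w - slice \<psi> k w) n = 0" for n
  proof -
    have "fourier_coeff (\<lambda>w. component \<phi> k w - slice \<psi> k w) n
        = fourier_coeff (component \<phi> k) n - fourier_coeff (slice \<psi> k) n"
      unfolding fourier_coeff_def using i[OF L(1)] i[OF L(2)] by (simp add: left_diff_distrib)
    then show ?thesis
      using component(2)[OF assms(1)] fourier_coeff_slice[OF assms(2)] assms(3) by simp
  qed
  then have "AE w in circle. component \<phi> k w - slice \<psi> k w = 0"
    by (rule fourier_coeff_eq_0_imp_AE[OF Linf_diff[OF L]])
  then show ?thesis
    by simp
qed

section \<open>Hankel matrices with symbol in $L^\infty$\<close>

lemma sum_norm2_nonneg_le:
  fixes x :: "nat \<Rightarrow> complex"
  shows "i < M \<Longrightarrow> (norm (x i))\<^sup>2 \<le> (\<Sum>i<M. (norm (x i))\<^sup>2)"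
  by (intro member_le_sum) auto

text \<open>The easy half of Nehari's theorem: if the polynomial \<open>X\<close> has coefficients
  \<open>x\<close>, row \<open>i\<close> of the matrix gives the Fourier coefficient of
  \<open>u * X\<close> at \<open>-(i + 1)\<close>. Bessel's inequality bounds all rows together by
  the L2 norm of \<open>u * X\<close>, which is at most \<open>D\<close> times that of
  \<open>X\<close>.\<close>

lemma hankel_bounded_fourier_coeff:
  assumes u: "u \<in> Linf circle" and D: "AE z in circle. norm (u z) \<le> D" "D \<ge> 0"
  shows "hankel_bounded (\<lambda>k. fourier_coeff u (- (int k + 1))) D"
  unfolding hankel_bounded_def
proof (intro allI)
  fix M N and x :: "nat \<Rightarrow> complex"
  define X where "X z = (\<Sum>j<N. x j * z powi int j)" for z
  have X: "X \<in> Linf circle"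
    unfolding X_def by (rule trig_sum_Linf)
  have uX: "(\<lambda>z. u z * X z) \<in> Linf circle"
    by (rule Linf_mult[OF u X])
  have i: "integrable circle (\<lambda>z. u z * z powi m)" for m
    by (intro circle.Linf_integrable Linf_mult u powi_Linf_circle)
  have "fourier_coeff (\<lambda>z. u z * X z) (- (int i + 1))
      = (\<Sum>j<N. fourier_coeff u (- (int (i + j) + 1)) * x j)" for i
  proof -
    have "fourier_coeff (\<lambda>z. u z * X z) (- (int i + 1))
       = (\<integral>z. (\<Sum>j<N. x j * (u z * z powi (int (i + j) + 1))) \<partial>circle)"
      unfolding fourier_coeff_def
    proof (intro Bochner_Integration.integral_cong refl)
      fix z :: complex assume "z \<in> space circle"
      then have "z \<noteq> 0" by auto
      then have "z powi int j * z powi (int i + 1) = z powi (int (i + j) + 1)" for j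
        by (subst power_int_add[symmetric]) (simp_all add: add_ac)
      then have "u z * (x j * z powi int j) * z powi (int i + 1) = x j * (u z * z powi (int (i + j) + 1))" for j
        by (metis mult.assoc mult.left_commute)
      then show "u z * X z * z powi (- (- (int i + 1))) = (\<Sum>j<N. x j * (u z * z powi (int (i + j) + 1)))"
        by (simp only: X_def sum_distrib_left sum_distrib_right minus_minus)
    qed
    also have "\<dots> = (\<Sum>j<N. fourier_coeff u (- (int (i + j) + 1)) * x j)"
      unfolding fourier_coeff_def minus_minus using i
      by (subst Bochner_Integration.integral_sum) (auto simp: mult.commute)
    finally show ?thesis .
  qed
  then have "(\<Sum>i<M. (norm (\<Sum>j<N. fourier_coeff u (- (int (i + j) + 1)) * x j))\<^sup>2)
      = (\<Sum>i<M. (norm (fourier_coeff (\<lambda>z. u z * X z) (- (int i + 1))))\<^sup>2)"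
    by simp
  also have "\<dots> \<le> (\<integral>z. (norm (u z * X z))\<^sup>2 \<partial>circle)"
    by (rule bessel_inequality[OF _ _ uX]) (auto simp: inj_on_def)
  also have "\<dots> \<le> (\<integral>z. D\<^sup>2 * (norm (X z))\<^sup>2 \<partial>circle)"
  proof (rule integral_mono_AE)
    show "AE z in circle. (norm (u z * X z))\<^sup>2 \<le> D\<^sup>2 * (norm (X z))\<^sup>2"
      using D(1) by eventually_elim (auto simp: norm_mult power_mult_distrib intro!: mult_right_mono power_mono)
  qed (use circle.Linf_integrable_norm2[OF uX] circle.Linf_integrable_norm2[OF X] in auto)
  also have "\<dots> = D\<^sup>2 * (\<Sum>j<N. (norm (x j))\<^sup>2)"
    unfolding X_def by (simp only: Bochner_Integration.integral_mult_right_zero, subst integral_norm2_trig_sum) auto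
  finally show "(\<Sum>i<M. (norm (\<Sum>j<N. fourier_coeff u (- (int (i + j) + 1)) * x j))\<^sup>2)
      \<le> D\<^sup>2 * (\<Sum>j<N. (norm (x j))\<^sup>2)" .
qed

lemma AE_Linf_shear_slice:
  assumes "f \<in> Linf torus"
  shows "AE w in circle. (\<lambda>z. f (z, w * z)) \<in> Linf circle"
proof -
  obtain C where C: "AE x in torus. norm (f x) \<le> C"
    using Linf_bound[OF assms] by metis
  have m: "(\<lambda>z. f (z, w * z)) \<in> borel_measurable circle" if "w \<in> space circle" for w
    using measurable_compose[OF measurable_Pair1'[OF that]
        measurable_compose[OF shear_measurable Linf_measurable[OF assms]]]
    by (simp add: shear_def)
  show ?thesis
    using AE_shear[OF C] AE_space by eventually_elim (use m in \<open>auto simp: Linf_def\<close>)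
qed

text \<open>The matrix involves only coefficients with \<open>m + n < 0\<close>, which \<phi> shares
  with \<psi>. Its entries form a countable family, so one null set serves for all of them.\<close>

lemma AE_hankel_bounded_component:
  assumes \<phi>: "\<phi> \<in> Linf torus" and \<psi>: "\<psi> \<in> Linf torus"
    and coeff: "\<And>m n. m + n < 0 \<Longrightarrow> fourier_coeff2 \<phi> m n = fourier_coeff2 \<psi> m n"
    and D: "AE x in torus. norm (\<psi> x) \<le> D" "D \<ge> 0"
  shows "AE w in circle. hankel_bounded (\<lambda>k. component \<phi> (- (int k + 1)) w) D"
proof -
  have "AE w in circle. component \<phi> (- (int k + 1)) w = slice \<psi> (- (int k + 1)) w" for k
    by (rule component_AE_slice[OF \<phi> \<psi>]) (rule coeff, simp)
  then have "AE w in circle. \<forall>k. component \<phi> (- (int k + 1)) w = slice \<psi> (- (int k + 1)) w"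
    by (intro iffD2[OF AE_all_countable] allI)
  with AE_shear[OF D(1)] AE_Linf_shear_slice[OF \<psi>] show ?thesis
  proof eventually_elim
    case (elim w)
    then show ?case
      using hankel_bounded_fourier_coeff[OF elim(2,1) D(2)] by (simp add: slice_eq_fourier_coeff)
  qed
qed

text \<open>The finite-section bound is applied to the part of \<open>x\<close> with indices from
  \<open>n\<close> to below \<open>m\<close>, and \<open>m\<close> tends to infinity. For
  \<open>n = 0\<close> this bounds the image of a square-summable vector; for growing
  \<open>n\<close> it makes the partial sums of the image converge.\<close>

lemma hankel_bounded_tail:
  assumes c: "hankel_bounded c D" and x: "summable (\<lambda>j. (norm (x j))\<^sup>2)"
  shows "summable (\<lambda>j. c (i + j) * x j)"
    and "(\<Sum>i<M. (norm ((\<Sum>j. c (i + j) * x j) - (\<Sum>j<n. c (i + j) * x j)))\<^sup>2)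
      \<le> D\<^sup>2 * ((\<Sum>j. (norm (x j))\<^sup>2) - (\<Sum>j<n. (norm (x j))\<^sup>2))"
proof -
  \<comment> \<open>By symmetry the first row equals the first column, the image of a unit vector.
    It is thus square-summable, and all other rows are its tails.\<close>
  have row: "(\<Sum>j<N. (norm (c j))\<^sup>2) \<le> D\<^sup>2" for N
    using c[unfolded hankel_bounded_def, rule_format, where M=N and N="Suc 0" and x="\<lambda>_. 1"] by simp
  have "summable (\<lambda>j. (norm (c j))\<^sup>2)"
    by (rule bounded_imp_summable[where B="D\<^sup>2"]) (use row[of "Suc _"] in \<open>auto simp: lessThan_Suc_atMost\<close>)
  then have "summable (\<lambda>j. (norm (c (i + j)))\<^sup>2)" for i
    by (subst add.commute, rule summable_ignore_initial_segment)
  then have "summable (\<lambda>j. (norm (c (i + j)))\<^sup>2 + (norm (x j))\<^sup>2)" for i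
    using x by (intro summable_add)
  then have s: "summable (\<lambda>j. c (i + j) * x j)" for i
  proof (rule summable_comparison_test'[where N=0])
    fix j
    show "norm (c (i + j) * x j) \<le> (norm (c (i + j)))\<^sup>2 + (norm (x j))\<^sup>2"
      using sum_squares_bound[of "norm (c (i + j))" "norm (x j)"]
        mult_nonneg_nonneg[OF norm_ge_zero[of "c (i + j)"] norm_ge_zero[of "x j"]]
      unfolding norm_mult by linarith
  qed
  then show "summable (\<lambda>j. c (i + j) * x j)" .
  have "(\<Sum>i<M. (norm ((\<Sum>j<m. c (i + j) * x j) - (\<Sum>j<n. c (i + j) * x j)))\<^sup>2)
      \<le> D\<^sup>2 * ((\<Sum>j<m. (norm (x j))\<^sup>2) - (\<Sum>j<n. (norm (x j))\<^sup>2))" if "m \<ge> n" for m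
  proof -
    define y where "y j = (if j < n then 0 else x j)" for j
    have split: "(\<Sum>j<m. f j) - (\<Sum>j<n. f j) = (\<Sum>j<m. if j < n then 0 else f j)"
      for f :: "nat \<Rightarrow> 'b::ab_group_add"
    proof -
      have "(\<Sum>j<m. f j) - (\<Sum>j<n. f j) = sum f ({..<m} - {..<n})"
        using that by (subst sum_diff) auto
      also have "\<dots> = (\<Sum>j<m. if j < n then 0 else f j)"
        by (rule sum.mono_neutral_cong_left) auto
      finally show ?thesis .
    qed
    have "c k * y j = (if j < n then 0 else c k * x j)" "(norm (y j))\<^sup>2 = (if j < n then 0 else (norm (x j))\<^sup>2)" for j k
      by (simp_all add: y_def)
    then show ?thesis
      using c[unfolded hankel_bounded_def, rule_format, where M=M and N=m and x=y]
      by (simp add: split)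
  qed
  then have ev: "eventually (\<lambda>m. (\<Sum>i<M. (norm ((\<Sum>j<m. c (i + j) * x j) - (\<Sum>j<n. c (i + j) * x j)))\<^sup>2)
      \<le> D\<^sup>2 * ((\<Sum>j<m. (norm (x j))\<^sup>2) - (\<Sum>j<n. (norm (x j))\<^sup>2))) sequentially"
    using eventually_ge_at_top[of n] by (rule eventually_mono[rotated]) 
  show "(\<Sum>i<M. (norm ((\<Sum>j. c (i + j) * x j) - (\<Sum>j<n. c (i + j) * x j)))\<^sup>2)
      \<le> D\<^sup>2 * ((\<Sum>j. (norm (x j))\<^sup>2) - (\<Sum>j<n. (norm (x j))\<^sup>2))"
    by (rule tendsto_le[OF sequentially_bot _ _ ev])
       (intro tendsto_intros summable_LIMSEQ s x)+
qed

section \<open>Block operators assembled from fibre matrices\<close>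

lemma L2_norm_power2: "(L2_norm M f)\<^sup>2 = (\<integral>x. (norm (f x))\<^sup>2 \<partial>M)"
  by (simp add: L2_norm_def)

lemma L2_norm_nonneg: "L2_norm M f \<ge> 0"
  by (simp add: L2_norm_def)

lemma L2_bound:
  assumes "f \<in> borel_measurable M" "integrable M g" "AE x in M. (norm (f x))\<^sup>2 \<le> g x"
  shows "f \<in> L2 M" and "(L2_norm M f)\<^sup>2 \<le> (\<integral>x. g x \<partial>M)"
proof -
  have "integrable M (\<lambda>x. (norm (f x))\<^sup>2)"
  proof (rule Bochner_Integration.integrable_bound[OF assms(2)])
    show "AE x in M. norm ((norm (f x))\<^sup>2) \<le> norm (g x)"
      using assms(3) by eventually_elim auto
  qed (use assms(1) in auto)
  then show "f \<in> L2 M" "(L2_norm M f)\<^sup>2 \<le> (\<integral>x. g x \<partial>M)"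
    using assms by (auto simp: L2_def L2_norm_power2 intro: integral_mono_AE)
qed

lemma L2_diff:
  assumes "f \<in> L2 M" "g \<in> L2 M"
  shows "(\<lambda>x. f x - g x) \<in> L2 M"
proof (rule L2_bound(1))
  have "(norm (a - b))\<^sup>2 \<le> 2 * (norm a)\<^sup>2 + 2 * (norm b)\<^sup>2" for a b :: complex
  proof -
    have "(norm (a - b))\<^sup>2 \<le> (norm a + norm b)\<^sup>2"
      by (intro power_mono norm_triangle_ineq4) simp
    then show ?thesis
      using sum_squares_bound[of "norm a" "norm b"] by (simp add: power2_sum)
  qed
  then show "AE x in M. (norm (f x - g x))\<^sup>2 \<le> 2 * (norm (f x))\<^sup>2 + 2 * (norm (g x))\<^sup>2"
    by simp
qed (use assms in \<open>auto simp: L2_def\<close>)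

text \<open>Tonelli's theorem for the series of squares: an element of \<open>l2_L2 M\<close> can be
  read as a square-integrable family of square-summable sequences, which gives access to single
  fibres.\<close>

lemma l2_L2_sum_norm2:
  assumes F: "F \<in> l2_L2 M"
  shows "AE x in M. summable (\<lambda>j. (norm (F j x))\<^sup>2)"
    and "integrable M (\<lambda>x. \<Sum>j. (norm (F j x))\<^sup>2)"
    and "(\<integral>x. (\<Sum>j. (norm (F j x))\<^sup>2) \<partial>M) = (\<Sum>j. (L2_norm M (F j))\<^sup>2)"
proof -
  have m: "F j \<in> borel_measurable M" and i: "integrable M (\<lambda>x. (norm (F j x))\<^sup>2)" for j
    using F by (auto simp: l2_L2_def L2_def)
  have s: "summable (\<lambda>j. \<integral>x. (norm (F j x))\<^sup>2 \<partial>M)"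
    using F by (auto simp: l2_L2_def L2_norm_power2)
  have "(\<integral>\<^sup>+x. (\<Sum>j. ennreal ((norm (F j x))\<^sup>2)) \<partial>M) = (\<Sum>j. \<integral>\<^sup>+x. ennreal ((norm (F j x))\<^sup>2) \<partial>M)"
    using m by (intro nn_integral_suminf) simp
  also have "\<dots> = (\<Sum>j. ennreal (\<integral>x. (norm (F j x))\<^sup>2 \<partial>M))"
    using i by (simp add: nn_integral_eq_integral)
  also have "\<dots> = ennreal (\<Sum>j. \<integral>x. (norm (F j x))\<^sup>2 \<partial>M)"
    using s by (intro suminf_ennreal2) auto
  finally have "AE x in M. (\<Sum>j. ennreal ((norm (F j x))\<^sup>2)) \<noteq> \<infinity>"
    using m by (intro nn_integral_noteq_infinite) auto
  then show a: "AE x in M. summable (\<lambda>j. (norm (F j x))\<^sup>2)"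
    by eventually_elim (rule summable_suminf_not_top, auto)
  have a': "AE x in M. summable (\<lambda>j. norm ((norm (F j x))\<^sup>2))"
    and s': "summable (\<lambda>j. \<integral>x. norm ((norm (F j x))\<^sup>2) \<partial>M)"
    using a s by simp_all
  show "integrable M (\<lambda>x. \<Sum>j. (norm (F j x))\<^sup>2)"
    by (rule integrable_suminf[OF i a' s'])
  show "(\<integral>x. (\<Sum>j. (norm (F j x))\<^sup>2) \<partial>M) = (\<Sum>j. (L2_norm M (F j))\<^sup>2)"
    using integral_suminf[OF i a' s'] by (simp add: L2_norm_power2)
qed

text \<open>The image is computed in each fibre by the scalar matrix. Integrating the fibrewise tail
  estimate gives convergence of each row in L2, and its case \<open>n = 0\<close> gives the norm
  bound.\<close>

lemma hankel_block_image:
  assumes c: "\<And>k. c k \<in> borel_measurable M"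
    and hb: "AE w in M. hankel_bounded (\<lambda>k. c k w) D" and D: "D \<ge> 0"
    and F: "F \<in> l2_L2 M"
  shows "\<exists>G\<in>l2_L2 M. block_image M (\<lambda>i j. mult_op (c (i + j))) F G \<and> l2_L2_norm M G \<le> D * l2_L2_norm M F"
proof -
  have Fm: "F j \<in> borel_measurable M" and Fi: "integrable M (\<lambda>x. (norm (F j x))\<^sup>2)" for j
    using F by (auto simp: l2_L2_def L2_def)
  define S where "S x = (\<Sum>j. (norm (F j x))\<^sup>2)" for x
  define s where "s = (\<Sum>j. (L2_norm M (F j))\<^sup>2)"
  have Si: "integrable M S" and Sint: "(\<integral>x. S x \<partial>M) = s"
    using l2_L2_sum_norm2[OF F] by (simp_all add: S_def[abs_def] s_def)
  define G where "G i x = (\<Sum>j. c (i + j) x * F j x)" for i x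
  have Gm: "G i \<in> borel_measurable M" for i
    unfolding G_def using c Fm by (intro borel_measurable_suminf borel_measurable_times)
  have tail: "AE x in M. (\<Sum>i<N. (norm (G i x - (\<Sum>j<n. c (i + j) x * F j x)))\<^sup>2)
      \<le> D\<^sup>2 * (S x - (\<Sum>j<n. (norm (F j x))\<^sup>2))" for N n
    using hb l2_L2_sum_norm2(1)[OF F]
    by eventually_elim (unfold G_def S_def, rule hankel_bounded_tail(2))
  have Rm: "(\<lambda>x. G i x - (\<Sum>j<n. c (i + j) x * F j x)) \<in> borel_measurable M" for i n
    using Gm c Fm by (intro borel_measurable_diff borel_measurable_sum borel_measurable_times)
  have Ti: "integrable M (\<lambda>x. D\<^sup>2 * (S x - (\<Sum>j<n. (norm (F j x))\<^sup>2)))" for n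
    using Si Fi by simp
  have Tint: "(\<integral>x. D\<^sup>2 * (S x - (\<Sum>j<n. (norm (F j x))\<^sup>2)) \<partial>M) = D\<^sup>2 * (s - (\<Sum>j<n. (L2_norm M (F j))\<^sup>2))" for n
    using Si Fi Sint by (simp add: L2_norm_power2)
  have tail1: "AE x in M. (norm (G i x - (\<Sum>j<n. c (i + j) x * F j x)))\<^sup>2
      \<le> D\<^sup>2 * (S x - (\<Sum>j<n. (norm (F j x))\<^sup>2))" for i n
    using tail[where N="Suc i" and n=n]
  proof eventually_elim
    case (elim x)
    show ?case
      by (rule order_trans[OF sum_norm2_nonneg_le[OF lessI] elim])
  qed
  have GL2: "G i \<in> L2 M" for i
    using L2_bound(1)[OF Rm Ti tail1, of i 0] by simp
  have lim: "(\<lambda>n. L2_norm M (\<lambda>x. G i x - (\<Sum>j<n. c (i + j) x * F j x))) \<longlonglongrightarrow> 0" for i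
  proof -
    have "(\<lambda>n. \<Sum>j<n. (L2_norm M (F j))\<^sup>2) \<longlonglongrightarrow> s"
      unfolding s_def using F by (intro summable_LIMSEQ) (simp add: l2_L2_def)
    then have "(\<lambda>n. D\<^sup>2 * (s - (\<Sum>j<n. (L2_norm M (F j))\<^sup>2))) \<longlonglongrightarrow> D\<^sup>2 * (s - s)"
      by (intro tendsto_intros)
    then have upper: "(\<lambda>n. D\<^sup>2 * (s - (\<Sum>j<n. (L2_norm M (F j))\<^sup>2))) \<longlonglongrightarrow> 0"
      by simp
    have "(\<lambda>n. (L2_norm M (\<lambda>x. G i x - (\<Sum>j<n. c (i + j) x * F j x)))\<^sup>2) \<longlonglongrightarrow> 0"
    proof (rule tendsto_sandwich[OF _ _ tendsto_const upper])
      show "eventually (\<lambda>n. (L2_norm M (\<lambda>x. G i x - (\<Sum>j<n. c (i + j) x * F j x)))\<^sup>2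
          \<le> D\<^sup>2 * (s - (\<Sum>j<n. (L2_norm M (F j))\<^sup>2))) sequentially"
        using L2_bound(2)[OF Rm Ti tail1] unfolding Tint by (rule always_eventually[OF allI])
    qed simp
    then have "(\<lambda>n. sqrt ((L2_norm M (\<lambda>x. G i x - (\<Sum>j<n. c (i + j) x * F j x)))\<^sup>2)) \<longlonglongrightarrow> sqrt 0"
      by (rule tendsto_real_sqrt)
    then show ?thesis
      by (simp add: L2_norm_nonneg)
  qed
  have part: "(\<Sum>i<N. (L2_norm M (G i))\<^sup>2) \<le> D\<^sup>2 * s" for N
  proof -
    have Gi: "integrable M (\<lambda>x. (norm (G i x))\<^sup>2)" for i
      using GL2 by (simp add: L2_def)
    then have "(\<Sum>i<N. (L2_norm M (G i))\<^sup>2) = (\<integral>x. (\<Sum>i<N. (norm (G i x))\<^sup>2) \<partial>M)"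
      by (simp add: L2_norm_power2)
    also have "\<dots> \<le> (\<integral>x. D\<^sup>2 * S x \<partial>M)"
    proof (rule integral_mono_AE)
      show "AE x in M. (\<Sum>i<N. (norm (G i x))\<^sup>2) \<le> D\<^sup>2 * S x"
        using tail[where N=N and n=0] by simp
    qed (use Gi Si in simp_all)
    finally show ?thesis
      by (simp add: Sint)
  qed
  have sG: "summable (\<lambda>i. (L2_norm M (G i))\<^sup>2)"
  proof (rule bounded_imp_summable)
    show "(\<Sum>i\<le>n. (L2_norm M (G i))\<^sup>2) \<le> D\<^sup>2 * s" for n
      using part[of "Suc n"] by (simp add: lessThan_Suc_atMost)
  qed simp
  have cF: "mult_op (c (i + j)) (F j) \<in> L2 M" for i j
    unfolding mult_op_def
  proof (rule L2_bound(1))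
    show "AE x in M. (norm (c (i + j) x * F j x))\<^sup>2 \<le> D\<^sup>2 * (norm (F j x))\<^sup>2"
      using hb
    proof eventually_elim
      case (elim x)
      then show ?case
        using hankel_bounded_norm_le[OF elim D, of "i + j"]
        by (auto simp: norm_mult power_mult_distrib intro!: mult_right_mono power_mono)
    qed
  qed (use c Fm Fi in auto)
  have "l2_L2_norm M G \<le> sqrt (D\<^sup>2 * s)"
    unfolding l2_L2_norm_def using part by (intro real_sqrt_le_mono suminf_le_const[OF sG])
  also have "\<dots> = D * l2_L2_norm M F"
    using D by (simp add: real_sqrt_mult s_def l2_L2_norm_def)
  finally have nG: "l2_L2_norm M G \<le> D * l2_L2_norm M F" .
  have "G \<in> l2_L2 M"
    using GL2 sG by (simp add: l2_L2_def)
  moreover have "block_image M (\<lambda>i j. mult_op (c (i + j))) F G"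
    unfolding block_image_def using cF GL2 lim by (simp add: mult_op_def)
  ultimately show ?thesis
    using nG by blast
qed

section \<open>From the block operator back to almost every fibre\<close>

lemma hankel_bounded_sequential_closure:
  fixes x :: "nat \<Rightarrow> complex"
  assumes y: "\<And>n. (\<Sum>i<M. (norm (\<Sum>j<N. c (i + j) * y n j))\<^sup>2) \<le> K * (\<Sum>j<N. (norm (y n j))\<^sup>2)"
    and lim: "\<And>j. j < N \<Longrightarrow> (\<lambda>n. y n j) \<longlonglongrightarrow> x j"
  shows "(\<Sum>i<M. (norm (\<Sum>j<N. c (i + j) * x j))\<^sup>2) \<le> K * (\<Sum>j<N. (norm (x j))\<^sup>2)"
proof (rule LIMSEQ_le)
  show "(\<lambda>n. \<Sum>i<M. (norm (\<Sum>j<N. c (i + j) * y n j))\<^sup>2) \<longlonglongrightarrow> (\<Sum>i<M. (norm (\<Sum>j<N. c (i + j) * x j))\<^sup>2)"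
    by (intro tendsto_sum tendsto_power tendsto_norm tendsto_mult tendsto_const lim) simp
  show "(\<lambda>n. K * (\<Sum>j<N. (norm (y n j))\<^sup>2)) \<longlonglongrightarrow> K * (\<Sum>j<N. (norm (x j))\<^sup>2)"
    by (intro tendsto_sum tendsto_power tendsto_norm tendsto_mult tendsto_const lim) simp
qed (use y in blast)

text \<open>The vectors \<open>x\<close> are uncountably many, so their null sets cannot simply be
  united. Vectors with entries in a countable dense set are coded by \<open>nat list\<close>, a
  countable type; for a fixed section the inequality is closed in \<open>x\<close> and extends to
  all vectors.\<close>

lemma AE_hankel_boundedI:
  assumes "\<And>M N x. AE w in P. (\<Sum>i<M. (norm (\<Sum>j<N. c (i + j) w * x j))\<^sup>2) \<le> C\<^sup>2 * (\<Sum>j<N. (norm (x j))\<^sup>2)"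
  shows "AE w in P. hankel_bounded (\<lambda>k. c k w) C"
proof -
  obtain D :: "complex set" where D: "countable D" "\<And>X. open X \<Longrightarrow> X \<noteq> {} \<Longrightarrow> \<exists>d\<in>D. d \<in> X"
    using countable_dense_setE by blast
  define d where "d = from_nat_into D"
  have "D \<noteq> {}"
    using D(2)[of UNIV] by auto
  then have dD: "range d = D"
    unfolding d_def using D(1) by (rule range_from_nat_into)
  have dense: "\<exists>k. dist (d k) z < e" if "e > 0" for z e
    using D(2)[of "ball z e"] that dD by (force simp: dist_commute)
  have "AE w in P. \<forall>M N. \<forall>l :: nat list.
     (\<Sum>i<M. (norm (\<Sum>j<N. c (i + j) w * d (l ! j)))\<^sup>2) \<le> C\<^sup>2 * (\<Sum>j<N. (norm (d (l ! j)))\<^sup>2)"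
    unfolding AE_all_countable by (intro allI assms)
  then show ?thesis
  proof eventually_elim
    case (elim w)
    show ?case
      unfolding hankel_bounded_def
    proof (intro allI)
      fix M N and x :: "nat \<Rightarrow> complex"
      define f where "f n j = (SOME k. dist (d k) (x j) < inverse (real (Suc n)))" for n j
      have f: "dist (d (f n j)) (x j) < inverse (real (Suc n))" for n j
        unfolding f_def by (rule someI_ex[OF dense]) simp
      define l where "l n = map (f n) [0..<N]" for n
      have l: "d (l n ! j) = d (f n j)" if "j < N" for n j
        using that by (simp add: l_def)
      show "(\<Sum>i<M. (norm (\<Sum>j<N. c (i + j) w * x j))\<^sup>2) \<le> C\<^sup>2 * (\<Sum>j<N. (norm (x j))\<^sup>2)"
      proof (rule hankel_bounded_sequential_closure[where y="\<lambda>n j. d (l n ! j)"])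
        fix j assume "j < N"
        have "(\<lambda>n. dist (d (f n j)) (x j)) \<longlonglongrightarrow> 0"
          using f by (intro tendsto_sandwich[OF _ _ tendsto_const LIMSEQ_inverse_real_of_nat])
            (auto intro!: always_eventually less_imp_le)
        then show "(\<lambda>n. d (l n ! j)) \<longlonglongrightarrow> x j"
          unfolding l[OF \<open>j < N\<close>] tendsto_dist_iff[of _ "x j"] .
      qed (use elim in blast)
    qed
  qed
qed

lemma L2_norm_diff_eq_0:
  assumes "f \<in> L2 M" "g \<in> L2 M" "L2_norm M (\<lambda>x. f x - g x) = 0"
  shows "L2_norm M f = L2_norm M g"
proof -
  have "integrable M (\<lambda>x. (norm (f x - g x))\<^sup>2)"
    using L2_diff[OF assms(1,2)] by (simp add: L2_def)
  moreover have "(\<integral>x. (norm (f x - g x))\<^sup>2 \<partial>M) = 0"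
    using assms(3) by (simp add: L2_norm_def)
  ultimately have "AE x in M. f x = g x"
    by (simp add: integral_nonneg_eq_0_iff_AE)
  then have "(\<integral>x. (norm (f x))\<^sup>2 \<partial>M) = (\<integral>x. (norm (g x))\<^sup>2 \<partial>M)"
    using assms(1,2) by (intro integral_cong_AE) (auto simp: L2_def elim: eventually_mono)
  then show ?thesis
    by (simp add: L2_norm_def)
qed

lemma (in finite_measure) Linf_imp_L2: "f \<in> Linf M \<Longrightarrow> f \<in> L2 M"
  using Linf_integrable_norm2 by (simp add: L2_def Linf_def)

text \<open>Testing the operator on the vectors \<open>x j * indicator A w\<close> bounds the
  integral of the fibre quantity \<open>f\<close> over \<open>A\<close> by
  \<open>C\<^sup>2 * X * measure M A\<close>. As \<open>A\<close> is arbitrary, the averages of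
  \<open>f\<close>, and hence almost all its values, stay below
  \<open>C\<^sup>2 * X\<close>.\<close>

lemma (in finite_measure) AE_hankel_bounded_of_block_image:
  assumes c: "\<And>k. c k \<in> Linf M"
    and H: "\<And>F. F \<in> l2_L2 M \<Longrightarrow> \<exists>G\<in>l2_L2 M. block_image M (\<lambda>i j. mult_op (c (i + j))) F G \<and>
        l2_L2_norm M G \<le> C * l2_L2_norm M F"
  shows "AE w in M. hankel_bounded (\<lambda>k. c k w) C"
proof (rule AE_hankel_boundedI)
  fix m N :: nat and x :: "nat \<Rightarrow> complex"
  define f where "f w = (\<Sum>i<m. (norm (\<Sum>j<N. c (i + j) w * x j))\<^sup>2)" for w
  define X where "X = (\<Sum>j<N. (norm (x j))\<^sup>2)"
  have hL: "(\<lambda>w. \<Sum>j<N. c (i + j) w * x j) \<in> Linf M" for i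
    by (intro Linf_sum Linf_mult Linf_const c)
  have fi: "integrable M f"
    unfolding f_def by (intro Bochner_Integration.integrable_sum Linf_integrable_norm2 hL)
  have "AE w in M. f w \<in> {..C\<^sup>2 * X}"
  proof (rule averaging_theorem[OF fi])
    fix A assume A: "A \<in> sets M" and pos: "measure M A > 0"
    have ind: "(\<lambda>w. indicator A w :: complex) \<in> Linf M"
      using A by (intro LinfI[where C=1]) (auto split: split_indicator)
    define F where "F j w = (if j < N then x j * indicator A w else 0)" for j w
    have F_Linf: "F j \<in> Linf M" for j
      unfolding F_def using Linf_mult[OF Linf_const ind] by (cases "j < N") (simp_all add: Linf_const)
    have F_norm: "(L2_norm M (F j))\<^sup>2 = (if j < N then (norm (x j))\<^sup>2 * measure M A else 0)" for j
    proof -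
      have "(norm (F j w))\<^sup>2 = (if j < N then (norm (x j))\<^sup>2 else 0) * indicator A w" for w
        by (auto simp: F_def norm_mult power_mult_distrib split: split_indicator)
      then show ?thesis
        using A by (simp add: L2_norm_power2)
    qed
    have F_sums: "(\<lambda>j. (L2_norm M (F j))\<^sup>2) sums (\<Sum>j<N. (L2_norm M (F j))\<^sup>2)"
      by (rule sums_finite) (auto simp: F_norm)
    then have F_l2: "F \<in> l2_L2 M"
      using Linf_imp_L2[OF F_Linf] by (auto simp: l2_L2_def sums_iff)
    have F_l2norm: "(l2_L2_norm M F)\<^sup>2 = X * measure M A"
    proof -
      have "(\<Sum>j. (L2_norm M (F j))\<^sup>2) = X * measure M A"
        using F_sums by (simp add: sums_iff F_norm X_def sum_distrib_right)
      then show ?thesis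
        by (simp add: l2_L2_norm_def X_def sum_nonneg)
    qed
    obtain G where G: "G \<in> l2_L2 M" "block_image M (\<lambda>i j. mult_op (c (i + j))) F G"
      "l2_L2_norm M G \<le> C * l2_L2_norm M F"
      using H[OF F_l2] by blast
    define h where "h i w = (\<Sum>j<N. c (i + j) w * F j w)" for i w
    have h_Linf: "h i \<in> Linf M" for i
      unfolding h_def by (intro Linf_sum Linf_mult c F_Linf)
    \<comment> \<open>Only finitely many \<open>F j\<close> are nonzero, so the partial sums are
      constant from \<open>N\<close> on, and the limit in \<open>block_image\<close> determines
      \<open>G i\<close> up to null sets.\<close>
    have Gh: "L2_norm M (G i) = L2_norm M (h i)" for i
    proof (rule L2_norm_diff_eq_0)
      show "G i \<in> L2 M"
        using G(1) by (simp add: l2_L2_def)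
      show "h i \<in> L2 M"
        by (rule Linf_imp_L2[OF h_Linf])
      have "(\<lambda>n. L2_norm M (\<lambda>w. G i w - (\<Sum>j<n. c (i + j) w * F j w))) \<longlonglongrightarrow> 0"
        using G(2) by (simp add: block_image_def mult_op_def)
      moreover have "eventually (\<lambda>n. L2_norm M (\<lambda>w. G i w - (\<Sum>j<n. c (i + j) w * F j w))
          = L2_norm M (\<lambda>w. G i w - h i w)) sequentially"
        using eventually_ge_at_top[of N]
      proof eventually_elim
        case (elim n)
        have "(\<Sum>j<n. c (i + j) w * F j w) = h i w" for w
          unfolding h_def using elim by (intro sum.mono_neutral_right) (auto simp: F_def)
        then show ?case by simp
      qed
      ultimately have "(\<lambda>n. L2_norm M (\<lambda>w. G i w - h i w)) \<longlonglongrightarrow> 0"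
        by (rule Lim_transform_eventually)
      then show "L2_norm M (\<lambda>w. G i w - h i w) = 0"
        by (simp add: LIMSEQ_const_iff)
    qed
    have hA: "(norm (h i w))\<^sup>2 = indicator A w *\<^sub>R (norm (\<Sum>j<N. c (i + j) w * x j))\<^sup>2" for i w
    proof -
      have "h i w = (\<Sum>j<N. c (i + j) w * x j) * indicator A w"
        by (simp add: h_def F_def sum_distrib_right mult.assoc)
      then show ?thesis
        by (simp split: split_indicator)
    qed
    have "(\<integral>w\<in>A. f w \<partial>M) = (\<integral>w. (\<Sum>i<m. (norm (h i w))\<^sup>2) \<partial>M)"
      by (simp add: set_lebesgue_integral_def f_def hA sum_distrib_left)
    also have "\<dots> = (\<Sum>i<m. (L2_norm M (h i))\<^sup>2)"
      using Linf_integrable_norm2[OF h_Linf] by (simp add: L2_norm_power2)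
    also have "\<dots> = (\<Sum>i<m. (L2_norm M (G i))\<^sup>2)"
      by (simp add: Gh)
    also have "\<dots> \<le> (\<Sum>i. (L2_norm M (G i))\<^sup>2)"
      using G(1) by (intro sum_le_suminf) (auto simp: l2_L2_def)
    also have "\<dots> = (l2_L2_norm M G)\<^sup>2"
      using G(1) by (simp add: l2_L2_norm_def l2_L2_def suminf_nonneg)
    also have "\<dots> \<le> (C * l2_L2_norm M F)\<^sup>2"
      using G by (intro power_mono) (auto simp: l2_L2_norm_def l2_L2_def suminf_nonneg)
    also have "\<dots> = C\<^sup>2 * X * measure M A"
      by (simp add: power_mult_distrib F_l2norm)
    finally show "(1 / measure M A) *\<^sub>R (\<integral>w\<in>A. f w \<partial>M) \<in> {..C\<^sup>2 * X}"
      using pos by (simp add: field_simps)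
  qed simp
  then show "AE w in M. (\<Sum>i<m. (norm (\<Sum>j<N. c (i + j) w * x j))\<^sup>2) \<le> C\<^sup>2 * (\<Sum>j<N. (norm (x j))\<^sup>2)"
    by (simp add: f_def X_def)
qed

section \<open>Approximation from $H_1$\<close>

lemma Linf_mult_integrable:
  assumes "f \<in> Linf M" "integrable M g"
  shows "integrable M (\<lambda>x. f x * g x)"
proof -
  obtain C where C: "C \<ge> 0" "AE x in M. norm (f x) \<le> C"
    using Linf_bound[OF assms(1)] .
  show ?thesis
  proof (rule Bochner_Integration.integrable_bound[of M "\<lambda>x. of_real C * g x"])
    show "AE x in M. norm (f x * g x) \<le> norm (of_real C * g x)"
      using C(2) by eventually_elim (use C(1) in \<open>auto simp: norm_mult intro!: mult_right_mono\<close>)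
  qed (use assms in \<open>auto simp: Linf_def\<close>)
qed

text \<open>Trigonometric polynomials in \<open>z\<close> with strictly positive frequencies and coefficients in
  $L^\infty$ of the other sheared coordinate: a subspace of $L^1$ whose annihilator in $L^\infty$
  is contained in \<^term>\<open>H1\<close>.\<close>

definition H1_test :: "(complex \<times> complex \<Rightarrow> complex) set" where
  "H1_test = {f. integrable torus f \<and> (\<exists>N a. (\<forall>k. a k \<in> Linf circle) \<and> (\<forall>k\<ge>N. a k = (\<lambda>_. 0)) \<and>
     (\<forall>w z. norm w = 1 \<longrightarrow> norm z = 1 \<longrightarrow> f (z, w * z) = (\<Sum>k<N. a k w * z ^ Suc k)))}"

lemma H1_test_zero: "(\<lambda>_. 0) \<in> H1_test"
  unfolding H1_test_def by (auto intro!: exI[of _ 0] exI[of _ "\<lambda>_ _. 0"] Linf_const)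

lemma H1_test_scale:
  assumes "f \<in> H1_test"
  shows "(\<lambda>x. c * f x) \<in> H1_test"
proof -
  obtain N a where f: "integrable torus f" "\<And>k. a k \<in> Linf circle" "\<And>k. k \<ge> N \<Longrightarrow> a k = (\<lambda>_. 0)"
    "\<And>w z. norm w = 1 \<Longrightarrow> norm z = 1 \<Longrightarrow> f (z, w * z) = (\<Sum>k<N. a k w * z ^ Suc k)"
    using assms unfolding H1_test_def by blast
  have "\<exists>N b. (\<forall>k. b k \<in> Linf circle) \<and> (\<forall>k\<ge>N. b k = (\<lambda>_. 0)) \<and>
     (\<forall>w z. norm w = 1 \<longrightarrow> norm z = 1 \<longrightarrow> c * f (z, w * z) = (\<Sum>k<N. b k w * z ^ Suc k))"
    using f by (intro exI[of _ N] exI[of _ "\<lambda>k w. c * a k w"])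
      (auto intro!: Linf_mult Linf_const simp: sum_distrib_left mult.assoc)
  then show ?thesis
    using f(1) by (simp add: H1_test_def)
qed

lemma H1_test_add:
  assumes "f \<in> H1_test" "g \<in> H1_test"
  shows "(\<lambda>x. f x + g x) \<in> H1_test"
proof -
  obtain N a where f: "integrable torus f" "\<And>k. a k \<in> Linf circle" "\<And>k. k \<ge> N \<Longrightarrow> a k = (\<lambda>_. 0)"
    "\<And>w z. norm w = 1 \<Longrightarrow> norm z = 1 \<Longrightarrow> f (z, w * z) = (\<Sum>k<N. a k w * z ^ Suc k)"
    using assms(1) unfolding H1_test_def by blast
  obtain K b where g: "integrable torus g" "\<And>k. b k \<in> Linf circle" "\<And>k. k \<ge> K \<Longrightarrow> b k = (\<lambda>_. 0)"
    "\<And>w z. norm w = 1 \<Longrightarrow> norm z = 1 \<Longrightarrow> g (z, w * z) = (\<Sum>k<K. b k w * z ^ Suc k)"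
    using assms(2) unfolding H1_test_def by blast
  define R where "R = max N K"
  have "(\<Sum>k<N. a k w * z ^ Suc k) = (\<Sum>k<R. a k w * z ^ Suc k)"
    "(\<Sum>k<K. b k w * z ^ Suc k) = (\<Sum>k<R. b k w * z ^ Suc k)" for w z
    by (rule sum.mono_neutral_left; simp add: R_def f(3) g(3) not_less)+
  then have "\<exists>R c. (\<forall>k. c k \<in> Linf circle) \<and> (\<forall>k\<ge>R. c k = (\<lambda>_. 0)) \<and>
     (\<forall>w z. norm w = 1 \<longrightarrow> norm z = 1 \<longrightarrow> f (z, w * z) + g (z, w * z) = (\<Sum>k<R. c k w * z ^ Suc k))"
    using f g by (intro exI[of _ R] exI[of _ "\<lambda>k w. a k w + b k w"])
      (auto intro!: Linf_add simp: distrib_right sum.distrib R_def)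
  then show ?thesis
    using f(1) g(1) by (simp add: H1_test_def)
qed

text \<open>These are the functions against which \<open>fourier_coeff2\<close> integrates. In shear
  coordinates the exponent of \<open>z\<close> is \<open>-(m + n)\<close>, positive exactly for the
  coefficients that must vanish in \<open>H1\<close>.\<close>

lemma H1_test_monomial:
  assumes "m + n < 0"
  shows "(\<lambda>x. fst x powi (- m) * snd x powi (- n)) \<in> H1_test"
proof -
  \<comment> \<open>Frequencies are written as \<open>Suc k\<close>, so the single nonzero
    coefficient sits at \<open>-(m + n) - 1\<close>.\<close>
  define K where "K = nat (- (m + n)) - 1"
  have K: "int (Suc K) = - (m + n)"
    using assms by (simp add: K_def)
  define a where "a k w = (if k = K then w powi (- n) else 0 :: complex)" for k w
  have "a k \<in> Linf circle" for k
    unfolding a_def by (cases "k = K") (auto intro: powi_Linf_circle Linf_const)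
  moreover have "a k = (\<lambda>_. 0)" if "k \<ge> Suc K" for k
    using that by (auto simp: a_def)
  moreover have "z powi (- m) * (w * z) powi (- n) = (\<Sum>k<Suc K. a k w * z ^ Suc k)"
    if "norm w = 1" "norm z = 1" for w z
  proof -
    have "z \<noteq> 0"
      using that by auto
    then have "z powi (- m) * z powi (- n) = z powi int (Suc K)"
      unfolding K by (subst power_int_add[symmetric]) auto
    then have "z powi (- m) * z powi (- n) = z ^ Suc K"
      by (simp only: power_int_of_nat)
    moreover have "(\<Sum>k<Suc K. a k w * z ^ Suc k) = w powi (- n) * z ^ Suc K"
      by (simp add: a_def)
    ultimately show ?thesis
      by (simp only: power_int_mult_distrib mult.left_commute[of "z powi (- m)"])
  qed
  moreover have "integrable torus (\<lambda>x. fst x powi (- m) * snd x powi (- n))"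
    by (intro torus.Linf_integrable Linf_mult powi_Linf_torus)
  ultimately show ?thesis
    unfolding H1_test_def by (intro CollectI conjI exI[of _ "Suc K"] exI[of _ a]) auto
qed

text \<open>On the fibre of \<open>w\<close> the pairing picks from \<phi> the coefficients of index
  \<open>-(k + 1)\<close>, so it is the Hankel functional at the numbers \<open>a k w\<close>.
  Removing the unimodular factor \<open>z\<close> keeps the norm and lets the frequencies start at
  0, as in the scalar estimate.\<close>

lemma H1_test_functional_bound:
  assumes \<phi>: "\<phi> \<in> Linf torus" and C: "C \<ge> 0"
    and hb: "AE w in circle. hankel_bounded (\<lambda>k. component \<phi> (- (int k + 1)) w) C"
    and f: "f \<in> H1_test"
  shows "norm (\<integral>x. \<phi> x * f x \<partial>torus) \<le> C * (\<integral>x. norm (f x) \<partial>torus)"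
proof -
  obtain N a where fi: "integrable torus f" and a: "\<And>k. a k \<in> Linf circle"
    and fa: "\<And>w z. norm w = 1 \<Longrightarrow> norm z = 1 \<Longrightarrow> f (z, w * z) = (\<Sum>k<N. a k w * z ^ Suc k)"
    using f unfolding H1_test_def by blast
  have \<phi>f: "integrable torus (\<lambda>x. \<phi> x * f x)"
    by (rule Linf_mult_integrable[OF \<phi> fi])
  have nf: "integrable torus (\<lambda>x. norm (f x))"
    using fi by simp
  have "AE w in circle. component \<phi> (- (int k + 1)) w = slice \<phi> (- (int k + 1)) w" for k
    by (rule component_AE_slice[OF \<phi> \<phi> refl])
  then have "AE w in circle. \<forall>k. component \<phi> (- (int k + 1)) w = slice \<phi> (- (int k + 1)) w"
    by (intro iffD2[OF AE_all_countable] allI)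
  with hb AE_Linf_shear_slice[OF \<phi>] AE_space
  have fiber: "AE w in circle. norm (\<integral>z. \<phi> (z, w * z) * f (z, w * z) \<partial>circle)
      \<le> C * (\<integral>z. norm (f (z, w * z)) \<partial>circle)"
  proof eventually_elim
    case (elim w)
    have w: "norm w = 1"
      using elim(3) by simp
    have i: "integrable circle (\<lambda>z. \<phi> (z, w * z) * z powi m)" for m
      by (intro circle.Linf_integrable Linf_mult elim(2) powi_Linf_circle)
    have "(\<integral>z. \<phi> (z, w * z) * f (z, w * z) \<partial>circle)
        = (\<integral>z. (\<Sum>k<N. a k w * (\<phi> (z, w * z) * z powi (int k + 1))) \<partial>circle)"
    proof (intro Bochner_Integration.integral_cong refl)
      fix z :: complex assume "z \<in> space circle"
      then have z: "norm z = 1"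
        by simp
      have "z powi (int k + 1) = z ^ Suc k" for k
        by (simp only: power_int_of_nat flip: of_nat_Suc[where ?'a=int] add.commute[of 1])
      then show "\<phi> (z, w * z) * f (z, w * z) = (\<Sum>k<N. a k w * (\<phi> (z, w * z) * z powi (int k + 1)))"
        unfolding fa[OF w z] by (simp only: sum_distrib_left mult.left_commute)
    qed
    also have "\<dots> = (\<Sum>k<N. a k w * slice \<phi> (- (int k + 1)) w)"
      unfolding slice_def minus_minus using i by simp
    also have "\<dots> = (\<Sum>k<N. component \<phi> (- (int k + 1)) w * a k w)"
      using elim(4) by (simp add: mult.commute)
    finally have "norm (\<integral>z. \<phi> (z, w * z) * f (z, w * z) \<partial>circle)
        \<le> C * (\<integral>z. norm (\<Sum>k<N. a k w * z ^ k) \<partial>circle)"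
      using nehari_scalar[OF elim(1) C] by simp
    also have "(\<integral>z. norm (\<Sum>k<N. a k w * z ^ k) \<partial>circle) = (\<integral>z. norm (f (z, w * z)) \<partial>circle)"
    proof (intro Bochner_Integration.integral_cong refl)
      fix z :: complex assume "z \<in> space circle"
      then have z: "norm z = 1"
        by simp
      have "f (z, w * z) = z * (\<Sum>k<N. a k w * z ^ k)"
        unfolding fa[OF w z] by (simp add: sum_distrib_left mult_ac)
      then show "norm (\<Sum>k<N. a k w * z ^ k) = norm (f (z, w * z))"
        using z by (simp add: norm_mult)
    qed
    finally show ?case .
  qed
  have "norm (\<integral>x. \<phi> x * f x \<partial>torus) = norm (\<integral>w. (\<integral>z. \<phi> (z, w * z) * f (z, w * z) \<partial>circle) \<partial>circle)"
    using integral_shear(1)[OF \<phi>f] by simp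
  also have "\<dots> \<le> (\<integral>w. norm (\<integral>z. \<phi> (z, w * z) * f (z, w * z) \<partial>circle) \<partial>circle)"
    by (rule integral_norm_bound)
  also have "\<dots> \<le> (\<integral>w. C * (\<integral>z. norm (f (z, w * z)) \<partial>circle) \<partial>circle)"
    using integral_shear(2)[OF \<phi>f] integral_shear(2)[OF nf] fiber by (intro integral_mono_AE) auto
  also have "\<dots> = C * (\<integral>x. norm (f x) \<partial>torus)"
    using integral_shear(1)[OF nf] by simp
  finally show ?thesis .
qed

text \<open>The error bound is \<open>C\<close> itself, without an additional epsilon, because
  extension and representation both keep the constant. As \<phi> and \<psi> induce the same
  functional on the test functions, their difference has no coefficients with
  \<open>m + n < 0\<close>.\<close>

lemma exists_H1_approximant:
  assumes \<phi>: "\<phi> \<in> Linf torus" and C: "C \<ge> 0"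
    and hb: "AE w in circle. hankel_bounded (\<lambda>k. component \<phi> (- (int k + 1)) w) C"
  obtains g where "g \<in> H1" "Linf_norm torus (\<lambda>x. \<phi> x - g x) \<le> ennreal C"
proof -
  have H1i: "integrable torus f" if "f \<in> H1_test" for f
    using that by (simp add: H1_test_def)
  have \<phi>i: "integrable torus (\<lambda>x. \<phi> x * f x)" if "f \<in> H1_test" for f
    by (rule Linf_mult_integrable[OF \<phi> H1i[OF that]])
  obtain \<Lambda> where \<Lambda>: "\<And>f g. integrable torus f \<Longrightarrow> integrable torus g \<Longrightarrow> \<Lambda> (\<lambda>x. f x + g x) = \<Lambda> f + \<Lambda> g"
    "\<And>c f. integrable torus f \<Longrightarrow> \<Lambda> (\<lambda>x. c * f x) = c * \<Lambda> f"
    "\<And>f. integrable torus f \<Longrightarrow> norm (\<Lambda> f) \<le> C * (\<integral>x. norm (f x) \<partial>torus)"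
    and \<Lambda>\<phi>: "\<And>f. f \<in> H1_test \<Longrightarrow> \<Lambda> f = (\<integral>x. \<phi> x * f x \<partial>torus)"
  proof (rule hahn_banach_L1[of C H1_test torus "\<lambda>f. \<integral>x. \<phi> x * f x \<partial>torus"])
    fix f g assume "f \<in> H1_test" "g \<in> H1_test"
    then show "(\<integral>x. \<phi> x * (f x + g x) \<partial>torus) = (\<integral>x. \<phi> x * f x \<partial>torus) + (\<integral>x. \<phi> x * g x \<partial>torus)"
      using \<phi>i by (simp add: distrib_left)
  next
    fix c f assume "f \<in> H1_test"
    show "(\<integral>x. \<phi> x * (c * f x) \<partial>torus) = c * (\<integral>x. \<phi> x * f x \<partial>torus)"
      by (simp add: mult.left_commute)
  qed (use C H1i H1_test_zero H1_test_add H1_test_scale H1_test_functional_bound[OF \<phi> C hb] in blast)+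
  obtain \<psi> where \<psi>: "\<psi> \<in> borel_measurable torus" "AE x in torus. norm (\<psi> x) \<le> C"
    and \<Lambda>\<psi>: "\<And>f. integrable torus f \<Longrightarrow> \<Lambda> f = (\<integral>x. \<psi> x * f x \<partial>torus)"
    by (rule finite_measure.L1_functional_representation[OF torus.finite_measure_axioms, of \<Lambda> C])
      (use \<Lambda> in blast)+
  have \<psi>L: "\<psi> \<in> Linf torus"
    using \<psi> by (auto simp: Linf_def)
  define g where "g x = \<phi> x - \<psi> x" for x
  have gL: "g \<in> Linf torus"
    unfolding g_def by (rule Linf_diff[OF \<phi> \<psi>L])
  have "fourier_coeff2 g m n = 0" if "m + n < 0" for m n
  proof -
    define e where "e x = fst x powi (- m) * snd x powi (- n)" for x :: "complex \<times> complex"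
    have e: "e \<in> H1_test"
      unfolding e_def by (rule H1_test_monomial[OF that])
    have "fourier_coeff2 g m n = (\<integral>x. \<phi> x * e x - \<psi> x * e x \<partial>torus)"
      by (simp add: fourier_coeff2_def e_def g_def left_diff_distrib mult.assoc)
    also have "\<dots> = (\<integral>x. \<phi> x * e x \<partial>torus) - (\<integral>x. \<psi> x * e x \<partial>torus)"
      by (intro Bochner_Integration.integral_diff \<phi>i[OF e] Linf_mult_integrable[OF \<psi>L H1i[OF e]])
    also have "\<dots> = 0"
      using \<Lambda>\<phi>[OF e] \<Lambda>\<psi>[OF H1i[OF e]] by simp
    finally show ?thesis .
  qed
  then have "g \<in> H1"
    using gL by (simp add: H1_def)
  moreover have "Linf_norm torus (\<lambda>x. \<phi> x - g x) \<le> ennreal C"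
  proof -
    have "AE x in torus. ennreal (norm (\<psi> x)) \<le> ennreal C"
      using \<psi>(2) by eventually_elim (rule ennreal_leI)
    then have "esssup torus (\<lambda>x. ennreal (norm (\<psi> x))) \<le> ennreal C"
      using \<psi>(1) by (intro esssup_I) auto
    then show ?thesis
      by (simp add: Linf_norm_def g_def)
  qed
  ultimately show thesis
    by (rule that)
qed

section \<open>Comparison of the operator norm with the distance\<close>

lemma Linf_norm_real:
  assumes "f \<in> Linf M"
  obtains D where "D \<ge> 0" "Linf_norm M f = ennreal D" "AE x in M. norm (f x) \<le> D"
proof -
  obtain C where "AE x in M. norm (f x) \<le> C"
    using Linf_bound[OF assms] by metis
  then have "AE x in M. ennreal (norm (f x)) \<le> ennreal C"
    by eventually_elim (rule ennreal_leI)
  then have "Linf_norm M f \<le> ennreal C"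
    unfolding Linf_norm_def using Linf_measurable[OF assms] by (intro esssup_I) auto
  then have "Linf_norm M f < top"
    using ennreal_less_top le_less_trans by blast
  then obtain D where D: "D \<ge> 0" "Linf_norm M f = ennreal D"
    by (cases "Linf_norm M f") auto
  moreover have "AE x in M. norm (f x) \<le> D"
    using esssup_AE[of "\<lambda>x. ennreal (norm (f x))" M]
    by eventually_elim (use D in \<open>auto simp: Linf_norm_def\<close>)
  ultimately show thesis
    by (rule that)
qed

lemma hankel_eq: "hankel \<phi> = (\<lambda>i j. mult_op (component \<phi> (- (int (i + j) + 1))))"
  by (simp add: hankel_def fun_eq_iff)

theorem theorem4p6:
  fixes \<phi> :: "complex \<times> complex \<Rightarrow> complex"
  assumes "\<phi> \<in> Linf torus"
  shows "block_op_norm circle (hankel \<phi>) = dist_inf \<phi> H1"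
proof (rule antisym)
  have c: "component \<phi> (- (int k + 1)) \<in> Linf circle" for k
    by (rule component(1)[OF assms])
  show "block_op_norm circle (hankel \<phi>) \<le> dist_inf \<phi> H1"
    unfolding dist_inf_def
  proof (rule INF_greatest)
    fix g assume "g \<in> H1"
    then have gL: "g \<in> Linf torus" and g0: "\<And>m n. m + n < 0 \<Longrightarrow> fourier_coeff2 g m n = 0"
      by (auto simp: H1_def)
    define \<psi> where "\<psi> x = \<phi> x - g x" for x
    have \<psi>L: "\<psi> \<in> Linf torus"
      unfolding \<psi>_def by (rule Linf_diff[OF assms gL])
    obtain D where D: "D \<ge> 0" "Linf_norm torus \<psi> = ennreal D" "AE x in torus. norm (\<psi> x) \<le> D"
      using Linf_norm_real[OF \<psi>L] .
    have "fourier_coeff2 \<phi> m n = fourier_coeff2 \<psi> m n" if "m + n < 0" for m n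
    proof -
      have i: "integrable torus (\<lambda>x. f x * fst x powi (- m) * snd x powi (- n))" if "f \<in> Linf torus" for f
        by (intro torus.Linf_integrable Linf_mult that powi_Linf_torus)
      have "fourier_coeff2 \<psi> m n = fourier_coeff2 \<phi> m n - fourier_coeff2 g m n"
        unfolding fourier_coeff2_def \<psi>_def using i[OF assms] i[OF gL]
        by (simp add: left_diff_distrib)
      then show ?thesis
        using g0[OF that] by simp
    qed
    then have hb: "AE w in circle. hankel_bounded (\<lambda>k. component \<phi> (- (int k + 1)) w) D"
      by (rule AE_hankel_bounded_component[OF assms \<psi>L _ D(3,1)])
    \<comment> \<open>The essential supremum \<open>D\<close> of the difference is itself one of the
      constants over which \<open>block_op_norm\<close> takes the infimum.\<close>
    have "block_op_norm circle (hankel \<phi>) \<le> ennreal D"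
      unfolding block_op_norm_def hankel_eq
      using hankel_block_image[OF Linf_measurable[OF c] hb D(1)] D(1) by (intro Inf_lower) blast
    then show "block_op_norm circle (hankel \<phi>) \<le> Linf_norm torus (\<lambda>x. \<phi> x - g x)"
      using D(2) by (simp add: \<psi>_def[abs_def])
  qed
  show "dist_inf \<phi> H1 \<le> block_op_norm circle (hankel \<phi>)"
    unfolding block_op_norm_def
  \<comment> \<open>Every admissible constant yields an element of \<open>H1\<close> whose distance
    from \<phi> is at most that constant.\<close>
  proof (rule Inf_greatest, clarify)
    fix C :: real
    assume C: "0 \<le> C" and H: "\<forall>F\<in>l2_L2 circle. \<exists>G\<in>l2_L2 circle.
      block_image circle (hankel \<phi>) F G \<and> l2_L2_norm circle G \<le> C * l2_L2_norm circle F"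
    have "AE w in circle. hankel_bounded (\<lambda>k. component \<phi> (- (int k + 1)) w) C"
      using H unfolding hankel_eq
      by (intro circle.AE_hankel_bounded_of_block_image[OF c]) blast
    then obtain g where "g \<in> H1" "Linf_norm torus (\<lambda>x. \<phi> x - g x) \<le> ennreal C"
      using exists_H1_approximant[OF assms C] by blast
    then show "dist_inf \<phi> H1 \<le> ennreal C"
      unfolding dist_inf_def by (rule INF_lower2[of g H1 "\<lambda>g. Linf_norm torus (\<lambda>x. \<phi> x - g x)"])
  qed
qed

end
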